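(* Let $D$ be a VFD. The following statements are equivalent. (1) $D$ is a weakly Matlis GCD-domain. (2) $D$ is a UVFD. (3) $D$ is a P$v$MD. (4) $D$ is a $t$-treed domain. (5) Each minimal prime ideal of each nonzero $t$-finite $t$-ideal of $D$ is minimal over a $t$-invertible $t$-ideal; that is, for each nonzero $t$-finite $t$-ideal $I$ of $D$ and every prime ideal $P$ minimal over $I$ there is a $t$-invertible $t$-ideal $J$ of $D$ such that $P$ is minimal over $J$. (6) $D$ is a $t$-finite conductor domain. (7) $D$ is a UMT-domain.
   Context: Let $D$ be an integral domain with quotient field $K$. An overring of $D$ is a subring of $K$ containing $D$. A nonzero nonunit $a\in D$ is a valuation element of $D$ if there is a valuation domain $V$ that is an overring of $D$ with $aV\cap D=aD$. $D$ is a VFD (valuation factorization domain) if every nonzero nonunit of $D$ is a finite product of valuation elements. Two elements $x,y\in D$ are incomparable if the ideals $xD$ and $yD$ are incomparable under inclusion; a finite sequence (or product) of incomparable elements means that entries with distinct indices are pairwise incomparable. $D$ is a UVFD (unique VFD) if (i) every nonzero nonunit of $D$ is a finite product of incomparable valuation elements of $D$, and (ii) whenever $n,m\in\mathbb{N}$ (positive integers) and $(a_i)_{i=1}^n$, $(b_j)_{j=1}^m$ are two sequences of incomparable valuation elements of $D$ with $\prod_{i=1}^n a_i=\prod_{j=1}^m b_j$, then $n=m$ and there is a permutation $\sigma$ of $\{1,\dots,n\}$ with $a_iD=b_{\sigma(i)}D$ for each $i$. For a nonzero fractional ideal $A$ of an integral domain $D$ let $A^{-1}=\{x\in K\mid xA\subseteq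 D\}$, $A_v=(A^{-1})^{-1}$ and $A_t=\bigcup\{I_v\mid I\subseteq A,\ I$ a nonzero finitely generated fractional ideal$\}$. $A$ is a $t$-ideal if $A_t=A$. A maximal $t$-ideal is a $t$-ideal maximal among proper integral $t$-ideals; a prime $t$-ideal is a (nonzero) prime ideal that is a $t$-ideal. A $t$-ideal $I$ is $t$-finite if $I=J_t$ for some nonzero finitely generated fractional ideal $J$. $A$ is $t$-invertible if $(AA^{-1})_t=D$. $D$ is a P$v$MD (Prüfer $v$-multiplication domain) if every nonzero finitely generated ideal is $t$-invertible. $D$ is a weakly Matlis domain if each nonzero nonunit lies in only finitely many maximal $t$-ideals and no two distinct maximal $t$-ideals contain a common nonzero prime ideal; a weakly Matlis GCD-domain is a GCD-domain that is weakly Matlis. $D$ is $t$-treed if the set of prime $t$-ideals of $D$ is treed under inclusion (any two prime $t$-ideals contained in a common prime $t$-ideal are comparable). $D$ is a $t$-finite conductor domain if the intersection of each two nonzero principal ideals of $D$ is $t$-finite. An upper to zero in the polynomial ring $D[X]$ is a nonzero prime ideal $Q$ of $D[X]$ with $Q\cap D=(0)$; $D$ is a UMT-domain if each upper to zero in $D[X]$ is a maximal $t$-ideal of $D[X]$. *)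

theory Defs
  imports
    "HOL-Computational_Algebra.Computational_Algebra"
    "HOL-Combinatorics.Permutations"
begin

text \<open>
  An integral domain is represented as a subring \<open>D\<close> of a field type \<open>'k\<close> such that every element
  of \<open>'k\<close> is a fraction of elements of \<open>D\<close>.  Thus the quotient field of \<open>D\<close> is the whole type
  \<open>'k\<close>, and the elements of \<open>D\<close>, its overrings and its fractional ideals all live in \<open>'k\<close>.
\<close>

definition is_subring :: "'k::field set \<Rightarrow> bool" where
  "is_subring R \<longleftrightarrow> 1 \<in> R \<and> (\<forall>x\<in>R. \<forall>y\<in>R. x - y \<in> R \<and> x * y \<in> R)"

definition domain_with_qf_UNIV :: "'k::field set \<Rightarrow> bool" where
  "domain_with_qf_UNIV D \<longleftrightarrow>
     is_subring D \<and> (\<forall>x. \<exists>a\<in>D. \<exists>b\<in>D. b \<noteq> 0 \<and> x = a / b)"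

definition overring :: "'k::field set \<Rightarrow> 'k set \<Rightarrow> bool" where
  "overring D V \<longleftrightarrow> is_subring V \<and> D \<subseteq> V"

text \<open>The condition forces the quotient field of \<open>V\<close> to be all of \<open>'k\<close>, as it is for an overring.\<close>

definition valuation_domain :: "'k::field set \<Rightarrow> bool" where
  "valuation_domain V \<longleftrightarrow> is_subring V \<and> (\<forall>x. x \<noteq> 0 \<longrightarrow> x \<in> V \<or> inverse x \<in> V)"

definition nonzero_nonunit :: "'k::field set \<Rightarrow> 'k \<Rightarrow> bool" where
  "nonzero_nonunit D a \<longleftrightarrow> a \<in> D \<and> a \<noteq> 0 \<and> \<not> (\<exists>b\<in>D. a * b = 1)"

definition principal :: "'k::field set \<Rightarrow> 'k \<Rightarrow> 'k set" where
  "principal D a = {a * x | x. x \<in> D}"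


section \<open>Valuation factorization domains\<close>

definition valuation_element :: "'k::field set \<Rightarrow> 'k \<Rightarrow> bool" where
  "valuation_element D a \<longleftrightarrow> nonzero_nonunit D a \<and>
     (\<exists>V. overring D V \<and> valuation_domain V \<and> principal V a \<inter> D = principal D a)"

definition VFD :: "'k::field set \<Rightarrow> bool" where
  "VFD D \<longleftrightarrow> (\<forall>x. nonzero_nonunit D x \<longrightarrow>
     (\<exists>(n::nat) a. n \<ge> 1 \<and> (\<forall>i\<in>{1..n}. valuation_element D (a i)) \<and> x = (\<Prod>i=1..n. a i)))"

definition incomparable :: "'k::field set \<Rightarrow> 'k \<Rightarrow> 'k \<Rightarrow> bool" where
  "incomparable D x y \<longleftrightarrow>
     \<not> principal D x \<subseteq> principal D y \<and> \<not> principal D y \<subseteq> principal D x"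

definition incomparable_val_seq :: "'k::field set \<Rightarrow> nat \<Rightarrow> (nat \<Rightarrow> 'k) \<Rightarrow> bool" where
  "incomparable_val_seq D n a \<longleftrightarrow>
     (\<forall>i\<in>{1..n}. valuation_element D (a i)) \<and>
     (\<forall>i\<in>{1..n}. \<forall>j\<in>{1..n}. i \<noteq> j \<longrightarrow> incomparable D (a i) (a j))"

definition UVFD :: "'k::field set \<Rightarrow> bool" where
  "UVFD D \<longleftrightarrow>
     (\<forall>x. nonzero_nonunit D x \<longrightarrow>
        (\<exists>n a. n \<ge> 1 \<and> incomparable_val_seq D n a \<and> x = (\<Prod>i=1..n. a i))) \<and>
     (\<forall>n m a b. n \<ge> 1 \<and> m \<ge> 1 \<and> incomparable_val_seq D n a \<and> incomparable_val_seq D m b \<and>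
        (\<Prod>i=1..n. a i) = (\<Prod>j=1..m. b j) \<longrightarrow>
        n = m \<and>
        (\<exists>\<sigma>. \<sigma> permutes {1..n} \<and> (\<forall>i\<in>{1..n}. principal D (a i) = principal D (b (\<sigma> i)))))"


section \<open>Fractional ideals and the \<open>v\<close>- and \<open>t\<close>-operations\<close>

definition submodule :: "'k::field set \<Rightarrow> 'k set \<Rightarrow> bool" where
  "submodule D A \<longleftrightarrow>
     0 \<in> A \<and> (\<forall>x\<in>A. \<forall>y\<in>A. x + y \<in> A) \<and> (\<forall>d\<in>D. \<forall>x\<in>A. d * x \<in> A)"

definition nonzero_fractional_ideal :: "'k::field set \<Rightarrow> 'k set \<Rightarrow> bool" where
  "nonzero_fractional_ideal D A \<longleftrightarrow>
     submodule D A \<and> A \<noteq> {0} \<and> (\<exists>d\<in>D. d \<noteq> 0 \<and> (\<forall>x\<in>A. d * x \<in> D))"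

definition nonzero_fg_fractional_ideal :: "'k::field set \<Rightarrow> 'k set \<Rightarrow> bool" where
  "nonzero_fg_fractional_ideal D A \<longleftrightarrow>
     nonzero_fractional_ideal D A \<and> (\<exists>S. finite S \<and> A = submodule D hull S)"

definition ideal_mult :: "'k::field set \<Rightarrow> 'k set \<Rightarrow> 'k set \<Rightarrow> 'k set" where
  "ideal_mult D A B = submodule D hull {a * b | a b. a \<in> A \<and> b \<in> B}"

definition ideal_inverse :: "'k::field set \<Rightarrow> 'k set \<Rightarrow> 'k set" where
  "ideal_inverse D A = {x. \<forall>a\<in>A. x * a \<in> D}"

definition v_closure :: "'k::field set \<Rightarrow> 'k set \<Rightarrow> 'k set" where
  "v_closure D A = ideal_inverse D (ideal_inverse D A)"

definition t_closure :: "'k::field set \<Rightarrow> 'k set \<Rightarrow> 'k set" where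
  "t_closure D A = \<Union> {v_closure D I | I. nonzero_fg_fractional_ideal D I \<and> I \<subseteq> A}"

text \<open>A \<open>t\<close>-ideal is nonzero and may be fractional; integral ones are those contained in \<open>D\<close>.\<close>

definition t_ideal :: "'k::field set \<Rightarrow> 'k set \<Rightarrow> bool" where
  "t_ideal D A \<longleftrightarrow> nonzero_fractional_ideal D A \<and> t_closure D A = A"

definition maximal_t_ideal :: "'k::field set \<Rightarrow> 'k set \<Rightarrow> bool" where
  "maximal_t_ideal D M \<longleftrightarrow>
     t_ideal D M \<and> M \<subset> D \<and> (\<forall>N. t_ideal D N \<and> N \<subset> D \<and> M \<subseteq> N \<longrightarrow> N = M)"

text \<open>The zero ideal counts as prime here.\<close>

definition prime_ideal :: "'k::field set \<Rightarrow> 'k set \<Rightarrow> bool" where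
  "prime_ideal D P \<longleftrightarrow>
     submodule D P \<and> P \<subset> D \<and> (\<forall>x\<in>D. \<forall>y\<in>D. x * y \<in> P \<longrightarrow> x \<in> P \<or> y \<in> P)"

definition prime_t_ideal :: "'k::field set \<Rightarrow> 'k set \<Rightarrow> bool" where
  "prime_t_ideal D P \<longleftrightarrow> prime_ideal D P \<and> t_ideal D P"

definition minimal_prime_over :: "'k::field set \<Rightarrow> 'k set \<Rightarrow> 'k set \<Rightarrow> bool" where
  "minimal_prime_over D I P \<longleftrightarrow>
     prime_ideal D P \<and> I \<subseteq> P \<and> (\<forall>Q. prime_ideal D Q \<and> I \<subseteq> Q \<and> Q \<subseteq> P \<longrightarrow> Q = P)"

definition t_finite_t_ideal :: "'k::field set \<Rightarrow> 'k set \<Rightarrow> bool" where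
  "t_finite_t_ideal D I \<longleftrightarrow>
     t_ideal D I \<and> (\<exists>J. nonzero_fg_fractional_ideal D J \<and> I = t_closure D J)"

definition t_invertible :: "'k::field set \<Rightarrow> 'k set \<Rightarrow> bool" where
  "t_invertible D A \<longleftrightarrow>
     nonzero_fractional_ideal D A \<and> t_closure D (ideal_mult D A (ideal_inverse D A)) = D"


section \<open>Classes of domains\<close>

definition PvMD :: "'k::field set \<Rightarrow> bool" where
  "PvMD D \<longleftrightarrow> (\<forall>I. nonzero_fg_fractional_ideal D I \<and> I \<subseteq> D \<longrightarrow> t_invertible D I)"

definition divides_in :: "'k::field set \<Rightarrow> 'k \<Rightarrow> 'k \<Rightarrow> bool" where
  "divides_in D x y \<longleftrightarrow> (\<exists>d\<in>D. y = x * d)"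

definition GCD_domain :: "'k::field set \<Rightarrow> bool" where
  "GCD_domain D \<longleftrightarrow>
     (\<forall>x\<in>D. \<forall>y\<in>D. x \<noteq> 0 \<and> y \<noteq> 0 \<longrightarrow>
        (\<exists>g\<in>D. divides_in D g x \<and> divides_in D g y \<and>
           (\<forall>c\<in>D. divides_in D c x \<and> divides_in D c y \<longrightarrow> divides_in D c g)))"

definition weakly_Matlis :: "'k::field set \<Rightarrow> bool" where
  "weakly_Matlis D \<longleftrightarrow>
     (\<forall>x. nonzero_nonunit D x \<longrightarrow> finite {M. maximal_t_ideal D M \<and> x \<in> M}) \<and>
     (\<forall>M N. maximal_t_ideal D M \<and> maximal_t_ideal D N \<and> M \<noteq> N \<longrightarrow>
        \<not> (\<exists>P. prime_ideal D P \<and> P \<noteq> {0} \<and> P \<subseteq> M \<and> P \<subseteq> N))"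

definition t_treed :: "'k::field set \<Rightarrow> bool" where
  "t_treed D \<longleftrightarrow>
     (\<forall>P Q M. prime_t_ideal D P \<and> prime_t_ideal D Q \<and> prime_t_ideal D M \<and> P \<subseteq> M \<and> Q \<subseteq> M \<longrightarrow>
        P \<subseteq> Q \<or> Q \<subseteq> P)"

definition t_finite_conductor_domain :: "'k::field set \<Rightarrow> bool" where
  "t_finite_conductor_domain D \<longleftrightarrow>
     (\<forall>x\<in>D. \<forall>y\<in>D. x \<noteq> 0 \<and> y \<noteq> 0 \<longrightarrow> t_finite_t_ideal D (principal D x \<inter> principal D y))"

text \<open>
  \<open>D[X]\<close>, as a subring of its quotient field \<open>'k(X)\<close>, which is the type \<open>'k poly fract\<close>; the notions
  above therefore apply to it verbatim.
\<close>

definition poly_ring :: "'k::field set \<Rightarrow> 'k poly fract set" where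
  "poly_ring D = {to_fract p | p. \<forall>i. coeff p i \<in> D}"

definition upper_to_zero :: "'k::field set \<Rightarrow> 'k poly fract set \<Rightarrow> bool" where
  "upper_to_zero D Q \<longleftrightarrow>
     prime_ideal (poly_ring D) Q \<and> Q \<noteq> {0} \<and> Q \<inter> {to_fract [:d:] | d. d \<in> D} = {0}"

definition UMT_domain :: "'k::field set \<Rightarrow> bool" where
  "UMT_domain D \<longleftrightarrow> (\<forall>Q. upper_to_zero D Q \<longrightarrow> maximal_t_ideal (poly_ring D) Q)"

end

theory Submission
  imports Defs
begin

text \<open>
  Let \<open>D\<close> be a VFD.  All seven conditions turn out to be equivalent to one elementary condition on
  divisibility, called the chain property below (\<open>val_chains\<close>): two valuation elements with a common
  nonunit divisor are comparable.

  If \<open>aV \<inter> D = aD\<close> for a valuation overring \<open>V\<close>, then the same \<open>V\<close> serves for all divisors and all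
  powers of \<open>a\<close>.  Hence the divisors of each power of \<open>a\<close> form a chain (\<open>witness_divisors_chain\<close>),
  the radical of \<open>aD\<close> is a prime \<open>t\<close>-ideal (\<open>rad_prime_t_ideal\<close>), and two valuation elements are
  comparable as soon as one lies in the radical of the other (\<open>rad_comparable\<close>).  Two general properties
  of VFDs follow.  Every nonzero element is primal (\<open>all_primal\<close>), so \<open>D\<close> is a pre-Schreier domain:
  there are interpolating elements for divisibility (\<open>riesz_interpolation\<close>), and elements without common
  nonunit divisors have \<open>v\<close>-closure \<open>D\<close> (\<open>coprime_inverse\<close>).  And \<open>D\<close> is weakly Matlis: the maximal
  \<open>t\<close>-ideals containing a product of valuation elements \<open>c\<close> are among the sets of elements that share a
  nonunit divisor with one of the \<open>c\<close> (\<open>weakly_Matlis\<close>).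

  Necessity of the chain property rests on \<open>common_divisor_mult\<close>: the common divisors of two
  incomparable valuation elements are closed under products.  If all of them divide a single one, they
  are therefore units.  A gcd is such a common divisor; so is \<open>ab/l\<close> for a least common multiple \<open>l\<close>, which
  interpolation provides when \<open>aD \<inter> bD\<close> is \<open>t\<close>-finite, and so is a generator of \<open>(a, b)\<^sub>t\<close>, which
  interpolation provides when \<open>(a, b)\<close> is \<open>t\<close>-invertible.  The remaining conditions contradict a common
  nonunit divisor \<open>c\<close> of incomparable \<open>a\<close> and \<open>b\<close> as follows.  The radicals of \<open>a\<close> and \<open>b\<close> are
  incomparable prime \<open>t\<close>-ideals in the radical of \<open>c\<close>.  With \<open>b = c b'\<close>, the product \<open>ab = (ac) b'\<close> has
  two factorizations.  A prime minimal over \<open>(a, b)\<^sub>v\<close> that is minimal over a \<open>t\<close>-invertible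
  \<open>t\<close>-ideal is the radical of some \<open>e\<close>, but \<open>\<Inter>\<^sub>n e\<^sup>nD\<close> is a smaller prime containing \<open>a\<close> and \<open>b\<close>.
  Finally, the upper to zero of the polynomials that vanish at \<open>-b/a\<close> is contained in the larger
  \<open>t\<close>-ideal \<open>c D[X]\<close>.

  For the converse, the chain property lets one split off from two elements \<open>x\<close> and \<open>y\<close> a factor \<open>g\<close>
  such that \<open>{x/g, y/g}\<close> has \<open>v\<close>-closure \<open>D\<close> (\<open>val_chains_strong_gcd\<close>).  So \<open>D\<close> is a GCD domain, and
  the \<open>v\<close>-closure of each nonzero finitely generated integral ideal is principal, which settles the
  condition on minimal primes and shows that \<open>D\<close> is a PvMD and a \<open>t\<close>-finite conductor domain.
  Incomparable valuation elements have \<open>v\<close>-closure \<open>D\<close>, so \<open>D\<close> is \<open>t\<close>-treed, and comparability is an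
  equivalence relation on the valuation elements, which yields unique factorization.  An upper to
  zero is generated by a polynomial \<open>f\<close> whose coefficients have no common nonunit divisor, and \<open>f\<close>
  together with any nonzero constant has \<open>v\<close>-closure \<open>D[X]\<close>.  Both directions for uppers to zero use
  Gauss's lemma in the form \<open>gauss\<close>, which holds in each VFD: a nonzero constant that divides \<open>fg\<close> is
  a product of a divisor of \<open>f\<close> and a divisor of \<open>g\<close>.
\<close>


section \<open>Divisibility in a subring of a field\<close>

locale subdomain =
  fixes D :: "'k::field set"
  assumes is_subring: "is_subring D"
begin

abbreviation dvd_D :: "'k \<Rightarrow> 'k \<Rightarrow> bool" (infix "\<preceq>" 50) where
  "x \<preceq> y \<equiv> divides_in D x y"

lemma one_closed [simp]: "1 \<in> D"
  using is_subring by (simp add: is_subring_def)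

lemma diff_closed: "x \<in> D \<Longrightarrow> y \<in> D \<Longrightarrow> x - y \<in> D"
  using is_subring by (simp add: is_subring_def)

lemma mult_closed [intro]: "x \<in> D \<Longrightarrow> y \<in> D \<Longrightarrow> x * y \<in> D"
  using is_subring by (simp add: is_subring_def)

lemma zero_closed [simp]: "0 \<in> D"
  using diff_closed[of 1 1] by simp

lemma minus_closed: "x \<in> D \<Longrightarrow> - x \<in> D"
  using diff_closed[of 0 x] by simp

lemma add_closed [intro]: "x \<in> D \<Longrightarrow> y \<in> D \<Longrightarrow> x + y \<in> D"
  using diff_closed[of x "- y"] minus_closed[of y] by simp

lemma power_closed [intro]: "x \<in> D \<Longrightarrow> x ^ n \<in> D"
  by (induction n) auto

lemma prod_closed: "(\<And>i. i \<in> I \<Longrightarrow> f i \<in> D) \<Longrightarrow> prod f I \<in> D"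
  by (induction I rule: infinite_finite_induct) auto

lemma prod_mset_closed: "(\<And>x. x \<in># X \<Longrightarrow> x \<in> D) \<Longrightarrow> prod_mset X \<in> D"
  by (induction X) auto

lemma prod_list_closed: "set xs \<subseteq> D \<Longrightarrow> prod_list xs \<in> D"
  by (induction xs) auto

lemma dvd_D_I: "d \<in> D \<Longrightarrow> y = x * d \<Longrightarrow> x \<preceq> y"
  by (auto simp: divides_in_def)

lemma dvd_D_E:
  assumes "x \<preceq> y" obtains d where "d \<in> D" "y = x * d"
  using assms by (auto simp: divides_in_def)

lemma dvd_D_iff: "x \<noteq> 0 \<Longrightarrow> x \<preceq> y \<longleftrightarrow> y / x \<in> D"
  by (auto simp: divides_in_def intro: bexI[of _ "y / x"])

lemma one_dvd_D [simp]: "1 \<preceq> x \<longleftrightarrow> x \<in> D"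
  by (simp add: dvd_D_iff)

lemma dvd_D_refl [simp]: "x \<preceq> x"
  by (auto simp: divides_in_def intro: bexI[of _ 1])

lemma dvd_D_0 [simp]: "x \<preceq> 0"
  by (auto simp: divides_in_def intro: bexI[of _ 0])

lemma dvd_D_trans [trans]: "x \<preceq> y \<Longrightarrow> y \<preceq> z \<Longrightarrow> x \<preceq> z"
  unfolding divides_in_def by (metis mult.assoc mult_closed)

lemma dvd_D_multI: "x \<preceq> y \<Longrightarrow> d \<in> D \<Longrightarrow> x \<preceq> y * d"
  unfolding divides_in_def by (metis mult.assoc mult_closed)

lemma dvd_D_multI2: "x \<preceq> y \<Longrightarrow> d \<in> D \<Longrightarrow> x \<preceq> d * y"
  using dvd_D_multI[of x y d] by (simp add: mult.commute)

lemma dvd_D_triv [intro]: "d \<in> D \<Longrightarrow> x \<preceq> x * d"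
  by (auto simp: divides_in_def)

lemma dvd_D_triv2 [intro]: "d \<in> D \<Longrightarrow> x \<preceq> d * x"
  by (auto simp: divides_in_def mult.commute)

lemma dvd_D_add: "x \<preceq> y \<Longrightarrow> x \<preceq> z \<Longrightarrow> x \<preceq> y + z"
  unfolding divides_in_def by (metis add_closed distrib_left)

lemma dvd_D_sum: "(\<And>i. i \<in> I \<Longrightarrow> x \<preceq> f i) \<Longrightarrow> x \<preceq> sum f I"
  by (induction I rule: infinite_finite_induct) (auto intro: dvd_D_add)

lemma dvd_D_mult_mono: "x \<preceq> y \<Longrightarrow> x' \<preceq> y' \<Longrightarrow> x * x' \<preceq> y * y'"
  unfolding divides_in_def
  by (metis (no_types, opaque_lifting) mult.assoc mult.left_commute mult_closed)

lemma dvd_D_power_mono: "x \<preceq> y \<Longrightarrow> x ^ n \<preceq> y ^ n"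
  by (induction n) (auto intro: dvd_D_mult_mono)

lemma dvd_D_cancel: "c \<noteq> 0 \<Longrightarrow> c * x \<preceq> c * y \<longleftrightarrow> x \<preceq> y"
  unfolding divides_in_def by (simp add: mult.assoc)

lemma dvd_D_closed: "x \<in> D \<Longrightarrow> x \<preceq> y \<Longrightarrow> y \<in> D"
  by (auto elim: dvd_D_E)

lemma dvd_D_nonzero: "x \<preceq> y \<Longrightarrow> y \<noteq> 0 \<Longrightarrow> x \<noteq> 0"
  by (auto elim: dvd_D_E)

lemma nonzero_nonunit_iff: "nonzero_nonunit D a \<longleftrightarrow> a \<in> D \<and> a \<noteq> 0 \<and> \<not> a \<preceq> 1"
  unfolding nonzero_nonunit_def divides_in_def by metis

lemma mem_principal_iff: "y \<in> principal D x \<longleftrightarrow> x \<preceq> y"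
  by (auto simp: principal_def divides_in_def)

lemma principal_subset_iff: "principal D x \<subseteq> principal D y \<longleftrightarrow> y \<preceq> x"
  using dvd_D_trans by (auto simp: subset_iff mem_principal_iff)

lemma principal_eq_iff: "principal D x = principal D y \<longleftrightarrow> x \<preceq> y \<and> y \<preceq> x"
  using principal_subset_iff[of x y] principal_subset_iff[of y x] by blast

lemma incomparable_iff: "incomparable D x y \<longleftrightarrow> \<not> x \<preceq> y \<and> \<not> y \<preceq> x"
  by (auto simp: incomparable_def principal_subset_iff)


section \<open>The \<open>v\<close>- and \<open>t\<close>-operations on finite generating sets\<close>

abbreviation gen :: "'k set \<Rightarrow> 'k set" where
  "gen S \<equiv> submodule D hull S"

lemma submodule_Inter: "(\<And>A. A \<in> \<A> \<Longrightarrow> submodule D A) \<Longrightarrow> submodule D (\<Inter>\<A>)"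
  unfolding submodule_def by blast

lemma submodule_gen: "submodule D (gen S)"
  by (rule hull_in) (auto intro: submodule_Inter)

lemma gen_minimal: "S \<subseteq> A \<Longrightarrow> submodule D A \<Longrightarrow> gen S \<subseteq> A"
  by (rule hull_minimal)

lemma submodule_principal: "submodule D (principal D x)"
  by (auto simp: submodule_def mem_principal_iff intro: dvd_D_add dvd_D_multI2)

lemma submodule_D: "submodule D D"
  by (auto simp: submodule_def)

lemma mem_inverse_iff: "x \<in> ideal_inverse D A \<longleftrightarrow> (\<forall>a\<in>A. x * a \<in> D)"
  by (simp add: ideal_inverse_def)

lemma submodule_inverse: "submodule D (ideal_inverse D A)"
  by (auto simp: submodule_def mem_inverse_iff distrib_right mult.assoc)

lemma inverse_antimono: "A \<subseteq> B \<Longrightarrow> ideal_inverse D B \<subseteq> ideal_inverse D A"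
  by (auto simp: ideal_inverse_def)

lemma inverse_gen: "ideal_inverse D (gen S) = ideal_inverse D S"
proof
  show "ideal_inverse D (gen S) \<subseteq> ideal_inverse D S"
    by (intro inverse_antimono hull_subset)
  show "ideal_inverse D S \<subseteq> ideal_inverse D (gen S)"
  proof
    fix x assume x: "x \<in> ideal_inverse D S"
    have "gen S \<subseteq> {a. x * a \<in> D}"
    proof (rule gen_minimal)
      show "S \<subseteq> {a. x * a \<in> D}" using x by (auto simp: mem_inverse_iff)
      show "submodule D {a. x * a \<in> D}"
        by (auto simp: submodule_def distrib_left mult.left_commute[of x])
    qed
    then show "x \<in> ideal_inverse D (gen S)" by (auto simp: mem_inverse_iff)
  qed
qed

lemma v_closure_gen: "v_closure D (gen S) = v_closure D S"
  by (simp add: v_closure_def inverse_gen)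

lemma mem_v_closure_iff:
  "y \<in> v_closure D S \<longleftrightarrow> (\<forall>x. (\<forall>s\<in>S. x * s \<in> D) \<longrightarrow> x * y \<in> D)"
  by (auto simp: v_closure_def mem_inverse_iff mult.commute)

lemma v_closure_mono: "A \<subseteq> B \<Longrightarrow> v_closure D A \<subseteq> v_closure D B"
  unfolding v_closure_def by (intro inverse_antimono)

lemma subset_v_closure: "S \<subseteq> v_closure D S"
  by (auto simp: mem_v_closure_iff)

lemma submodule_v_closure: "submodule D (v_closure D S)"
  by (simp add: v_closure_def submodule_inverse)

lemma v_closure_singleton: "g \<noteq> 0 \<Longrightarrow> v_closure D {g} = principal D g"
proof (intro set_eqI iffI)
  fix y assume g: "g \<noteq> 0" and "y \<in> v_closure D {g}"
  then have "inverse g * y \<in> D" by (auto simp: mem_v_closure_iff)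
  then show "y \<in> principal D g" using g by (simp add: mem_principal_iff dvd_D_iff field_simps)
next
  fix y assume "y \<in> principal D g"
  then show "y \<in> v_closure D {g}"
    by (auto simp: mem_v_closure_iff mem_principal_iff mult.assoc[symmetric] elim!: dvd_D_E)
qed

lemma v_closure_subset_principal:
  assumes "g \<noteq> 0" "\<And>s. s \<in> S \<Longrightarrow> g \<preceq> s"
  shows "v_closure D S \<subseteq> principal D g"
proof
  fix y assume y: "y \<in> v_closure D S"
  have "\<forall>s\<in>S. inverse g * s \<in> D"
    using assms by (auto simp: dvd_D_iff field_simps)
  then have "inverse g * y \<in> D" using y by (auto simp: mem_v_closure_iff)
  then show "y \<in> principal D g"
    using assms(1) by (simp add: mem_principal_iff dvd_D_iff field_simps)
qed

lemma v_closure_subset_D: "S \<subseteq> D \<Longrightarrow> v_closure D S \<subseteq> D"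
  using v_closure_subset_principal[of 1 S] by (simp add: subset_iff mem_principal_iff)

lemma fractional_subset:
  "nonzero_fractional_ideal D A \<Longrightarrow> submodule D B \<Longrightarrow> B \<noteq> {0} \<Longrightarrow> B \<subseteq> A \<Longrightarrow>
    nonzero_fractional_ideal D B"
  unfolding nonzero_fractional_ideal_def by blast

lemma fractional_integral:
  "submodule D A \<Longrightarrow> A \<subseteq> D \<Longrightarrow> A \<noteq> {0} \<Longrightarrow> nonzero_fractional_ideal D A"
  unfolding nonzero_fractional_ideal_def by (intro conjI bexI[of _ 1]) auto

lemma gen_zero_iff: "gen S = {0} \<longleftrightarrow> S \<subseteq> {0}"
proof
  assume "gen S = {0}" then show "S \<subseteq> {0}" using hull_subset[of S "submodule D"] by auto
next
  assume "S \<subseteq> {0}"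
  then have "gen S \<subseteq> {0}" by (rule gen_minimal) (simp add: submodule_def)
  moreover have "0 \<in> gen S" using submodule_gen[of S] by (simp add: submodule_def)
  ultimately show "gen S = {0}" by blast
qed

lemma t_closure_eq:
  assumes "nonzero_fractional_ideal D A"
  shows "t_closure D A = \<Union> {v_closure D S | S. finite S \<and> S \<subseteq> A \<and> \<not> S \<subseteq> {0}}"
proof (intro equalityI subsetI)
  fix x assume "x \<in> t_closure D A"
  then obtain I where I: "nonzero_fg_fractional_ideal D I" "I \<subseteq> A" "x \<in> v_closure D I"
    by (auto simp: t_closure_def)
  then obtain S where S: "finite S" "I = gen S"
    by (auto simp: nonzero_fg_fractional_ideal_def)
  have "I \<noteq> {0}"
    using I by (auto simp: nonzero_fg_fractional_ideal_def nonzero_fractional_ideal_def)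
  then have "\<not> S \<subseteq> {0}" using S gen_zero_iff by blast
  moreover have "S \<subseteq> A" using S I hull_subset[of S "submodule D"] by blast
  ultimately show "x \<in> \<Union> {v_closure D S | S. finite S \<and> S \<subseteq> A \<and> \<not> S \<subseteq> {0}}"
    using S I(3) v_closure_gen by blast
next
  fix x assume "x \<in> \<Union> {v_closure D S | S. finite S \<and> S \<subseteq> A \<and> \<not> S \<subseteq> {0}}"
  then obtain S where S: "finite S" "S \<subseteq> A" "\<not> S \<subseteq> {0}" "x \<in> v_closure D S" by blast
  have sub: "submodule D A" using assms by (simp add: nonzero_fractional_ideal_def)
  have "gen S \<subseteq> A" using S sub by (intro gen_minimal)
  moreover have "nonzero_fg_fractional_ideal D (gen S)"
    unfolding nonzero_fg_fractional_ideal_def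
    using fractional_subset[OF assms submodule_gen] calculation S gen_zero_iff by blast
  ultimately show "x \<in> t_closure D A"
    unfolding t_closure_def using S v_closure_gen by blast
qed

lemma t_closure_subset_D: "A \<subseteq> D \<Longrightarrow> t_closure D A \<subseteq> D"
  unfolding t_closure_def using v_closure_subset_D by blast

lemma t_closure_gen:
  assumes "nonzero_fractional_ideal D (gen S)" "finite S"
  shows "t_closure D (gen S) = v_closure D S"
proof
  show "t_closure D (gen S) \<subseteq> v_closure D S"
    unfolding t_closure_def using v_closure_mono v_closure_gen by blast
  have "nonzero_fg_fractional_ideal D (gen S)"
    using assms by (auto simp: nonzero_fg_fractional_ideal_def)
  then show "v_closure D S \<subseteq> t_closure D (gen S)"
    unfolding t_closure_def using v_closure_gen by blast
qed

lemma t_idealI: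
  assumes A: "nonzero_fractional_ideal D A"
    and cl: "\<And>S. finite S \<Longrightarrow> S \<subseteq> A \<Longrightarrow> \<not> S \<subseteq> {0} \<Longrightarrow> v_closure D S \<subseteq> A"
  shows "t_ideal D A"
proof -
  obtain a where a: "a \<in> A" "a \<noteq> 0"
    using A by (auto simp: nonzero_fractional_ideal_def submodule_def)
  have "A \<subseteq> t_closure D A"
  proof
    fix x assume "x \<in> A"
    then have "finite {a, x}" "{a, x} \<subseteq> A" "\<not> {a, x} \<subseteq> {0}" using a by auto
    moreover have "x \<in> v_closure D {a, x}" using subset_v_closure by blast
    ultimately show "x \<in> t_closure D A" unfolding t_closure_eq[OF A] by blast
  qed
  moreover have "t_closure D A \<subseteq> A" unfolding t_closure_eq[OF A] using cl by blast
  ultimately show ?thesis using A by (auto simp: t_ideal_def)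
qed

lemma t_idealD:
  assumes "t_ideal D A" "finite S" "S \<subseteq> A"
  shows "v_closure D S \<subseteq> A"
proof -
  have A: "nonzero_fractional_ideal D A" using assms by (simp add: t_ideal_def)
  obtain a where a: "a \<in> A" "a \<noteq> 0"
    using A by (auto simp: nonzero_fractional_ideal_def submodule_def)
  have "v_closure D S \<subseteq> v_closure D (insert a S)" by (rule v_closure_mono) blast
  also have "\<dots> \<subseteq> t_closure D A"
    unfolding t_closure_eq[OF A] using a assms by (auto intro!: exI[of _ "insert a S"])
  finally show ?thesis using assms by (simp add: t_ideal_def)
qed

lemma t_ideal_submodule: "t_ideal D A \<Longrightarrow> submodule D A"
  by (simp add: t_ideal_def nonzero_fractional_ideal_def)

lemma submodule_one: "submodule D A \<Longrightarrow> 1 \<in> A \<Longrightarrow> D \<subseteq> A"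
  unfolding submodule_def by (metis mult.right_neutral subsetI)

lemma principal_nonzero: "x \<noteq> 0 \<Longrightarrow> principal D x \<noteq> {0}"
  using mem_principal_iff[of x x] by auto

lemma t_ideal_principal:
  assumes "g \<in> D" "g \<noteq> 0"
  shows "t_ideal D (principal D g)"
proof (rule t_idealI)
  show "nonzero_fractional_ideal D (principal D g)"
    using assms submodule_principal principal_nonzero
    by (intro fractional_integral) (auto simp: mem_principal_iff elim!: dvd_D_E)
  show "v_closure D S \<subseteq> principal D g" if "S \<subseteq> principal D g" for S
    using v_closure_subset_principal[of g S] that assms by (simp add: subset_iff mem_principal_iff)
qed

lemma v_closure_t_finite:
  assumes "finite S" "S \<subseteq> D" "\<not> S \<subseteq> {0}"
  shows "t_finite_t_ideal D (v_closure D S)"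
proof -
  have "gen S \<subseteq> D" using assms submodule_D by (intro gen_minimal)
  then have frac: "nonzero_fractional_ideal D (gen S)"
    using assms submodule_gen gen_zero_iff by (intro fractional_integral) auto
  then have "nonzero_fg_fractional_ideal D (gen S)" "v_closure D S = t_closure D (gen S)"
    using assms t_closure_gen by (auto simp: nonzero_fg_fractional_ideal_def)
  moreover have "t_ideal D (v_closure D S)"
  proof (rule t_idealI)
    show "nonzero_fractional_ideal D (v_closure D S)"
      using v_closure_subset_D[OF assms(2)] submodule_v_closure subset_v_closure[of S] assms(3)
      by (intro fractional_integral) auto
    show "v_closure D T \<subseteq> v_closure D S" if "T \<subseteq> v_closure D S" for T
      using that unfolding subset_iff mem_v_closure_iff by blast
  qed
  ultimately show ?thesis unfolding t_finite_t_ideal_def by blast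
qed

lemma t_finite_t_idealE:
  assumes "t_finite_t_ideal D I"
  obtains S where "finite S" "S \<subseteq> I" "\<not> S \<subseteq> {0}" "I = v_closure D S"
proof -
  obtain J where J: "nonzero_fg_fractional_ideal D J" "I = t_closure D J"
    using assms by (auto simp: t_finite_t_ideal_def)
  then obtain S where S: "finite S" "J = gen S" "nonzero_fractional_ideal D J"
    by (auto simp: nonzero_fg_fractional_ideal_def)
  then have "I = v_closure D S" using J t_closure_gen by blast
  moreover have "\<not> S \<subseteq> {0}"
    using S gen_zero_iff by (auto simp: nonzero_fractional_ideal_def)
  ultimately show ?thesis using that S subset_v_closure by blast
qed

text \<open>
  If finitely many elements of an ideal already have the \<open>v\<close>-closure \<open>gD\<close> of the ideal, then
  multiplying by \<open>1/g\<close> turns them into elements of \<open>A A\<^sup>-\<^sup>1\<close> whose \<open>v\<close>-closure is \<open>D\<close>.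
\<close>

lemma t_invertibleI:
  assumes A: "nonzero_fractional_ideal D A" and S: "finite S" "S \<subseteq> A"
    and S0: "\<not> S \<subseteq> {0}"
    and g: "g \<noteq> 0" "ideal_inverse D S = ideal_inverse D {g}" "A \<subseteq> principal D g"
  shows "t_invertible D A"
proof -
  let ?B = "ideal_mult D A (ideal_inverse D A)"
  have BD: "?B \<subseteq> D" unfolding ideal_mult_def
    by (rule gen_minimal) (auto simp: mem_inverse_iff mult.commute submodule_D)
  have ginv: "inverse g \<in> ideal_inverse D A"
    using g by (auto simp: mem_inverse_iff subset_iff mem_principal_iff dvd_D_iff field_simps)
  define T where "T = (\<lambda>s. s * inverse g) ` S"
  have TB: "T \<subseteq> ?B" unfolding ideal_mult_def T_def
    using S ginv by (blast intro: hull_inc)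
  have one: "1 \<in> v_closure D T"
  proof (unfold mem_v_closure_iff, intro allI impI)
    fix x assume "\<forall>s\<in>T. x * s \<in> D"
    then have "x * inverse g \<in> ideal_inverse D S"
      by (auto simp: T_def mem_inverse_iff mult_ac)
    then have "x * inverse g * g \<in> D" using g(2) by (simp add: mem_inverse_iff)
    then show "x * 1 \<in> D" using g(1) by (simp add: mult.assoc)
  qed
  have T0: "\<not> T \<subseteq> {0}" using S0 g by (auto simp: T_def)
  then have frac: "nonzero_fractional_ideal D ?B"
    using BD TB submodule_gen by (intro fractional_integral) (auto simp: ideal_mult_def)
  have "v_closure D T \<subseteq> t_closure D ?B"
    unfolding t_closure_eq[OF frac] using TB T0 S by (auto simp: T_def)
  moreover have "submodule D (v_closure D T)" by (rule submodule_v_closure)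
  ultimately have "D \<subseteq> t_closure D ?B" using one submodule_one by blast
  then show ?thesis
    using A t_closure_subset_D[OF BD] by (auto simp: t_invertible_def)
qed

end

section \<open>Valuation elements\<close>

lemma valuation_dvd_linear:
  "valuation_domain V \<Longrightarrow> divides_in V x y \<or> divides_in V y x"
proof -
  assume V: "valuation_domain V"
  then interpret subdomain V by unfold_locales (simp add: valuation_domain_def)
  show ?thesis
  proof (cases "x = 0 \<or> y = 0")
    case False
    then have "y / x \<in> V \<or> inverse (y / x) \<in> V"
      using V unfolding valuation_domain_def by (metis divide_eq_0_iff)
    then show ?thesis using False dvd_D_iff[of x y] dvd_D_iff[of y x] by simp
  qed (use dvd_D_0 in blast)
qed

lemma valuation_min:
  assumes V: "valuation_domain V"
  shows "finite S \<Longrightarrow> S \<noteq> {} \<Longrightarrow> \<exists>s\<in>S. \<forall>t\<in>S. divides_in V s t"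
proof (induction S rule: finite_ne_induct)
  case (singleton x)
  interpret subdomain V by unfold_locales (use V in \<open>simp add: valuation_domain_def\<close>)
  show ?case by simp
next
  case (insert x F)
  interpret subdomain V by unfold_locales (use V in \<open>simp add: valuation_domain_def\<close>)
  obtain s where s: "s \<in> F" "\<forall>t\<in>F. divides_in V s t" using insert by blast
  then show ?case
    using valuation_dvd_linear[OF V, of s x] dvd_D_trans dvd_D_refl by blast
qed

text \<open>
  Dropping the requirement that \<open>a\<close> be a nonunit makes the class closed under divisors and powers.
\<close>

definition val_witness :: "'k::field set \<Rightarrow> 'k set \<Rightarrow> 'k \<Rightarrow> bool" where
  "val_witness D V a \<longleftrightarrow> valuation_domain V \<and> D \<subseteq> V \<and> a \<in> D \<and> a \<noteq> 0 \<and>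
     (\<forall>x\<in>D. divides_in V a x \<longrightarrow> divides_in D a x)"

definition valuational :: "'k::field set \<Rightarrow> 'k \<Rightarrow> bool" where
  "valuational D a \<longleftrightarrow> (\<exists>V. val_witness D V a)"

context subdomain
begin

abbreviation val :: "'k \<Rightarrow> bool" where
  "val \<equiv> valuation_element D"

lemma dvd_D_overring: "D \<subseteq> V \<Longrightarrow> x \<preceq> y \<Longrightarrow> divides_in V x y"
  by (auto simp: divides_in_def)

lemma witness_subdomain: "val_witness D V a \<Longrightarrow> subdomain V"
  by unfold_locales (simp add: val_witness_def valuation_domain_def)

lemma val_iff: "val a \<longleftrightarrow> valuational D a \<and> \<not> a \<preceq> 1"
proof -
  have "principal V a \<inter> D = principal D a \<longleftrightarrow> (\<forall>x\<in>D. divides_in V a x \<longrightarrow> a \<preceq> x)"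
    if V: "valuation_domain V" "D \<subseteq> V" and a: "a \<in> D" for V
  proof -
    interpret V: subdomain V
      by unfold_locales (use V in \<open>simp add: valuation_domain_def\<close>)
    show ?thesis
      using dvd_D_overring[OF V(2), of a] dvd_D_closed[OF a]
      by (auto simp: set_eq_iff mem_principal_iff V.mem_principal_iff)
  qed
  note eq = this
  show ?thesis
  proof
    assume "val a"
    then obtain V where V: "nonzero_nonunit D a" "D \<subseteq> V" "valuation_domain V"
      "principal V a \<inter> D = principal D a"
      by (auto simp: valuation_element_def overring_def)
    have a: "a \<in> D" "a \<noteq> 0" "\<not> a \<preceq> 1" using V(1) by (simp_all add: nonzero_nonunit_iff)
    then have "val_witness D V a"
      using eq[OF V(3,2) a(1)] V unfolding val_witness_def by simp
    then show "valuational D a \<and> \<not> a \<preceq> 1" using a unfolding valuational_def by metis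
  next
    assume a: "valuational D a \<and> \<not> a \<preceq> 1"
    then obtain V where "val_witness D V a" by (auto simp: valuational_def)
    then have V: "valuation_domain V" "D \<subseteq> V" "a \<in> D" "a \<noteq> 0" "\<forall>x\<in>D. divides_in V a x \<longrightarrow> a \<preceq> x"
      by (auto simp: val_witness_def)
    then have "principal V a \<inter> D = principal D a" using eq by simp
    moreover have "overring D V" using V by (simp add: overring_def valuation_domain_def)
    moreover have "nonzero_nonunit D a" using a V by (simp add: nonzero_nonunit_iff)
    ultimately show "val a" using V(1) unfolding valuation_element_def by metis
  qed
qed

lemma valD: assumes "val a" shows "a \<in> D" "a \<noteq> 0" "\<not> a \<preceq> 1" "valuational D a"
  using assms unfolding val_iff by (auto simp: valuational_def val_witness_def)

lemma valuationalD: "valuational D a \<Longrightarrow> a \<in> D" "valuational D a \<Longrightarrow> a \<noteq> 0"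
  by (auto simp: valuational_def val_witness_def)

lemma witness_mult:
  assumes a: "val_witness D V a" and b: "val_witness D V b"
  shows "val_witness D V (a * b)"
proof -
  interpret V: subdomain V using a by (rule witness_subdomain)
  have "a * b \<preceq> x" if x: "x \<in> D" "divides_in V (a * b) x" for x
  proof -
    have "divides_in V a (a * b)" using b by (auto simp: val_witness_def)
    then have "divides_in V a x" using x(2) by (rule V.dvd_D_trans)
    then have "a \<preceq> x" using x(1) a by (simp add: val_witness_def)
    then obtain d where d: "d \<in> D" "x = a * d" by (rule dvd_D_E)
    then have "divides_in V b d"
      using x V.dvd_D_cancel[of a b d] a by (simp add: val_witness_def)
    then have "b \<preceq> d" using d b by (auto simp: val_witness_def)
    then show ?thesis using d dvd_D_mult_mono[of a a b d] by simp
  qed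
  then show ?thesis using a b by (auto simp: val_witness_def)
qed

lemma witness_one: "val_witness D V a \<Longrightarrow> val_witness D V 1"
  by (auto simp: val_witness_def)

lemma witness_power: "val_witness D V a \<Longrightarrow> val_witness D V (a ^ n)"
  by (induction n) (auto intro: witness_one witness_mult)

text \<open>
  Write \<open>a = bc\<close>.  If \<open>x \<in> bV \<inter> D\<close>, then \<open>xc \<in> aV \<inter> D = aD\<close>, and cancelling \<open>c\<close> gives \<open>x \<in> bD\<close>.
\<close>

lemma witness_dvd:
  assumes a: "val_witness D V a" and b: "b \<preceq> a" "b \<in> D"
  shows "val_witness D V b"
proof -
  interpret V: subdomain V using a by (rule witness_subdomain)
  obtain c where c: "c \<in> D" "a = b * c" using b by (auto elim: dvd_D_E)
  have nz: "b \<noteq> 0" "c \<noteq> 0" using a c by (auto simp: val_witness_def)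
  have "b \<preceq> x" if x: "x \<in> D" "divides_in V b x" for x
  proof -
    have "divides_in V a (x * c)" unfolding c using x by (intro V.dvd_D_mult_mono) auto
    then have "b * c \<preceq> x * c" using a c x by (auto simp: val_witness_def)
    then show ?thesis using dvd_D_cancel[of c b x] nz by (simp add: mult.commute)
  qed
  then show ?thesis using a b nz by (auto simp: val_witness_def)
qed

text \<open>In \<open>V\<close> one of \<open>b\<close> and \<open>c\<close> divides the other, and \<open>V\<close> is a witness for both.\<close>

lemma witness_divisors_chain:
  assumes a: "val_witness D V a" and "b \<preceq> a" "b \<in> D" "c \<preceq> a" "c \<in> D"
  shows "b \<preceq> c \<or> c \<preceq> b"
  using witness_dvd[OF a, of b] witness_dvd[OF a, of c] assms
    valuation_dvd_linear[of V b c] by (auto simp: val_witness_def)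

lemma valuational_dvd: "valuational D a \<Longrightarrow> b \<preceq> a \<Longrightarrow> b \<in> D \<Longrightarrow> valuational D b"
  using witness_dvd unfolding valuational_def by blast

lemma valuational_power: "valuational D a \<Longrightarrow> valuational D (a ^ n)"
  using witness_power unfolding valuational_def by blast

lemma valuational_mult_dvd:
  "valuational D a \<Longrightarrow> b \<preceq> a \<Longrightarrow> b \<in> D \<Longrightarrow> valuational D (a * b)"
  using witness_dvd witness_mult unfolding valuational_def by blast

lemma valuational_divisors_chain:
  "valuational D a \<Longrightarrow> b \<preceq> a \<Longrightarrow> b \<in> D \<Longrightarrow> c \<preceq> a \<Longrightarrow> c \<in> D \<Longrightarrow> b \<preceq> c \<or> c \<preceq> b"
  using witness_divisors_chain unfolding valuational_def by blast

lemma val_dvd: "val a \<Longrightarrow> b \<preceq> a \<Longrightarrow> b \<in> D \<Longrightarrow> \<not> b \<preceq> 1 \<Longrightarrow> val b"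
  using valuational_dvd by (auto simp: val_iff)

definition rad :: "'k \<Rightarrow> 'k set" where
  "rad a = {x \<in> D. \<exists>n. a \<preceq> x ^ n}"

lemma radI: "x \<in> D \<Longrightarrow> a \<preceq> x ^ n \<Longrightarrow> x \<in> rad a"
  by (auto simp: rad_def)

lemma mem_rad_self: "a \<in> D \<Longrightarrow> a \<in> rad a"
  using radI[of a a 1] by simp

lemma power_dvd_D: "x \<in> D \<Longrightarrow> n > 0 \<Longrightarrow> x \<preceq> x ^ n"
  by (cases n) auto

lemma rad_posE:
  assumes "x \<in> rad a" "\<not> a \<preceq> 1" obtains n where "n > 0" "a \<preceq> x ^ n" "x \<in> D"
proof -
  obtain n where n: "a \<preceq> x ^ n" "x \<in> D" using assms by (auto simp: rad_def)
  moreover have "n > 0" using n assms(2) by (cases n) simp_all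
  ultimately show ?thesis using that by simp
qed

text \<open>If \<open>a\<close> divides \<open>b\<^sup>n\<close>, both \<open>a\<close> and \<open>b\<close> lie in the chain of divisors of \<open>b\<^sup>n\<close>.\<close>

lemma rad_comparable:
  assumes "valuational D b" "a \<in> D" "\<not> a \<preceq> 1" "b \<in> rad a"
  shows "a \<preceq> b \<or> b \<preceq> a"
proof -
  obtain n where n: "n > 0" "a \<preceq> b ^ n" "b \<in> D" using assms(4,3) by (rule rad_posE)
  show ?thesis
    using valuational_divisors_chain[OF valuational_power[OF assms(1), of n], of a b] n assms(2)
      power_dvd_D[of b n] by blast
qed

lemma rad_dvd: "x \<in> rad a \<Longrightarrow> x \<preceq> y \<Longrightarrow> y \<in> rad a"
proof -
  assume "x \<in> rad a" "x \<preceq> y"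
  then obtain n where "x \<in> D" "a \<preceq> x ^ n" "x \<preceq> y" by (auto simp: rad_def)
  then show "y \<in> rad a"
    using radI[of y a n] dvd_D_trans[OF _ dvd_D_power_mono[of x y n]] dvd_D_closed[of x y] by simp
qed

text \<open>If \<open>x\<close> divides \<open>y\<close> in \<open>V\<close>, then \<open>x + y\<close> is a multiple of \<open>x\<close>, and \<open>y\<^sup>2\<close> is one of \<open>xy\<close>.\<close>

lemma rad_prime:
  assumes a: "val a"
  shows "prime_ideal D (rad a)"
proof -
  obtain V where V: "val_witness D V a" using a by (auto simp: val_iff valuational_def)
  interpret V: subdomain V using V by (rule witness_subdomain)
  have VV: "valuation_domain V" "D \<subseteq> V" using V by (auto simp: val_witness_def)
  have radV: "x \<in> rad a" if "x \<in> D" "divides_in V a (x ^ n)" for x n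
    using V that radI[of x a n] power_closed by (auto simp: val_witness_def)
  have add: "x + y \<in> rad a" if x: "x \<in> rad a" "y \<in> rad a" and xy: "divides_in V x y" for x y
  proof -
    obtain n where n: "a \<preceq> x ^ n" "x \<in> D" "y \<in> D" using x by (auto simp: rad_def)
    have "divides_in V x (x + y)" using xy by (intro V.dvd_D_add) auto
    then have "divides_in V (x ^ n) ((x + y) ^ n)" by (rule V.dvd_D_power_mono)
    then show ?thesis
      using V.dvd_D_trans[OF dvd_D_overring[OF VV(2) n(1)]] radV[of "x + y" n] n(2,3) by blast
  qed
  have prime: "y \<in> rad a"
    if x: "x \<in> D" "y \<in> D" and n: "a \<preceq> (x * y) ^ n" and xy: "divides_in V x y" for x y n
  proof -
    have "divides_in V (x * y) (y ^ 2)"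
      unfolding power2_eq_square using xy by (intro V.dvd_D_mult_mono) auto
    then have "divides_in V ((x * y) ^ n) ((y ^ 2) ^ n)" by (rule V.dvd_D_power_mono)
    then have "divides_in V a (y ^ (2 * n))"
      using V.dvd_D_trans[OF dvd_D_overring[OF VV(2) n]] by (simp add: power_mult)
    then show ?thesis using radV[OF x(2)] by blast
  qed
  show ?thesis unfolding prime_ideal_def submodule_def
  proof (intro conjI ballI impI psubsetI)
    show "0 \<in> rad a" using radI[of 0 a 1] by simp
    show "x + y \<in> rad a" if "x \<in> rad a" "y \<in> rad a" for x y
      using add[of x y] add[of y x] that valuation_dvd_linear[OF VV(1), of x y]
      by (auto simp: add.commute)
    show "d * x \<in> rad a" if "d \<in> D" "x \<in> rad a" for d x
      using that rad_dvd[of x a "d * x"] by blast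
    show "rad a \<subseteq> D" by (auto simp: rad_def)
    have "1 \<notin> rad a" using a by (auto simp: rad_def val_iff)
    then show "rad a \<noteq> D" by auto
    show "x \<in> rad a \<or> y \<in> rad a" if xy: "x \<in> D" "y \<in> D" "x * y \<in> rad a" for x y
    proof -
      obtain n where "a \<preceq> (x * y) ^ n" using xy by (auto simp: rad_def)
      then show ?thesis
        using prime[of x y n] prime[of y x n] xy valuation_dvd_linear[OF VV(1), of x y]
        by (auto simp: mult.commute)
    qed
  qed
qed

lemma prime_ideal_mult:
  "prime_ideal D P \<Longrightarrow> x \<in> D \<Longrightarrow> y \<in> D \<Longrightarrow> x * y \<in> P \<Longrightarrow> x \<in> P \<or> y \<in> P"
  by (simp add: prime_ideal_def)

lemma prime_ideal_not_unit: "prime_ideal D P \<Longrightarrow> u \<preceq> 1 \<Longrightarrow> u \<notin> P"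
proof
  assume P: "prime_ideal D P" "u \<preceq> 1" "u \<in> P"
  then obtain w where w: "w \<in> D" "1 = u * w" by (auto elim: dvd_D_E)
  then have "w * u \<in> P" using P by (simp add: prime_ideal_def submodule_def)
  then have "1 \<in> P" using w by (simp add: mult.commute)
  then show False using P submodule_one[of P] by (auto simp: prime_ideal_def)
qed

lemma prime_ideal_dvd: "prime_ideal D P \<Longrightarrow> x \<in> P \<Longrightarrow> x \<preceq> y \<Longrightarrow> y \<in> P"
  by (auto simp: prime_ideal_def submodule_def mult.commute elim!: dvd_D_E)

lemma prime_ideal_power:
  assumes "prime_ideal D P" "x \<in> D" "x ^ n \<in> P" shows "x \<in> P"
  using assms(3)
proof (induction n)
  case 0 then show ?case using prime_ideal_not_unit[OF assms(1), of 1] by simp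
next
  case (Suc n) then show ?case using prime_ideal_mult[OF assms(1), of x "x ^ n"] assms(2) by auto
qed

lemma prime_ideal_prod_mset:
  assumes P: "prime_ideal D P" and "\<And>x. x \<in># X \<Longrightarrow> x \<in> D" "prod_mset X \<in> P"
  shows "\<exists>x\<in>#X. x \<in> P"
  using assms(2,3)
proof (induction X)
  case empty then show ?case using prime_ideal_not_unit[OF P, of 1] by simp
next
  case (add x X)
  then show ?case using prime_ideal_mult[OF P, of x "prod_mset X"] prod_mset_closed[of X] by auto
qed

lemma prime_ideal_prod:
  assumes P: "prime_ideal D P"
  shows "finite I \<Longrightarrow> (\<And>i. i \<in> I \<Longrightarrow> f i \<in> D) \<Longrightarrow> prod f I \<in> P \<Longrightarrow> \<exists>i\<in>I. f i \<in> P"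
proof (induction I rule: finite_induct)
  case empty then show ?case using prime_ideal_not_unit[OF P, of 1] by simp
next
  case (insert i I)
  then show ?case using prime_ideal_mult[OF P, of "f i" "prod f I"] prod_closed[of I f] by auto
qed

lemma rad_subset_prime: "prime_ideal D P \<Longrightarrow> a \<in> P \<Longrightarrow> rad a \<subseteq> P"
proof
  fix x assume P: "prime_ideal D P" "a \<in> P" and "x \<in> rad a"
  then obtain n where "x \<in> D" "a \<preceq> x ^ n" by (auto simp: rad_def)
  then show "x \<in> P" using prime_ideal_power[OF P(1)] prime_ideal_dvd[OF P] by blast
qed

text \<open>
  A single \<open>n\<close> works for all products of \<open>n\<close> elements of \<open>S\<close>: an element of \<open>S\<close> that is
  smallest for the valuation divides the others in \<open>V\<close>, so an \<open>n\<close> with \<open>a | s\<^sup>n\<close> for this \<open>s\<close>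
  will do.  Then the factors from \<open>S\<close> are exchanged for factors \<open>y \<in> S\<^sub>v\<close> one at a time.
\<close>

lemma rad_prime_t_ideal:
  assumes a: "val a"
  shows "prime_t_ideal D (rad a)"
proof -
  obtain V where V: "val_witness D V a" using a by (auto simp: val_iff valuational_def)
  interpret V: subdomain V using V by (rule witness_subdomain)
  have VV: "valuation_domain V" "D \<subseteq> V" using V by (auto simp: val_witness_def)
  have rad_D: "rad a \<subseteq> D" by (auto simp: rad_def)
  have sub: "submodule D (rad a)" using rad_prime[OF a] by (simp add: prime_ideal_def)
  have "t_ideal D (rad a)"
  proof (rule t_idealI)
    show "nonzero_fractional_ideal D (rad a)"
      using mem_rad_self[of a] valD[OF a] by (intro fractional_integral sub rad_D) auto
    fix S assume S: "finite S" "S \<subseteq> rad a" "\<not> S \<subseteq> {0}"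
    then obtain s where s: "s \<in> S" "\<forall>t\<in>S. divides_in V s t"
      using valuation_min[OF VV(1) S(1)] by auto
    then obtain n where n: "a \<preceq> s ^ n" using S by (auto simp: rad_def)
    have SV: "divides_in V (s ^ length ws) (prod_list ws)" if "set ws \<subseteq> S" for ws
      using that
    proof (induction ws)
      case (Cons t ws)
      then show ?case using V.dvd_D_mult_mono[of s t "s ^ length ws" "prod_list ws"] s by simp
    qed simp
    have "p * y ^ k \<in> D"
      if y: "y \<in> v_closure D S" and "\<forall>ws. length ws = k \<and> set ws \<subseteq> S \<longrightarrow> p * prod_list ws \<in> D"
      for y k p
      using that(2)
    proof (induction k arbitrary: p)
      case 0
      then show ?case by simp
    next
      case (Suc k)
      have "p * y * prod_list ws \<in> D" if ws: "length ws = k" "set ws \<subseteq> S" for ws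
      proof -
        have "p * prod_list ws * t \<in> D" if "t \<in> S" for t
          using Suc.prems[rule_format, of "t # ws"] ws that by (simp add: mult_ac)
        then have "p * prod_list ws * y \<in> D" using y by (auto simp: mem_v_closure_iff)
        then show ?thesis by (simp add: mult_ac)
      qed
      then show ?case using Suc.IH[of "p * y"] by (simp add: mult_ac)
    qed
    note * = this[where k = n and p = "inverse a"]
    have "y \<in> rad a" if y: "y \<in> v_closure D S" for y
    proof -
      have "inverse a * prod_list ws \<in> D" if ws: "length ws = n" "set ws \<subseteq> S" for ws
      proof -
        have "divides_in V a (prod_list ws)"
          using SV[OF ws(2)] dvd_D_overring[OF VV(2) n] V.dvd_D_trans ws(1) by blast
        moreover have "prod_list ws \<in> D" using ws S rad_D by (intro prod_list_closed) auto
        ultimately have "a \<preceq> prod_list ws" using V by (auto simp: val_witness_def)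
        then show ?thesis using valD[OF a] by (simp add: dvd_D_iff field_simps)
      qed
      then have "a \<preceq> y ^ n" using *[OF y] valD[OF a] by (simp add: dvd_D_iff field_simps)
      then show ?thesis using radI[of y a n] y v_closure_subset_D[of S] S rad_D by blast
    qed
    then show "v_closure D S \<subseteq> rad a" by blast
  qed
  then show ?thesis using rad_prime[OF a] by (simp add: prime_t_ideal_def)
qed

end

section \<open>Primality of the elements of a VFD\<close>

locale vfd = subdomain +
  assumes fractions: "\<forall>x. \<exists>a\<in>D. \<exists>b\<in>D. b \<noteq> 0 \<and> x = a / b"
    and VFD: "VFD D"
begin

lemma factorization:
  assumes x: "x \<in> D" "x \<noteq> 0"
  obtains u X where "u \<in> D" "u \<preceq> 1" "\<And>z. z \<in># X \<Longrightarrow> val z" "x = u * prod_mset X"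
proof (cases "x \<preceq> 1")
  case True
  then show ?thesis using that[of x "{#}"] x by simp
next
  case False
  then have "nonzero_nonunit D x" using x by (simp add: nonzero_nonunit_iff)
  then obtain n a where a: "\<forall>i\<in>{1..n::nat}. val (a i)" "x = (\<Prod>i=1..n. a i)"
    using VFD unfolding VFD_def by blast
  have "x = prod_mset (image_mset a (mset_set {1..n}))"
    using a(2) by (simp add: prod_unfold_prod_mset)
  then show ?thesis using that[of 1 "image_mset a (mset_set {1..n})"] a(1) by auto
qed

lemma vfd_induct [consumes 2, case_names unit val_mult]:
  assumes x: "x \<in> D" "x \<noteq> 0"
    and unit: "\<And>u. u \<in> D \<Longrightarrow> u \<preceq> 1 \<Longrightarrow> P u"
    and step: "\<And>a x. val a \<Longrightarrow> x \<in> D \<Longrightarrow> x \<noteq> 0 \<Longrightarrow> P x \<Longrightarrow> P (a * x)"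
  shows "P x"
proof -
  obtain u X where u: "u \<in> D" "u \<preceq> 1" and X: "\<And>z. z \<in># X \<Longrightarrow> val z"
    and xu: "x = u * prod_mset X" using factorization[OF x] by blast
  have u0: "u \<noteq> 0" using dvd_D_nonzero[OF u(2)] by simp
  have "P (u * prod_mset X)" using X
  proof (induction X)
    case empty
    then show ?case using unit u by simp
  next
    case (add z X)
    have mem: "z \<in># X \<Longrightarrow> z \<in> D \<and> z \<noteq> 0" for z using valD[of z] add.prems by auto
    have "prod_mset X \<in> D" using mem by (intro prod_mset_closed) auto
    moreover have "prod_mset X \<noteq> 0" using mem by auto
    ultimately have "P (z * (u * prod_mset X))"
      using add.IH add.prems u(1) u0 step[of z "u * prod_mset X"] by (simp add: mult_closed)
    then show ?case by (simp add: mult_ac)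
  qed
  then show ?thesis using xu by simp
qed

lemma prime_ideal_val_divisor:
  assumes P: "prime_ideal D P" and x: "x \<in> P" "x \<noteq> 0"
  obtains a where "val a" "a \<in> P" "a \<preceq> x"
proof -
  have "x \<in> D" using P x by (auto simp: prime_ideal_def)
  then have "x \<in> P \<longrightarrow> (\<exists>a. val a \<and> a \<in> P \<and> a \<preceq> x)" using x(2)
  proof (induction x rule: vfd_induct)
    case (unit u)
    then show ?case using prime_ideal_not_unit[OF P] by blast
  next
    case (val_mult a x)
    show ?case
    proof
      assume "a * x \<in> P"
      then have "a \<in> P \<or> x \<in> P" using prime_ideal_mult[OF P] valD[of a] val_mult by blast
      then show "\<exists>b. val b \<and> b \<in> P \<and> b \<preceq> a * x"
      proof
        assume "a \<in> P" then show ?thesis using val_mult dvd_D_triv[of x a] by blast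
      next
        assume "x \<in> P"
        then obtain b where "val b" "b \<in> P" "b \<preceq> x" using val_mult by blast
        then show ?thesis using dvd_D_multI2[of b x a] valD[of a] val_mult by blast
      qed
    qed
  qed
  then show ?thesis using that x by blast
qed

definition primal :: "'a \<Rightarrow> bool" where
  "primal b \<longleftrightarrow> (\<forall>x\<in>D. \<forall>y\<in>D. b \<preceq> x * y \<longrightarrow>
     (\<exists>e\<in>D. \<exists>f\<in>D. b = e * f \<and> e \<preceq> x \<and> f \<preceq> y))"

lemma primalE:
  assumes "primal b" "x \<in> D" "y \<in> D" "b \<preceq> x * y"
  obtains e f where "e \<in> D" "f \<in> D" "b = e * f" "e \<preceq> x" "f \<preceq> y"
  using assms unfolding primal_def by metis

lemma primal_unit: "u \<in> D \<Longrightarrow> u \<preceq> 1 \<Longrightarrow> primal u"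
  unfolding primal_def using dvd_D_multI[of u 1] by (metis mult_1 one_closed one_dvd_D)

text \<open>
  Some valuation factor \<open>z\<close> of \<open>xy\<close> lies in the prime ideal \<open>rad a\<close>, hence is comparable with \<open>a\<close>.
  If \<open>a\<close> divides \<open>z\<close>, all of \<open>a\<close> goes to the side of \<open>z\<close>; otherwise \<open>z\<close> is cancelled on both
  sides, and the number of factors drops.
\<close>

lemma valuational_primal_prod_mset:
  assumes "valuational D a" "u \<in> D" "v \<in> D" "u \<preceq> 1" "v \<preceq> 1"
    and "\<And>z. z \<in># X + Y \<Longrightarrow> val z"
    and "a \<preceq> (u * prod_mset X) * (v * prod_mset Y)"
  shows "\<exists>e\<in>D. \<exists>f\<in>D. a = e * f \<and> e \<preceq> u * prod_mset X \<and> f \<preceq> v * prod_mset Y"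
  using assms
proof (induction "size X + size Y" arbitrary: a X Y u v rule: less_induct)
  case less
  have a: "a \<in> D" "a \<noteq> 0" using valuationalD[OF less.prems(1)] .
  have in_D: "z \<in> D" if "z \<in># X + Y" for z using valD[OF less.prems(6)[OF that]] by simp
  have XD: "u * prod_mset X \<in> D" "v * prod_mset Y \<in> D"
    using in_D less.prems by (auto intro!: prod_mset_closed)
  show ?case
  proof (cases "a \<preceq> 1")
    case True
    then have "a \<preceq> u * prod_mset X" using dvd_D_trans[of a 1 "u * prod_mset X"] XD by simp
    then show ?thesis
      using a XD by (intro bexI[of _ a] bexI[of _ 1]) auto
  next
    case False
    then have va: "val a" using less.prems by (simp add: val_iff)
    have P: "prime_ideal D (rad a)" using va by (rule rad_prime)
    have "(u * prod_mset X) * (v * prod_mset Y) \<in> rad a"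
      using radI[of "(u * prod_mset X) * (v * prod_mset Y)" a 1] less.prems(7)
        mult_closed[OF XD] by simp
    then have "(u * v) * prod_mset (X + Y) \<in> rad a" by (simp add: mult_ac)
    moreover have "u * v \<notin> rad a"
      using prime_ideal_not_unit[OF P, of "u * v"] dvd_D_mult_mono[of u 1 v 1] less.prems by simp
    ultimately have "prod_mset (X + Y) \<in> rad a"
      using prime_ideal_mult[OF P, of "u * v" "prod_mset (X + Y)"] less.prems(2,3) in_D
        prod_mset_closed[of "X + Y"] by blast
    then obtain z where z: "z \<in># X + Y" "z \<in> rad a"
      using prime_ideal_prod_mset[OF P, of "X + Y"] in_D by blast
    have vz: "val z" using less.prems z by blast
    have zz: "z \<in> D" "z \<noteq> 0" using valD[OF vz] by simp_all
    have comp: "a \<preceq> z \<or> z \<preceq> a" using rad_comparable[of z a] z(2) va vz valD by blast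
    \<comment> \<open>the two sides play the same role, so one argument serves both\<close>
    have main: "\<exists>e\<in>D. \<exists>f\<in>D. a = e * f \<and> e \<preceq> u * prod_mset X \<and> f \<preceq> v * prod_mset Y"
      if zX: "z \<in># X" and prems: "u \<in> D" "v \<in> D" "u \<preceq> 1" "v \<preceq> 1" "\<And>z. z \<in># X + Y \<Longrightarrow> val z"
        "a \<preceq> (u * prod_mset X) * (v * prod_mset Y)"
        and IH: "\<And>a X' Y'. size X' + size Y' < size X + size Y \<Longrightarrow> valuational D a \<Longrightarrow>
          (\<And>z. z \<in># X' + Y' \<Longrightarrow> val z) \<Longrightarrow> a \<preceq> (u * prod_mset X') * (v * prod_mset Y') \<Longrightarrow>
          \<exists>e\<in>D. \<exists>f\<in>D. a = e * f \<and> e \<preceq> u * prod_mset X' \<and> f \<preceq> v * prod_mset Y'"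
      for X Y u v
    proof -
      obtain X' where X': "X = add_mset z X'" using zX by (metis insert_DiffM)
      have "prod_mset X' \<in> D" "prod_mset Y \<in> D"
        using prems(5) valD X' by (auto intro!: prod_mset_closed)
      then have cl: "u * prod_mset X' \<in> D" "v * prod_mset Y \<in> D" using prems by auto
      have eq: "u * prod_mset X = z * (u * prod_mset X')" using X' by (simp add: mult_ac)
      from comp show ?thesis
      proof
        assume "a \<preceq> z"
        then have "a \<preceq> u * prod_mset X" unfolding eq using cl by (intro dvd_D_multI)
        then show ?thesis using a cl by (intro bexI[of _ a] bexI[of _ 1]) auto
      next
        assume za: "z \<preceq> a"
        then obtain a' where a': "a' \<in> D" "a = z * a'" by (rule dvd_D_E)
        have va': "valuational D a'"
          using valuational_dvd[OF less.prems(1), of a'] a' zz by auto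
        have "z * a' \<preceq> z * ((u * prod_mset X') * (v * prod_mset Y))"
          using prems(6) eq a' by (simp add: mult_ac)
        then have "a' \<preceq> (u * prod_mset X') * (v * prod_mset Y)" using dvd_D_cancel zz by blast
        then obtain e f where ef: "e \<in> D" "f \<in> D" "a' = e * f" "e \<preceq> u * prod_mset X'"
          "f \<preceq> v * prod_mset Y"
          using IH[of X' Y a'] va' X' prems(5) by auto
        have "z * e \<preceq> u * prod_mset X" unfolding eq using ef dvd_D_mult_mono by simp
        then show ?thesis using ef zz a'
          by (intro bexI[of _ "z * e"] bexI[of _ f]) (auto simp: mult_ac)
      qed
    qed
    show ?thesis
    proof (cases "z \<in># X")
      case True
      then show ?thesis using main[of X u v Y] less.prems less.hyps by blast
    next
      case False
      then have "z \<in># Y" using z by simp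
      have "\<exists>e\<in>D. \<exists>f\<in>D. a = e * f \<and> e \<preceq> v * prod_mset Y \<and> f \<preceq> u * prod_mset X"
      proof (rule main[OF \<open>z \<in># Y\<close> less.prems(3,2,5,4)])
        show "val z" if "z \<in># Y + X" for z using that less.prems(6) by auto
        show "a \<preceq> v * prod_mset Y * (u * prod_mset X)" using less.prems(7) by (simp add: mult_ac)
        fix a' X' Y'
        assume sz: "size X' + size Y' < size Y + size X" and a': "valuational D a'"
          and val': "\<And>z. z \<in># X' + Y' \<Longrightarrow> val z"
          and dvd': "a' \<preceq> v * prod_mset X' * (u * prod_mset Y')"
        have sz': "size Y' + size X' < size X + size Y" using sz by simp
        have dvd'': "a' \<preceq> u * prod_mset Y' * (v * prod_mset X')" using dvd' by (simp add: mult_ac)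
        have val'': "val z" if "z \<in># Y' + X'" for z using that val' by auto
        obtain e f where "e \<in> D" "f \<in> D" "a' = e * f" "e \<preceq> u * prod_mset Y'" "f \<preceq> v * prod_mset X'"
          using less.hyps[OF sz' a' less.prems(2-5) val'' dvd''] by blast
        then show "\<exists>e\<in>D. \<exists>f\<in>D. a' = e * f \<and> e \<preceq> v * prod_mset X' \<and> f \<preceq> u * prod_mset Y'"
          by (intro bexI[of _ f] bexI[of _ e]) (auto simp: mult_ac)
      qed
      then obtain e f where "e \<in> D" "f \<in> D" "a = e * f" "e \<preceq> v * prod_mset Y" "f \<preceq> u * prod_mset X"
        by blast
      then show ?thesis by (intro bexI[of _ f] bexI[of _ e]) (auto simp: mult_ac)
    qed
  qed
qed

lemma valuational_primal:
  assumes a: "valuational D a"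
  shows "primal a"
  unfolding primal_def
proof (intro ballI impI)
  fix x y assume x: "x \<in> D" and y: "y \<in> D" and dvd: "a \<preceq> x * y"
  have aD: "a \<in> D" using a by (rule valuationalD)
  consider "x = 0" | "y = 0" | "x \<noteq> 0" "y \<noteq> 0" by blast
  then show "\<exists>e\<in>D. \<exists>f\<in>D. a = e * f \<and> e \<preceq> x \<and> f \<preceq> y"
  proof cases
    case 1
    then show ?thesis using aD y by (intro bexI[of _ a] bexI[of _ 1]) auto
  next
    case 2
    then show ?thesis using aD x by (intro bexI[of _ 1] bexI[of _ a]) auto
  next
    case 3
    obtain u X where "u \<in> D" "u \<preceq> 1" "\<And>z. z \<in># X \<Longrightarrow> val z" "x = u * prod_mset X"
      using factorization[OF x 3(1)] by blast
    moreover obtain v Y where "v \<in> D" "v \<preceq> 1" "\<And>z. z \<in># Y \<Longrightarrow> val z" "y = v * prod_mset Y"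
      using factorization[OF y 3(2)] by blast
    ultimately show ?thesis
      using valuational_primal_prod_mset[OF a, of u v X Y] dvd by auto
  qed
qed

lemma primal_mult:
  assumes a: "primal a" and b: "primal b" "a \<in> D" "b \<in> D" "a \<noteq> 0"
  shows "primal (a * b)"
  unfolding primal_def
proof (intro ballI impI)
  fix x y assume x: "x \<in> D" "y \<in> D" "a * b \<preceq> x * y"
  have "a \<preceq> x * y" using dvd_D_trans[OF dvd_D_triv[OF b(3), of a] x(3)] .
  then obtain e f where ef: "e \<in> D" "f \<in> D" "a = e * f" "e \<preceq> x" "f \<preceq> y"
    using primalE[OF a x(1,2)] by blast
  then obtain x' y' where xy: "x' \<in> D" "y' \<in> D" "x = e * x'" "y = f * y'"
    by (auto elim!: dvd_D_E)
  have "a * b \<preceq> a * (x' * y')" using x(3) xy ef by (simp add: mult_ac)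
  then have "b \<preceq> x' * y'" using dvd_D_cancel b(4) by blast
  then obtain g h where gh: "g \<in> D" "h \<in> D" "b = g * h" "g \<preceq> x'" "h \<preceq> y'"
    using primalE[OF b(1) xy(1,2)] by blast
  have "e * g \<preceq> x" "f * h \<preceq> y"
    using xy gh dvd_D_mult_mono[of e e g x'] dvd_D_mult_mono[of f f h y'] by simp_all
  moreover have "a * b = (e * g) * (f * h)" using ef gh by (simp add: mult_ac)
  ultimately show "\<exists>e\<in>D. \<exists>f\<in>D. a * b = e * f \<and> e \<preceq> x \<and> f \<preceq> y"
    using mult_closed[OF ef(1) gh(1)] mult_closed[OF ef(2) gh(2)] by blast
qed

text \<open>So a VFD is a pre-Schreier domain.\<close>

lemma all_primal: "x \<in> D \<Longrightarrow> x \<noteq> 0 \<Longrightarrow> primal x"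
proof (induction x rule: vfd_induct)
  case (unit u) then show ?case by (rule primal_unit)
next
  case (val_mult a x)
  then show ?case using primal_mult[of a x] valuational_primal[of a] valD[of a] by blast
qed

text \<open>
  This says that \<open>{a, b}\<close> has \<open>v\<close>-closure \<open>D\<close>.  Since \<open>a\<close> divides \<open>(ua) b\<close>, it splits into a divisor of
  \<open>ua\<close> and a common divisor of \<open>a\<close> and \<open>b\<close>; the latter is a unit, so \<open>a\<close> divides \<open>ua\<close>.
\<close>

lemma coprime_inverse:
  assumes a: "a \<in> D" "a \<noteq> 0" and b: "b \<in> D"
    and cop: "\<And>d. d \<in> D \<Longrightarrow> d \<preceq> a \<Longrightarrow> d \<preceq> b \<Longrightarrow> d \<preceq> 1"
    and u: "u * a \<in> D" "u * b \<in> D"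
  shows "u \<in> D"
proof -
  have "a \<preceq> (u * a) * b" using dvd_D_triv2[OF u(2), of a] by (simp add: mult_ac)
  then obtain e f where ef: "e \<in> D" "f \<in> D" "a = e * f" "e \<preceq> u * a" "f \<preceq> b"
    using primalE[OF all_primal[OF a] u(1) b] by blast
  have "f \<preceq> 1" using cop[of f] ef dvd_D_triv2[of e f] by blast
  then have "a \<preceq> e" using dvd_D_mult_mono[of e e f 1] ef by simp
  then have "a \<preceq> u * a" using ef dvd_D_trans by blast
  then show ?thesis using a by (simp add: dvd_D_iff)
qed

text \<open>
  The element \<open>p = s/a\<close> divides \<open>(t/a)(s/b)\<close>.  Splitting \<open>p = ef\<close> accordingly gives \<open>z = ae = s/f\<close>.
\<close>

lemma riesz_2x2:
  assumes nz: "a \<noteq> 0" "b \<noteq> 0" "s \<noteq> 0" "t \<noteq> 0"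
    and dvd: "a \<preceq> s" "a \<preceq> t" "b \<preceq> s" "b \<preceq> t"
  shows "\<exists>z. a \<preceq> z \<and> b \<preceq> z \<and> z \<preceq> s \<and> z \<preceq> t"
proof -
  obtain p q r w where pq: "p \<in> D" "q \<in> D" "r \<in> D" "w \<in> D"
    "s = a * p" "t = a * q" "s = b * r" "t = b * w"
    using dvd by (elim dvd_D_E) blast
  have "(a * b) * (p * w) = s * t" using pq(5,8) by (simp add: mult_ac)
  also have "s * t = (a * b) * (q * r)" using pq(6,7) by (simp add: mult_ac)
  finally have pw: "p * w = q * r" using nz by simp
  have "p \<preceq> q * r" using pw dvd_D_triv[OF pq(4), of p] by simp
  moreover have p0: "p \<noteq> 0" using pq nz by auto
  ultimately obtain e f where ef: "e \<in> D" "f \<in> D" "p = e * f" "e \<preceq> q" "f \<preceq> r"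
    using primalE[OF all_primal[OF pq(1)] pq(2,3)] by blast
  then obtain q' r' where qr: "q' \<in> D" "r' \<in> D" "q = e * q'" "r = f * r'"
    by (auto elim!: dvd_D_E)
  have "f * (a * e) = f * (b * r')" using pq(5,7) ef(3) qr(4) by (metis mult.commute mult.left_commute)
  moreover have "f \<noteq> 0" using p0 ef(3) by auto
  ultimately have "a * e = b * r'" by simp
  moreover have "s = (a * e) * f" "t = (a * e) * q'" using pq ef qr by (simp_all add: mult_ac)
  ultimately show ?thesis using ef qr
    by (intro exI[of _ "a * e"]) (metis dvd_D_triv)
qed

lemma riesz_interpolation:
  assumes X: "finite X" "X \<noteq> {}" and S: "finite S" "S \<noteq> {}" and nz: "0 \<notin> X" "0 \<notin> S"
    and dvd: "\<And>x s. x \<in> X \<Longrightarrow> s \<in> S \<Longrightarrow> x \<preceq> s"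
  shows "\<exists>z. z \<noteq> 0 \<and> (\<forall>x\<in>X. x \<preceq> z) \<and> (\<forall>s\<in>S. z \<preceq> s)"
proof -
  have two: "\<exists>z. a \<preceq> z \<and> b \<preceq> z \<and> (\<forall>s\<in>S. z \<preceq> s)"
    if "a \<noteq> 0" "b \<noteq> 0" "\<And>s. s \<in> S \<Longrightarrow> a \<preceq> s" "\<And>s. s \<in> S \<Longrightarrow> b \<preceq> s" for a b
    using S nz(2) that(3,4)
  proof (induction S rule: finite_ne_induct)
    case (singleton s) then show ?case by auto
  next
    case (insert t S)
    then obtain z where z: "a \<preceq> z" "b \<preceq> z" "\<forall>s\<in>S. z \<preceq> s" by auto
    obtain s where "s \<in> S" using insert by blast
    then have z0: "z \<noteq> 0" using z(3) insert dvd_D_nonzero[of z s] by auto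
    have "\<exists>z'. a \<preceq> z' \<and> b \<preceq> z' \<and> z' \<preceq> z \<and> z' \<preceq> t"
      using insert.prems that(1,2) z0 z by (intro riesz_2x2) auto
    then obtain z' where z': "a \<preceq> z'" "b \<preceq> z'" "z' \<preceq> z" "z' \<preceq> t" by blast
    then have "\<forall>s\<in>S. z' \<preceq> s" using z(3) dvd_D_trans[of z' z] by blast
    then show ?case using z' by blast
  qed
  obtain s0 where s0: "s0 \<in> S" "s0 \<noteq> 0" using S nz by auto
  have "\<exists>z. (\<forall>x\<in>X. x \<preceq> z) \<and> (\<forall>s\<in>S. z \<preceq> s)"
    using X nz(1) dvd
  proof (induction X rule: finite_ne_induct)
    case (singleton x) then show ?case by (intro exI[of _ x]) auto
  next
    case (insert y X)
    then obtain z where z: "\<forall>x\<in>X. x \<preceq> z" "\<forall>s\<in>S. z \<preceq> s" by auto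
    have "z \<noteq> 0" using dvd_D_nonzero[of z s0] z s0 by blast
    then obtain z' where z': "y \<preceq> z'" "z \<preceq> z'" "\<forall>s\<in>S. z' \<preceq> s"
      using two[of y z] insert.prems z by auto
    then have "\<forall>x\<in>X. x \<preceq> z'" using z(1) dvd_D_trans[of _ z z'] by blast
    then show ?case using z' by blast
  qed
  then show ?thesis using dvd_D_nonzero[of _ s0] s0 by blast
qed

end

section \<open>Incomparable valuation elements with a common divisor\<close>

text \<open>
  The divisors of one valuation element always form a chain.  Together with this dual condition on
  multiples, that makes comparability an equivalence relation on the valuation elements: ordered by
  divisibility, they form a disjoint union of chains.
\<close>

definition (in subdomain) val_chains :: bool where
  "val_chains \<longleftrightarrow> (\<forall>a b c. val a \<and> val b \<and> val c \<and> c \<preceq> a \<and> c \<preceq> b \<longrightarrow> a \<preceq> b \<or> b \<preceq> a)"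

context vfd
begin

text \<open>
  The prime ideal \<open>rad a\<close> contains \<open>e a'\<close>, but not \<open>e\<close>, because it would then contain \<open>b\<close> as well.
\<close>

lemma cofactor_in_rad:
  assumes a: "val a" and b: "val b" and inc: "\<not> a \<preceq> b" "\<not> b \<preceq> a"
    and e: "e \<in> D" "e \<preceq> b" and a': "a' \<in> D" "a = e * a'"
  shows "a' \<in> rad a"
proof -
  have "e * a' \<in> rad a" using mem_rad_self[of a] valD[OF a] a' by simp
  moreover have "e \<notin> rad a"
  proof
    assume "e \<in> rad a"
    then have "b \<in> rad a" using rad_dvd e by blast
    then show False using rad_comparable[of b a] valD[OF a] valD[OF b] inc by blast
  qed
  ultimately show ?thesis using prime_ideal_mult[OF rad_prime[OF a]] e a' by blast
qed

text \<open>
  The common divisors of two incomparable valuation elements are closed under products.  Indeed, \<open>c\<close>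
  and the cofactor \<open>a' = a/e\<close> are comparable as divisors of \<open>a\<close>; but if \<open>a'\<close> divided \<open>c\<close>, it would
  divide \<open>b\<close>, and \<open>b\<close> would lie in \<open>rad a\<close>.
\<close>

lemma common_divisor_mult:
  assumes a: "val a" and b: "val b" and inc: "\<not> a \<preceq> b" "\<not> b \<preceq> a"
    and e: "e \<in> D" "e \<preceq> a" "e \<preceq> b" and c: "c \<in> D" "c \<preceq> a" "c \<preceq> b"
  shows "e * c \<preceq> a"
proof -
  obtain a' where a': "a' \<in> D" "a = e * a'" using e(2) by (rule dvd_D_E)
  have rad: "a' \<in> rad a" using cofactor_in_rad[OF a b inc e(1,3) a'] .
  have "a' \<preceq> a" using a' e by auto
  then have "c \<preceq> a' \<or> a' \<preceq> c"
    using valuational_divisors_chain[of a c a'] valD[OF a] c a' by blast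
  moreover have "\<not> a' \<preceq> c"
  proof
    assume "a' \<preceq> c"
    then have "b \<in> rad a" using rad_dvd[OF rad] dvd_D_trans c(3) by blast
    then show False using rad_comparable[of b a] valD[OF a] valD[OF b] inc by blast
  qed
  ultimately have "c \<preceq> a'" by blast
  then show ?thesis unfolding a'(2) using dvd_D_mult_mono[of e e c a'] by simp
qed

text \<open>
  If \<open>a\<close> and \<open>b\<close> are incomparable, a common divisor that all others divide is a unit, and then so are
  the others.
\<close>

lemma val_chainsI:
  assumes "\<And>a b. val a \<Longrightarrow> val b \<Longrightarrow>
    \<exists>g\<in>D. g \<preceq> a \<and> g \<preceq> b \<and> (\<forall>d\<in>D. d \<preceq> a \<longrightarrow> d \<preceq> b \<longrightarrow> d \<preceq> g)"
  shows "val_chains"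
  unfolding val_chains_def
proof (intro allI impI)
  fix a b c assume *: "val a \<and> val b \<and> val c \<and> c \<preceq> a \<and> c \<preceq> b"
  then have v: "val a" "val b" "val c" "c \<preceq> a" "c \<preceq> b" by blast+
  have c: "c \<in> D" using valD[OF v(3)] by simp
  obtain g where g: "g \<in> D" "g \<preceq> a" "g \<preceq> b" "\<And>d. d \<in> D \<Longrightarrow> d \<preceq> a \<Longrightarrow> d \<preceq> b \<Longrightarrow> d \<preceq> g"
    using assms[OF v(1,2)] by blast
  show "a \<preceq> b \<or> b \<preceq> a"
  proof (rule ccontr)
    assume "\<not> ?thesis"
    then have inc: "\<not> a \<preceq> b" "\<not> b \<preceq> a" by blast+
    have "g * c \<preceq> a" using common_divisor_mult[OF v(1,2) inc g(1-3) c v(4,5)] .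
    moreover have "g * c \<preceq> b"
      using common_divisor_mult[OF v(2,1) inc(2,1) g(1,3,2) c v(5,4)] .
    ultimately have "g * c \<preceq> g * 1" using g(4)[of "g * c"] g(1) c by (simp add: mult_closed)
    moreover have "g \<noteq> 0" using g(2) valD[OF v(1)] dvd_D_nonzero by blast
    ultimately have "c \<preceq> 1" using dvd_D_cancel by blast
    then show False using valD[OF v(3)] by simp
  qed
qed

lemma val_chains_if_GCD: "GCD_domain D \<Longrightarrow> val_chains"
proof (rule val_chainsI)
  fix a b assume GCD: "GCD_domain D" and "val a" "val b"
  then have "a \<in> D" "b \<in> D" "a \<noteq> 0 \<and> b \<noteq> 0" using valD by blast+
  then have "\<exists>g\<in>D. g \<preceq> a \<and> g \<preceq> b \<and> (\<forall>c\<in>D. c \<preceq> a \<and> c \<preceq> b \<longrightarrow> c \<preceq> g)"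
    using GCD unfolding GCD_domain_def by (elim ballE[of _ _ a] ballE[of _ _ b]) simp_all
  then show "\<exists>g\<in>D. g \<preceq> a \<and> g \<preceq> b \<and> (\<forall>d\<in>D. d \<preceq> a \<longrightarrow> d \<preceq> b \<longrightarrow> d \<preceq> g)"
    by (elim bexE) (intro bexI conjI; simp)
qed

text \<open>The greatest common divisor is \<open>ab/l\<close>.\<close>

lemma gcd_if_lcm:
  assumes ab: "a \<in> D" "b \<in> D" "a \<noteq> 0" "b \<noteq> 0"
    and l: "a \<preceq> l" "b \<preceq> l" "\<And>m. a \<preceq> m \<Longrightarrow> b \<preceq> m \<Longrightarrow> l \<preceq> m"
  shows "\<exists>g\<in>D. g \<preceq> a \<and> g \<preceq> b \<and> (\<forall>d\<in>D. d \<preceq> a \<longrightarrow> d \<preceq> b \<longrightarrow> d \<preceq> g)"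
proof -
  have "l \<preceq> a * b" using l(3) ab by auto
  then obtain g where g: "g \<in> D" "a * b = l * g" by (rule dvd_D_E)
  obtain x y where xy: "x \<in> D" "y \<in> D" "l = a * x" "l = b * y"
    using l(1,2) by (auto elim!: dvd_D_E)
  have "a * b = a * (x * g)" using g xy(3) by (simp add: mult_ac)
  then have b: "b = g * x" using ab by simp
  have "b * a = b * (y * g)" using g xy(4) by (simp add: mult_ac)
  then have a: "a = g * y" using ab by simp
  show ?thesis
  proof (intro bexI[of _ g] conjI ballI impI)
    show "g \<preceq> a" "g \<preceq> b" using a b xy by auto
    fix d assume d: "d \<in> D" "d \<preceq> a" "d \<preceq> b"
    then obtain r s where rs: "r \<in> D" "s \<in> D" "a = d * r" "b = d * s"
      by (auto elim!: dvd_D_E)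
    have "a \<preceq> d * r * s" "b \<preceq> d * r * s" using rs
      by (auto intro: dvd_D_I[of s] dvd_D_I[of r])
    then have "l \<preceq> d * r * s" by (rule l(3))
    then have "l * d \<preceq> (d * r * s) * d" using dvd_D_mult_mono by simp
    also have "(d * r * s) * d = l * g" using g rs by (simp add: mult_ac)
    finally have "l * d \<preceq> l * g" .
    moreover have "l \<noteq> 0" using g ab by auto
    ultimately show "d \<preceq> g" using dvd_D_cancel by blast
  qed (use g in simp)
qed

text \<open>
  In a pre-Schreier domain finitely many common multiples of \<open>a\<close> and \<open>b\<close> are divisible by a common
  multiple.  If their \<open>v\<close>-closure is all of \<open>aD \<inter> bD\<close>, that common multiple generates it.
\<close>

lemma val_chains_if_t_finite_conductor:
  assumes "t_finite_conductor_domain D"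
  shows "val_chains"
proof (rule val_chainsI)
  fix a b assume "val a" "val b"
  then have ab: "a \<in> D" "b \<in> D" "a \<noteq> 0" "b \<noteq> 0" using valD by blast+
  then have "t_finite_t_ideal D (principal D a \<inter> principal D b)"
    using assms by (auto simp: t_finite_conductor_domain_def)
  then obtain S where S: "finite S" "S \<subseteq> principal D a \<inter> principal D b" "\<not> S \<subseteq> {0}"
    "principal D a \<inter> principal D b = v_closure D S"
    by (rule t_finite_t_idealE)
  have "\<exists>z. z \<noteq> 0 \<and> (\<forall>x\<in>{a, b}. x \<preceq> z) \<and> (\<forall>s\<in>S - {0}. z \<preceq> s)"
    using S ab by (intro riesz_interpolation) (auto simp: subset_iff mem_principal_iff)
  then obtain z where z: "z \<noteq> 0" "a \<preceq> z" "b \<preceq> z" "\<forall>s\<in>S - {0}. z \<preceq> s" by auto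
  have "v_closure D S \<subseteq> principal D z"
  proof (rule v_closure_subset_principal[OF z(1)])
    show "z \<preceq> s" if "s \<in> S" for s using z(4) that by (cases "s = 0") auto
  qed
  then have "z \<preceq> m" if "a \<preceq> m" "b \<preceq> m" for m
    using that S(4) by (auto simp: mem_principal_iff set_eq_iff subset_iff)
  then show "\<exists>g\<in>D. g \<preceq> a \<and> g \<preceq> b \<and> (\<forall>d\<in>D. d \<preceq> a \<longrightarrow> d \<preceq> b \<longrightarrow> d \<preceq> g)"
    using gcd_if_lcm[OF ab z(2,3)] by blast
qed

lemma gen_finitary:
  assumes "x \<in> gen S" shows "\<exists>T. finite T \<and> T \<subseteq> S \<and> x \<in> gen T"
proof -
  define F where "F = {x. \<exists>T. finite T \<and> T \<subseteq> S \<and> x \<in> gen T}"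
  have FI: "y \<in> F" if "finite T" "T \<subseteq> S" "y \<in> gen T" for y T using that by (auto simp: F_def)
  have "submodule D F" unfolding submodule_def
  proof (intro conjI ballI)
    show "0 \<in> F" using submodule_gen[of "{}"] by (intro FI[of "{}"]) (auto simp: submodule_def)
    fix y z assume "y \<in> F" "z \<in> F"
    then obtain T U where T: "finite T" "T \<subseteq> S" "y \<in> gen T" and U: "finite U" "U \<subseteq> S" "z \<in> gen U"
      by (auto simp: F_def)
    have "y \<in> gen (T \<union> U)" "z \<in> gen (T \<union> U)"
      using T U hull_mono[of T "T \<union> U" "submodule D"] hull_mono[of U "T \<union> U" "submodule D"] by auto
    then have "y + z \<in> gen (T \<union> U)" using submodule_gen by (simp add: submodule_def)
    then show "y + z \<in> F" using T U by (intro FI[of "T \<union> U"]) auto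
  next
    fix d y assume "d \<in> D" "y \<in> F"
    then obtain T where T: "finite T" "T \<subseteq> S" "y \<in> gen T" by (auto simp: F_def)
    then have "d * y \<in> gen T" using submodule_gen[of T] \<open>d \<in> D\<close> by (simp add: submodule_def)
    then show "d * y \<in> F" using FI T by blast
  qed
  moreover have "S \<subseteq> F" by (auto intro!: FI[of "{_}"] hull_inc)
  ultimately have "gen S \<subseteq> F" by (intro gen_minimal)
  then show ?thesis using assms by (auto simp: F_def)
qed

lemma gen_finitary_set:
  assumes "finite F" "F \<subseteq> gen S" shows "\<exists>T. finite T \<and> T \<subseteq> S \<and> F \<subseteq> gen T"
  using assms
proof (induction F rule: finite_induct)
  case empty then show ?case by blast
next
  case (insert x F)
  then obtain T U where T: "finite T" "T \<subseteq> S" "F \<subseteq> gen T" and U: "finite U" "U \<subseteq> S" "x \<in> gen U"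
    using gen_finitary[of x S] by auto
  then show ?case
    using hull_mono[of T "T \<union> U" "submodule D"] hull_mono[of U "T \<union> U" "submodule D"]
    by (intro exI[of _ "T \<union> U"]) auto
qed

text \<open>
  \<open>D\<close> is the \<open>v\<close>-closure of finitely many products \<open>xu\<close> with \<open>x \<in> A\<close> and \<open>u \<in> A\<^sup>-\<^sup>1\<close>.  As \<open>ux' \<in> D\<close>
  for all these \<open>u\<close> and \<open>x'\<close>, each \<open>1/u\<close> divides each \<open>x'\<close>, and an element \<open>z\<close> in between generates
  \<open>A\<^sub>t\<close>.
\<close>

lemma t_invertible_principal:
  assumes "t_invertible D A"
  obtains z where "z \<noteq> 0" "z \<in> t_closure D A" "A \<subseteq> principal D z"
proof -
  let ?P = "{a * b | a b. a \<in> A \<and> b \<in> ideal_inverse D A}"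
  have frac: "nonzero_fractional_ideal D A"
    and "1 \<in> t_closure D (gen ?P)"
    using assms by (auto simp: t_invertible_def ideal_mult_def)
  then obtain I where I: "nonzero_fg_fractional_ideal D I" "I \<subseteq> gen ?P" "1 \<in> v_closure D I"
    by (auto simp: t_closure_def)
  then obtain S where S: "finite S" "I = gen S" "I \<noteq> {0}"
    by (auto simp: nonzero_fg_fractional_ideal_def nonzero_fractional_ideal_def)
  have S0: "\<not> S \<subseteq> {0}" using S gen_zero_iff by blast
  have "S \<subseteq> gen ?P" using I(2) S(2) hull_subset[of S "submodule D"] by blast
  from gen_finitary_set[OF S(1) this]
  obtain T where T: "finite T" "T \<subseteq> ?P" "S \<subseteq> gen T" by (elim exE conjE)
  have T0: "\<not> T \<subseteq> {0}" using T(3) S0 gen_zero_iff[of T] by auto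
  have "v_closure D S \<subseteq> v_closure D T" using v_closure_mono[OF T(3)] by (simp add: v_closure_gen)
  then have one: "1 \<in> v_closure D T" using I(3) S(2) by (auto simp: v_closure_gen)
  have "\<forall>t\<in>T. \<exists>w. t = fst w * snd w \<and> fst w \<in> A \<and> snd w \<in> ideal_inverse D A" using T(2) by force
  then obtain w where w: "\<And>t. t \<in> T \<Longrightarrow> t = fst (w t) * snd (w t)"
    "\<And>t. t \<in> T \<Longrightarrow> fst (w t) \<in> A" "\<And>t. t \<in> T \<Longrightarrow> snd (w t) \<in> ideal_inverse D A"
    by metis
  let ?T = "T - {0}"
  have nz: "fst (w t) \<noteq> 0 \<and> snd (w t) \<noteq> 0" if "t \<in> ?T" for t
    using w(1)[of t] that by (metis DiffD1 DiffD2 mult_zero_left mult_zero_right singletonI)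
  have inv: "snd (w t) * y \<in> D" if "t \<in> ?T" "y \<in> A" for t y
    using w(3)[of t] that by (simp add: mem_inverse_iff)
  let ?X = "(\<lambda>t. fst (w t)) ` ?T" and ?U = "(\<lambda>t. inverse (snd (w t))) ` ?T"
  have "\<exists>z. z \<noteq> 0 \<and> (\<forall>u\<in>?U. u \<preceq> z) \<and> (\<forall>x\<in>?X. z \<preceq> x)"
  proof (rule riesz_interpolation)
    show "finite ?U" "?U \<noteq> {}" "finite ?X" "?X \<noteq> {}" using T T0 by auto
    have "\<forall>t\<in>?T. fst (w t) \<noteq> 0 \<and> inverse (snd (w t)) \<noteq> 0" using nz by simp
    then show "0 \<notin> ?U" "0 \<notin> ?X" by (metis (no_types, lifting) imageE)+
    show "u \<preceq> x" if ux: "u \<in> ?U" "x \<in> ?X" for u x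
    proof -
      obtain t t' where t: "t \<in> ?T" "t' \<in> ?T" "u = inverse (snd (w t))" "x = fst (w t')"
        using ux by blast
      have "snd (w t) * fst (w t') \<in> D" using inv[OF t(1)] w(2) t(2) by blast
      then show ?thesis unfolding t(3,4) using nz[OF t(1)]
        by (simp add: dvd_D_iff divide_inverse mult.commute)
    qed
  qed
  then obtain z where z: "z \<noteq> 0" "\<And>t. t \<in> ?T \<Longrightarrow> inverse (snd (w t)) \<preceq> z"
    "\<And>t. t \<in> ?T \<Longrightarrow> z \<preceq> fst (w t)" by auto
  have one': "p \<in> D" if "\<And>t. t \<in> ?T \<Longrightarrow> p * t \<in> D" for p
  proof -
    have "\<forall>t\<in>T. p * t \<in> D" using that by (metis Diff_iff mult_zero_right singletonD zero_closed)
    then show ?thesis using one unfolding mem_v_closure_iff by (metis mult.right_neutral)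
  qed
  have "z \<preceq> y" if y: "y \<in> A" for y
  proof -
    have "inverse z * y * t \<in> D" if t: "t \<in> ?T" for t
    proof -
      have "fst (w t) / z \<in> D" using z(1) z(3)[OF t] by (simp add: dvd_D_iff)
      then have "(fst (w t) / z) * (snd (w t) * y) \<in> D" using inv[OF t y] by (rule mult_closed)
      also have "(fst (w t) / z) * (snd (w t) * y) = inverse z * y * t"
        using w(1)[of t] t by (simp add: field_simps)
      finally show ?thesis .
    qed
    then have "inverse z * y \<in> D" by (rule one')
    then show ?thesis using z(1) by (simp add: dvd_D_iff field_simps)
  qed
  then have "A \<subseteq> principal D z" by (auto simp: mem_principal_iff)
  moreover have "z \<in> v_closure D ?X"
  proof (unfold mem_v_closure_iff, intro allI impI)
    fix p assume p: "\<forall>x\<in>?X. p * x \<in> D"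
    have "p * z * t \<in> D" if t: "t \<in> ?T" for t
    proof -
      have "snd (w t) * z \<in> D" using z(2)[OF t] nz[OF t] by (simp add: dvd_D_iff field_simps)
      moreover have "p * fst (w t) \<in> D" using p t by blast
      ultimately have "(p * fst (w t)) * (snd (w t) * z) \<in> D" by (rule mult_closed[rotated])
      also have "(p * fst (w t)) * (snd (w t) * z) = p * z * t"
        using w(1)[of t] t by (simp add: field_simps)
      finally show ?thesis .
    qed
    then show "p * z \<in> D" by (rule one')
  qed
  moreover have "v_closure D ?X \<subseteq> t_closure D A"
  proof -
    obtain t where "t \<in> ?T" using T0 by blast
    then have "\<not> ?X \<subseteq> {0}" using nz[of t] by blast
    moreover have "finite ?X" "?X \<subseteq> A" using T(1) w(2) by auto
    ultimately show ?thesis unfolding t_closure_eq[OF frac] by blast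
  qed
  ultimately show ?thesis using that z(1) by blast
qed

lemma val_chains_if_PvMD:
  assumes "PvMD D" shows "val_chains"
proof (rule val_chainsI)
  fix a b assume "val a" "val b"
  then have ab: "a \<in> D" "b \<in> D" "a \<noteq> 0" "b \<noteq> 0" using valD by blast+
  let ?A = "gen {a, b}"
  have sub: "?A \<subseteq> D" using ab submodule_D by (intro gen_minimal) auto
  have frac: "nonzero_fractional_ideal D ?A"
    using sub ab submodule_gen gen_zero_iff[of "{a, b}"] by (intro fractional_integral) auto
  then have "nonzero_fg_fractional_ideal D ?A"
    unfolding nonzero_fg_fractional_ideal_def by (intro conjI exI[of _ "{a, b}"]) simp_all
  then have "t_invertible D ?A" using assms sub by (simp add: PvMD_def)
  then obtain z where z: "z \<noteq> 0" "z \<in> t_closure D ?A" "?A \<subseteq> principal D z"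
    by (rule t_invertible_principal)
  have zv: "z \<in> v_closure D {a, b}" using z(2) t_closure_gen[OF frac] by simp
  have "a \<in> ?A" "b \<in> ?A" by (auto intro: hull_inc)
  then have zab: "z \<preceq> a" "z \<preceq> b" using z(3) by (auto simp: mem_principal_iff)
  have "d \<preceq> z" if d: "d \<preceq> a" "d \<preceq> b" for d
  proof -
    have "d \<noteq> 0" using d ab dvd_D_nonzero by blast
    then have "v_closure D {a, b} \<subseteq> principal D d"
      using d by (intro v_closure_subset_principal) auto
    then show ?thesis using zv by (auto simp: mem_principal_iff)
  qed
  moreover have "z \<in> D" using zv v_closure_subset_D[of "{a, b}"] ab by auto
  ultimately show "\<exists>g\<in>D. g \<preceq> a \<and> g \<preceq> b \<and> (\<forall>d\<in>D. d \<preceq> a \<longrightarrow> d \<preceq> b \<longrightarrow> d \<preceq> g)"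
    using zab by blast
qed

text \<open>If \<open>c\<close> divides \<open>a\<close> and \<open>b\<close>, then \<open>rad c\<close> contains \<open>rad a\<close> and \<open>rad b\<close>.\<close>

lemma val_chains_if_t_treed:
  assumes "t_treed D" shows "val_chains"
  unfolding val_chains_def
proof (intro allI impI)
  fix a b c assume *: "val a \<and> val b \<and> val c \<and> c \<preceq> a \<and> c \<preceq> b"
  then have v: "val a" "val b" "val c" "c \<preceq> a" "c \<preceq> b" by blast+
  have "a \<in> rad c" "b \<in> rad c" using radI[of _ c 1] valD v by auto
  then have "rad a \<subseteq> rad c" "rad b \<subseteq> rad c"
    using rad_subset_prime[OF rad_prime[OF v(3)]] by blast+
  then have "rad a \<subseteq> rad b \<or> rad b \<subseteq> rad a"
    using assms rad_prime_t_ideal[OF v(1)] rad_prime_t_ideal[OF v(2)] rad_prime_t_ideal[OF v(3)]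
    unfolding t_treed_def by blast
  then have "a \<in> rad b \<or> b \<in> rad a" using mem_rad_self valD(1)[OF v(1)] valD(1)[OF v(2)] by blast
  then show "a \<preceq> b \<or> b \<preceq> a"
    using rad_comparable[of a b] rad_comparable[of b a] valD[OF v(1)] valD[OF v(2)] by blast
qed

text \<open>
  Let \<open>c\<close> be a nonunit dividing the incomparable elements \<open>a\<close> and \<open>b = c b'\<close>.  Then \<open>b'\<close> has the
  same radical as \<open>b\<close>, and \<open>(ac) b' = ab\<close> are two essentially different factorizations.
\<close>

lemma val_chains_if_UVFD:
  assumes "UVFD D" shows "val_chains"
  unfolding val_chains_def
proof (intro allI impI, rule ccontr)
  fix a b c assume *: "val a \<and> val b \<and> val c \<and> c \<preceq> a \<and> c \<preceq> b" and "\<not> (a \<preceq> b \<or> b \<preceq> a)"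
  then have v: "val a" "val b" "val c" "c \<preceq> a" "c \<preceq> b" and inc: "\<not> a \<preceq> b" "\<not> b \<preceq> a" by blast+
  note in_D = valD(1)[OF v(1)] valD(1)[OF v(2)] valD(1)[OF v(3)]
  obtain b' where b': "b' \<in> D" "b = c * b'" using v(5) by (rule dvd_D_E)
  have rad: "b' \<in> rad b"
    using cofactor_in_rad[OF v(2,1) inc(2,1) in_D(3) v(4) b'] .
  have b'b: "b' \<preceq> b" using b' in_D by auto
  have "\<not> b' \<preceq> 1"
  proof
    assume "b' \<preceq> 1"
    then have "b \<preceq> c" using dvd_D_mult_mono[of c c b' 1] b' by simp
    then show False using v(4) inc dvd_D_trans by blast
  qed
  then have vb': "val b'" using val_dvd v(2) b'b b'(1) by blast
  have aac: "a \<preceq> a * c" using in_D by auto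
  have nu: "\<not> a * c \<preceq> 1" using dvd_D_trans[OF aac, of 1] valD[OF v(1)] by blast
  then have vac: "val (a * c)" unfolding val_iff
    using valuational_mult_dvd[of a c] valD[OF v(1)] v(4) in_D by blast
  have inc': "\<not> a * c \<preceq> b'" "\<not> b' \<preceq> a * c"
  proof -
    show "\<not> a * c \<preceq> b'" using aac b'b inc(1) dvd_D_trans by blast
    show "\<not> b' \<preceq> a * c"
    proof
      assume "b' \<preceq> a * c"
      moreover have "a * c \<preceq> a ^ 2" unfolding power2_eq_square using v(4) dvd_D_mult_mono by simp
      ultimately have "a ^ 2 \<in> rad b" using rad_dvd[OF rad] dvd_D_trans by blast
      then have "a \<in> rad b" using prime_ideal_power[OF rad_prime[OF v(2)]] in_D by blast
      then show False using rad_comparable[of a b] valD[OF v(1)] valD[OF v(2)] inc by blast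
    qed
  qed
  define x y where "x = (\<lambda>i::nat. if i = 1 then a else b)"
    and "y = (\<lambda>i::nat. if i = 1 then a * c else b')"
  have two: "{1..2::nat} = {1, 2}" by auto
  have "incomparable_val_seq D 2 x" "incomparable_val_seq D 2 y"
    unfolding incomparable_val_seq_def incomparable_iff two x_def y_def
    using v inc vac vb' inc' by auto
  moreover have "(\<Prod>i=1..2. x i) = (\<Prod>i=1..2. y i)"
    unfolding two x_def y_def using b' by (simp add: mult_ac)
  ultimately obtain \<sigma> where s: "\<sigma> permutes {1..2::nat}"
    "\<forall>i\<in>{1..2}. principal D (x i) = principal D (y (\<sigma> i))"
    using assms unfolding UVFD_def by (metis one_le_numeral)
  have x1: "x 1 = a" by (simp add: x_def)
  have "principal D (x 1) = principal D (y (\<sigma> 1))" using s(2) by auto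
  then have "y (\<sigma> 1) \<preceq> a" "a \<preceq> y (\<sigma> 1)" unfolding principal_eq_iff x1 by blast+
  moreover have "y (\<sigma> 1) = a * c \<or> y (\<sigma> 1) = b'" by (simp add: y_def)
  ultimately consider "a * c \<preceq> a * 1" | "a \<preceq> b'" by auto
  then show False
  proof cases
    case 1
    then have "c \<preceq> 1" using dvd_D_cancel[of a c 1] valD[OF v(1)] by blast
    then show False using valD[OF v(3)] by blast
  next
    case 2
    then show False using b'b inc(1) dvd_D_trans by blast
  qed
qed

end

section \<open>Minimal primes of finitely generated \<open>t\<close>-ideals\<close>

context subdomain
begin

lemma prime_ideal_chain_Inter:
  assumes ne: "\<Q> \<noteq> {}" and P: "\<And>Q. Q \<in> \<Q> \<Longrightarrow> prime_ideal D Q"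
    and ch: "\<And>Q R. Q \<in> \<Q> \<Longrightarrow> R \<in> \<Q> \<Longrightarrow> Q \<subseteq> R \<or> R \<subseteq> Q"
  shows "prime_ideal D (\<Inter>\<Q>)"
proof -
  obtain Q0 where Q0: "Q0 \<in> \<Q>" using ne by blast
  have "submodule D (\<Inter>\<Q>)" using P by (intro submodule_Inter) (simp add: prime_ideal_def)
  moreover have "\<Inter>\<Q> \<subset> D" using P[OF Q0] Q0 unfolding prime_ideal_def by blast
  moreover have "x \<in> \<Inter>\<Q> \<or> y \<in> \<Inter>\<Q>" if xy: "x \<in> D" "y \<in> D" "x * y \<in> \<Inter>\<Q>" for x y
  proof (rule ccontr)
    assume "\<not> ?thesis"
    then obtain Q R where QR: "Q \<in> \<Q>" "x \<notin> Q" "R \<in> \<Q>" "y \<notin> R" by blast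
    have "x \<in> Q \<or> y \<in> Q" "x \<in> R \<or> y \<in> R"
      using prime_ideal_mult[OF P[OF QR(1)] xy(1,2)] prime_ideal_mult[OF P[OF QR(3)] xy(1,2)]
        xy(3) QR by auto
    then show False using ch[OF QR(1,3)] QR by blast
  qed
  ultimately show ?thesis by (simp add: prime_ideal_def)
qed

lemma minimal_prime_exists:
  assumes P: "prime_ideal D P" and I: "I \<subseteq> P"
  obtains Q where "minimal_prime_over D I Q" "Q \<subseteq> P"
proof -
  define \<A> where "\<A> = {Q. prime_ideal D Q \<and> I \<subseteq> Q \<and> Q \<subseteq> P}"
  have "\<exists>M\<in>uminus ` \<A>. \<forall>X\<in>uminus ` \<A>. M \<subseteq> X \<longrightarrow> X = M"
  proof (rule subset_Zorn_nonempty)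
    show "uminus ` \<A> \<noteq> {}" using P I by (auto simp: \<A>_def)
    fix \<C> assume C: "\<C> \<noteq> {}" "subset.chain (uminus ` \<A>) \<C>"
    define \<Q> where "\<Q> = uminus ` \<C>"
    have QA: "Q \<in> \<A>" if "Q \<in> \<Q>" for Q using that C(2) by (auto simp: \<Q>_def subset_chain_def)
    have "\<Q> \<noteq> {}" using C by (simp add: \<Q>_def)
    moreover have "Q \<subseteq> R \<or> R \<subseteq> Q" if "Q \<in> \<Q>" "R \<in> \<Q>" for Q R
      using that C(2) by (fastforce simp: \<Q>_def subset_chain_def)
    ultimately have "prime_ideal D (\<Inter>\<Q>)"
      using QA by (intro prime_ideal_chain_Inter) (auto simp: \<A>_def)
    moreover have "I \<subseteq> \<Inter>\<Q>" "\<Inter>\<Q> \<subseteq> P" using QA \<open>\<Q> \<noteq> {}\<close> by (auto simp: \<A>_def)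
    ultimately have "\<Inter>\<Q> \<in> \<A>" by (simp add: \<A>_def)
    moreover have "\<Union>\<C> = - \<Inter>\<Q>" by (auto simp: \<Q>_def)
    ultimately show "\<Union>\<C> \<in> uminus ` \<A>" by blast
  qed
  then obtain Q where Q: "Q \<in> \<A>" "\<forall>X\<in>uminus ` \<A>. - Q \<subseteq> X \<longrightarrow> X = - Q"
    by (elim bexE imageE) simp
  have "R = Q" if "R \<in> \<A>" "R \<subseteq> Q" for R
    using Q(2)[rule_format, of "- R"] that by simp
  then have "minimal_prime_over D I Q"
    using Q(1) unfolding minimal_prime_over_def \<A>_def by blast
  then show ?thesis using that Q(1) by (auto simp: \<A>_def)
qed

text \<open>
  If \<open>e\<^sup>m\<close> does not divide \<open>x\<close> and \<open>e\<^sup>n\<close> does not divide \<open>y\<close>, then \<open>xy\<close> divides \<open>e\<^sup>m\<^sup>+\<^sup>n\<close> in \<open>V\<close>, so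
  \<open>e\<^sup>m\<^sup>+\<^sup>n\<^sup>+\<^sup>1\<close> cannot divide \<open>xy\<close>.
\<close>

lemma powers_Inter_prime:
  assumes e: "val e"
  shows "prime_ideal D {x. \<forall>n. e ^ n \<preceq> x}"
proof -
  obtain V where V: "val_witness D V e" using e by (auto simp: val_iff valuational_def)
  interpret V: subdomain V using V by (rule witness_subdomain)
  have VV: "valuation_domain V" "D \<subseteq> V" using V by (auto simp: val_witness_def)
  have e0: "e \<noteq> 0" using valD[OF e] by simp
  have pow: "e ^ n \<preceq> x" if "x \<in> D" "divides_in V (e ^ n) x" for x n
    using witness_power[OF V, of n] that by (simp add: val_witness_def)
  let ?Q = "{x. \<forall>n. e ^ n \<preceq> x}"
  have "x \<in> ?Q \<or> y \<in> ?Q" if xy: "x \<in> D" "y \<in> D" "x * y \<in> ?Q" for x y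
  proof (rule ccontr)
    assume "\<not> ?thesis"
    then obtain m n where mn: "\<not> e ^ m \<preceq> x" "\<not> e ^ n \<preceq> y" by blast
    have "divides_in V x (e ^ m)" "divides_in V y (e ^ n)"
      using pow[OF xy(1), of m] pow[OF xy(2), of n] mn valuation_dvd_linear[OF VV(1)] by blast+
    then have "divides_in V (x * y) (e ^ (m + n))"
      unfolding power_add by (rule V.dvd_D_mult_mono)
    moreover have "e ^ Suc (m + n) \<preceq> x * y" using xy(3) by blast
    ultimately have "divides_in V (e ^ Suc (m + n)) (e ^ (m + n))"
      using V.dvd_D_trans dvd_D_overring[OF VV(2)] by blast
    then have "divides_in V (e ^ (m + n) * e) (e ^ (m + n) * 1)" by (simp add: mult.commute)
    then have "divides_in V e 1" using V.dvd_D_cancel[of "e ^ (m + n)" e 1] e0 by simp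
    then have "e \<preceq> 1" using V by (simp add: val_witness_def)
    then show False using valD[OF e] by simp
  qed
  moreover have "1 \<notin> ?Q"
  proof
    assume "1 \<in> ?Q"
    then have "e ^ 1 \<preceq> 1" by blast
    then show False using valD[OF e] by simp
  qed
  then have "?Q \<noteq> D" by auto
  moreover have "?Q \<subseteq> D"
  proof
    fix x assume "x \<in> ?Q"
    then have "e ^ 0 \<preceq> x" by blast
    then show "x \<in> D" by simp
  qed
  moreover have "submodule D ?Q"
    unfolding submodule_def using dvd_D_add dvd_D_multI2 by simp
  ultimately show ?thesis unfolding prime_ideal_def by blast
qed

end

context vfd
begin

text \<open>
  A prime minimal over a \<open>t\<close>-invertible \<open>t\<close>-ideal is \<open>rad e\<close> for a valuation element \<open>e\<close>.  If \<open>a\<close>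
  and \<open>b\<close> are incomparable and \<open>rad e\<close> contains both, then all powers of \<open>e\<close> divide \<open>a\<close> and \<open>b\<close>, and
  the smaller prime ideal of all common multiples of these powers contains \<open>{a, b}\<^sub>v\<close> already.
\<close>

lemma val_chains_if_minimal_primes:
  assumes min: "\<And>I P. I \<subseteq> D \<Longrightarrow> t_finite_t_ideal D I \<Longrightarrow> minimal_prime_over D I P \<Longrightarrow>
    \<exists>J. J \<subseteq> D \<and> t_ideal D J \<and> t_invertible D J \<and> minimal_prime_over D J P"
  shows "val_chains"
  unfolding val_chains_def
proof (intro allI impI, rule ccontr)
  fix a b c assume *: "val a \<and> val b \<and> val c \<and> c \<preceq> a \<and> c \<preceq> b" and "\<not> (a \<preceq> b \<or> b \<preceq> a)"
  then have v: "val a" "val b" "val c" "c \<preceq> a" "c \<preceq> b" and inc: "\<not> a \<preceq> b" "\<not> b \<preceq> a" by blast+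
  have ab: "a \<in> D" "b \<in> D" "a \<noteq> 0" "b \<noteq> 0" and c0: "c \<noteq> 0" using valD v by blast+
  let ?I = "v_closure D {a, b}"
  have I: "?I \<subseteq> D" "t_finite_t_ideal D ?I"
    using v_closure_subset_D[of "{a, b}"] v_closure_t_finite[of "{a, b}"] ab by auto
  have below: "?I \<subseteq> principal D d" if "d \<noteq> 0" "d \<preceq> a" "d \<preceq> b" for d
    using v_closure_subset_principal[of d "{a, b}"] that by blast
  have "?I \<subseteq> rad c"
    using below[OF c0 v(4,5)] I(1) radI[of _ c 1] by (simp add: subset_iff mem_principal_iff)
  then obtain P where P: "minimal_prime_over D ?I P"
    using minimal_prime_exists[OF rad_prime[OF v(3)], of ?I] by metis
  then obtain J where J: "t_ideal D J" "t_invertible D J" "minimal_prime_over D J P"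
    using min[OF I P] by blast
  obtain z where z: "z \<noteq> 0" "z \<in> t_closure D J" "J \<subseteq> principal D z"
    using J(2) by (rule t_invertible_principal)
  have primeP: "prime_ideal D P" and "J \<subseteq> P" using J(3) by (auto simp: minimal_prime_over_def)
  have "z \<in> P" using z(2) J(1) \<open>J \<subseteq> P\<close> by (auto simp: t_ideal_def)
  then obtain e where e: "val e" "e \<in> P" "e \<preceq> z"
    using prime_ideal_val_divisor[OF primeP _ z(1)] by blast
  have eD: "e \<in> D" "e \<noteq> 0" using valD[OF e(1)] by simp_all
  have "J \<subseteq> rad e"
  proof
    fix x assume "x \<in> J"
    then have "z \<preceq> x" "x \<in> D"
      using subsetD[OF z(3)] \<open>J \<subseteq> P\<close> primeP unfolding mem_principal_iff prime_ideal_def by blast+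
    then show "x \<in> rad e" using dvd_D_trans[OF e(3)] radI[of x e 1] by simp
  qed
  then have Pe: "P = rad e"
    using J(3) rad_prime[OF e(1)] rad_subset_prime[OF primeP e(2)]
    unfolding minimal_prime_over_def by blast
  have "a \<in> ?I" "b \<in> ?I" using subset_v_closure[of "{a, b}"] by auto
  then have abe: "a \<in> rad e" "b \<in> rad e" using P Pe by (auto simp: minimal_prime_over_def)
  have "e \<preceq> x" if x: "val x" "val y" "\<not> x \<preceq> y" "\<not> y \<preceq> x" "x \<in> rad e" "y \<in> rad e" for x y
  proof (rule ccontr)
    assume "\<not> e \<preceq> x"
    then have "x \<preceq> e" using rad_comparable[of x e] valD[OF x(1)] valD[OF e(1)] x(5) by blast
    moreover obtain n where "e \<preceq> y ^ n" using x(6) by (auto simp: rad_def)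
    ultimately have "x \<preceq> y ^ n" by (rule dvd_D_trans)
    then have "y \<in> rad x" using radI valD[OF x(2)] by blast
    then show False using rad_comparable[of y x] valD[OF x(1)] valD[OF x(2)] x(3,4) by blast
  qed
  then have eab: "e \<preceq> a" "e \<preceq> b" using v inc abe by blast+
  have pow: "e ^ n \<preceq> a \<and> e ^ n \<preceq> b" for n
  proof (induction n)
    case 0 then show ?case using ab by simp
  next
    case (Suc n)
    then have n: "e ^ n \<preceq> a" "e ^ n \<preceq> b" by blast+
    have "e ^ n \<in> D" using eD(1) by (rule power_closed)
    then have "e ^ n * e \<preceq> a" "e ^ n * e \<preceq> b"
      using common_divisor_mult[OF v(1,2) inc _ n eD(1) eab]
        common_divisor_mult[OF v(2,1) inc(2,1) _ n(2,1) eD(1) eab(2,1)] by blast+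
    then show ?case by (simp add: mult.commute)
  qed
  let ?Q = "{x. \<forall>n. e ^ n \<preceq> x}"
  have "?I \<subseteq> ?Q"
  proof
    fix x assume x: "x \<in> ?I"
    have "e ^ n \<preceq> x" for n
      using subsetD[OF below[of "e ^ n"] x] pow[of n] eD by (simp add: mem_principal_iff)
    then show "x \<in> ?Q" by blast
  qed
  moreover have "?Q \<subseteq> P"
  proof
    fix x assume "x \<in> ?Q"
    then have "e ^ 1 \<preceq> x" by blast
    then show "x \<in> P" using prime_ideal_dvd[OF primeP e(2)] by simp
  qed
  ultimately have "?Q = P"
    using P powers_Inter_prime[OF e(1)] unfolding minimal_prime_over_def by blast
  then have "e ^ 2 \<preceq> e" using e(2) by blast
  then have "e * e \<preceq> e * 1" by (simp add: power2_eq_square)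
  then show False using dvd_D_cancel[of e e 1] eD valD[OF e(1)] by blast
qed


section \<open>Greatest common divisors\<close>

text \<open>For \<open>x\<close> and \<open>y\<close> in \<open>D\<close> this says that \<open>{x, y}\<close> has \<open>v\<close>-closure \<open>D\<close>.\<close>

definition v_coprime :: "'a \<Rightarrow> 'a \<Rightarrow> bool" where
  "v_coprime x y \<longleftrightarrow> (\<forall>u. u * x \<in> D \<longrightarrow> u * y \<in> D \<longrightarrow> u \<in> D)"

lemma v_coprimeD: "v_coprime x y \<Longrightarrow> u * x \<in> D \<Longrightarrow> u * y \<in> D \<Longrightarrow> u \<in> D"
  by (simp add: v_coprime_def)

lemma v_coprime_sym: "v_coprime x y \<Longrightarrow> v_coprime y x"
  by (simp add: v_coprime_def)

lemma v_coprime_unit: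
  assumes "x \<preceq> 1" shows "v_coprime x y"
  unfolding v_coprime_def
proof (intro allI impI)
  fix u assume "u * x \<in> D"
  obtain w where w: "w \<in> D" "1 = x * w" using assms by (rule dvd_D_E)
  have "u = (u * x) * w" using w(2) by (metis mult.assoc mult.right_neutral)
  then show "u \<in> D" using \<open>u * x \<in> D\<close> w(1) by (metis mult_closed)
qed

lemma v_coprime_dvd:
  assumes xy: "v_coprime x y" and x': "x' \<preceq> x" shows "v_coprime x' y"
  unfolding v_coprime_def
proof (intro allI impI)
  fix u assume u: "u * x' \<in> D" "u * y \<in> D"
  obtain d where d: "d \<in> D" "x = x' * d" using x' by (rule dvd_D_E)
  have "u * x \<in> D" using mult_closed[OF u(1) d(1)] unfolding d(2) by (simp only: mult.assoc)
  then show "u \<in> D" using v_coprimeD[OF xy] u(2) by blast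
qed

lemma v_coprime_mult:
  assumes "v_coprime x y" "v_coprime x z" "y \<in> D" shows "v_coprime x (y * z)"
  unfolding v_coprime_def
proof (intro allI impI)
  fix u assume u: "u * x \<in> D" "u * (y * z) \<in> D"
  have "u * y * x = (u * x) * y" "u * y * z = u * (y * z)" by (simp_all add: mult_ac)
  then have "u * y \<in> D"
    using v_coprimeD[OF assms(2), of "u * y"] u(2) mult_closed[OF u(1) assms(3)] by metis
  then show "u \<in> D" using v_coprimeD[OF assms(1)] u(1) by blast
qed

text \<open>
  A greatest common divisor \<open>g\<close> for which, moreover, the \<open>v\<close>-closure of \<open>{x, y}\<close> is \<open>gD\<close>.  For
  products it can be assembled from those for the factors, so it suffices to look at valuation
  elements.
\<close>

definition strong_gcd :: "'a \<Rightarrow> 'a \<Rightarrow> 'a \<Rightarrow> bool" where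
  "strong_gcd g x y \<longleftrightarrow>
     g \<in> D \<and> (\<exists>x'\<in>D. \<exists>y'\<in>D. x = g * x' \<and> y = g * y' \<and> v_coprime x' y')"

lemma strong_gcdI:
  "g \<in> D \<Longrightarrow> x' \<in> D \<Longrightarrow> y' \<in> D \<Longrightarrow> x = g * x' \<Longrightarrow> y = g * y' \<Longrightarrow> v_coprime x' y' \<Longrightarrow>
    strong_gcd g x y"
  unfolding strong_gcd_def by blast

lemma strong_gcdE:
  assumes "strong_gcd g x y"
  obtains x' y' where "g \<in> D" "x' \<in> D" "y' \<in> D" "x = g * x'" "y = g * y'" "v_coprime x' y'"
  using assms unfolding strong_gcd_def by metis

lemma val_chains_v_coprime:
  assumes T: val_chains and v: "val a" "val b" and inc: "\<not> a \<preceq> b" "\<not> b \<preceq> a"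
  shows "v_coprime a b"
proof -
  have "d \<preceq> 1" if d: "d \<in> D" "d \<preceq> a" "d \<preceq> b" for d
  proof (rule ccontr)
    assume "\<not> d \<preceq> 1"
    then have "val d" using val_dvd[OF v(1)] d by blast
    then show False using T v d inc unfolding val_chains_def by blast
  qed
  then show ?thesis
    using coprime_inverse[of a b] valD[OF v(1)] valD[OF v(2)] unfolding v_coprime_def by blast
qed

lemma val_chains_strong_gcd_valuational:
  assumes T: val_chains and a: "valuational D a" and y: "y \<in> D" "y \<noteq> 0"
  shows "\<exists>g. strong_gcd g a y"
proof -
  have "\<forall>a. valuational D a \<longrightarrow> (\<exists>g. strong_gcd g a y)"
    using y
  proof (induction y rule: vfd_induct)
    case (unit u)
    show ?case
    proof (intro allI impI)
      fix a assume "valuational D a"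
      then have "strong_gcd 1 a u"
        using unit v_coprime_sym[OF v_coprime_unit[of u a]] valuationalD[of a]
        by (intro strong_gcdI[of 1 a u]) auto
      then show "\<exists>g. strong_gcd g a u" by blast
    qed
  next
    case (val_mult b y)
    have b: "b \<in> D" "b \<noteq> 0" using valD[OF val_mult(1)] by simp_all
    show ?case
    proof (intro allI impI)
      fix a assume va: "valuational D a"
      have a: "a \<in> D" "a \<noteq> 0" using valuationalD[OF va] .
      have by_closed: "b * y \<in> D" using b val_mult by blast
      consider "a \<preceq> 1" | "a \<preceq> b" | "b \<preceq> a" | "\<not> a \<preceq> 1" "\<not> a \<preceq> b" "\<not> b \<preceq> a" by blast
      then show "\<exists>g. strong_gcd g a (b * y)"
      proof cases
        case 1
        then have "strong_gcd 1 a (b * y)"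
          using a by_closed v_coprime_unit by (intro strong_gcdI[of 1 a "b * y"]) auto
        then show ?thesis by blast
      next
        case 2
        then obtain b' where b': "b' \<in> D" "b = a * b'" by (rule dvd_D_E)
        have "b' * y \<in> D" using b' val_mult by blast
        then have "strong_gcd a a (b * y)"
          using a b' v_coprime_unit[of 1] by (intro strong_gcdI[of a 1 "b' * y"]) auto
        then show ?thesis by blast
      next
        case 3
        then obtain a' where a': "a' \<in> D" "a = b * a'" by (rule dvd_D_E)
        then have "valuational D a'" using valuational_dvd[OF va, of a'] b by auto
        then obtain k where "strong_gcd k a' y" using val_mult.IH by blast
        then obtain a2 y2 where k: "k \<in> D" "a2 \<in> D" "y2 \<in> D" "a' = k * a2" "y = k * y2"
          "v_coprime a2 y2" by (rule strong_gcdE)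
        have "strong_gcd (b * k) a (b * y)"
          by (rule strong_gcdI[of _ a2 y2]) (use k a' b in \<open>auto simp: mult_ac\<close>)
        then show ?thesis by blast
      next
        case 4
        then have "val a" using va by (simp add: val_iff)
        then have ab: "v_coprime a b" using val_chains_v_coprime[OF T] val_mult(1) 4 by blast
        obtain k where "strong_gcd k a y" using val_mult.IH va by blast
        then obtain a2 y2 where k: "k \<in> D" "a2 \<in> D" "y2 \<in> D" "a = k * a2" "y = k * y2"
          "v_coprime a2 y2" by (rule strong_gcdE)
        have "a2 \<preceq> a" using k by auto
        then have "v_coprime a2 b" using v_coprime_dvd[OF ab] by blast
        then have "v_coprime a2 (b * y2)" using v_coprime_mult k(6) b by blast
        moreover have "b * y2 \<in> D" using b k by blast
        ultimately have "strong_gcd k a (b * y)"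
          using k by (intro strong_gcdI[of k a2 "b * y2"]) (auto simp: mult_ac)
        then show ?thesis by blast
      qed
    qed
  qed
  then show ?thesis using a by blast
qed

lemma val_chains_strong_gcd:
  assumes T: val_chains and x: "x \<in> D" "x \<noteq> 0" and y: "y \<in> D" "y \<noteq> 0"
  shows "\<exists>g. strong_gcd g x y"
proof -
  have "\<forall>y\<in>D. y \<noteq> 0 \<longrightarrow> (\<exists>g. strong_gcd g x y)"
    using x
  proof (induction x rule: vfd_induct)
    case (unit u)
    show ?case
    proof (intro ballI impI)
      fix y assume "y \<in> D"
      then have "strong_gcd 1 u y"
        using unit v_coprime_unit[of u y] by (intro strong_gcdI[of 1 u y]) auto
      then show "\<exists>g. strong_gcd g u y" by blast
    qed
  next
    case (val_mult a x)
    show ?case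
    proof (intro ballI impI)
      fix y assume y: "y \<in> D" "y \<noteq> 0"
      obtain g where "strong_gcd g x y" using val_mult.IH y by blast
      then obtain x1 y1 where g: "g \<in> D" "x1 \<in> D" "y1 \<in> D" "x = g * x1" "y = g * y1"
        "v_coprime x1 y1" by (rule strong_gcdE)
      have "y1 \<noteq> 0" using g y by auto
      then obtain h where "strong_gcd h a y1"
        using val_chains_strong_gcd_valuational[OF T _ g(3)] valD(4)[OF val_mult(1)] by blast
      then obtain a2 y2 where h: "h \<in> D" "a2 \<in> D" "y2 \<in> D" "a = h * a2" "y1 = h * y2"
        "v_coprime a2 y2" by (rule strong_gcdE)
      have "y2 \<preceq> y1" using h by auto
      then have "v_coprime y2 x1" using v_coprime_dvd v_coprime_sym[OF g(6)] by blast
      then have "v_coprime (a2 * x1) y2"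
        using v_coprime_mult[OF v_coprime_sym[OF h(6)]] h(2) v_coprime_sym by blast
      moreover have "a2 * x1 \<in> D" "h * g \<in> D" using g h by blast+
      ultimately have "strong_gcd (h * g) (a * x) y"
        using g h by (intro strong_gcdI[of "h * g" "a2 * x1" y2]) (auto simp: mult_ac)
      then show "\<exists>g. strong_gcd g (a * x) y" by blast
    qed
  qed
  then show ?thesis using y by blast
qed

lemma strong_gcd_inverse:
  assumes g: "strong_gcd g x y"
  shows "ideal_inverse D {x, y} = ideal_inverse D {g}"
proof -
  obtain x' y' where *: "g \<in> D" "x' \<in> D" "y' \<in> D" "x = g * x'" "y = g * y'" "v_coprime x' y'"
    using g by (rule strong_gcdE)
  have "u * g \<in> D" if "u * x \<in> D" "u * y \<in> D" for u
    using v_coprimeD[OF *(6), of "u * g"] that *(4,5) by (simp add: mult.assoc)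
  moreover have "u * x \<in> D" "u * y \<in> D" if "u * g \<in> D" for u
    using mult_closed[OF that *(2)] mult_closed[OF that *(3)] *(4,5) by (simp_all add: mult.assoc)
  ultimately show ?thesis by (auto simp: mem_inverse_iff)
qed

lemma val_chains_inverse_principal:
  assumes T: val_chains and S: "finite S" "S \<subseteq> D" "\<not> S \<subseteq> {0}"
  obtains g where "g \<in> D" "g \<noteq> 0" "ideal_inverse D S = ideal_inverse D {g}"
    "\<And>s. s \<in> S \<Longrightarrow> g \<preceq> s"
proof -
  have "\<exists>g\<in>D. g \<noteq> 0 \<and> ideal_inverse D S = ideal_inverse D {g}"
    if "finite S" "S \<noteq> {}" "S \<subseteq> D - {0}" for S
    using that
  proof (induction S rule: finite_ne_induct)
    case (singleton x) then show ?case by blast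
  next
    case (insert x S)
    then obtain g where g: "g \<in> D" "g \<noteq> 0" "ideal_inverse D S = ideal_inverse D {g}" by auto
    have x: "x \<in> D" "x \<noteq> 0" using insert.prems by auto
    obtain h where h: "strong_gcd h x g" using val_chains_strong_gcd[OF T x g(1,2)] by blast
    have "ideal_inverse D (insert x S) = ideal_inverse D {x} \<inter> ideal_inverse D S"
      by (auto simp: mem_inverse_iff)
    also have "\<dots> = ideal_inverse D {x, g}" unfolding g(3) by (auto simp: mem_inverse_iff)
    also have "\<dots> = ideal_inverse D {h}" using h by (rule strong_gcd_inverse)
    finally have "ideal_inverse D (insert x S) = ideal_inverse D {h}" .
    moreover have "h \<in> D" "h \<noteq> 0" using h x by (auto elim!: strong_gcdE)
    ultimately show ?case by blast
  qed
  from this[of "S - {0}"] obtain g where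
    g: "g \<in> D" "g \<noteq> 0" "ideal_inverse D (S - {0}) = ideal_inverse D {g}"
    using S by blast
  have "ideal_inverse D S = ideal_inverse D (S - {0})"
    unfolding ideal_inverse_def by (metis (no_types, opaque_lifting) Diff_iff mult_zero_right singletonD zero_closed)
  then have inv: "ideal_inverse D S = ideal_inverse D {g}" using g(3) by simp
  have "inverse g \<in> ideal_inverse D S" unfolding inv using g(2) by (simp add: mem_inverse_iff)
  then have "g \<preceq> s" if "s \<in> S" for s
    using that g(2) by (simp add: mem_inverse_iff dvd_D_iff divide_inverse mult.commute)
  then show ?thesis using that g(1,2) inv by blast
qed

lemma GCD_if_val_chains: "val_chains \<Longrightarrow> GCD_domain D"
  unfolding GCD_domain_def
proof (intro ballI impI)
  fix x y assume T: val_chains and xy: "x \<in> D" "y \<in> D" "x \<noteq> 0 \<and> y \<noteq> 0"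
  then obtain g where "strong_gcd g x y" using val_chains_strong_gcd by blast
  then obtain x' y' where g: "g \<in> D" "x' \<in> D" "y' \<in> D" "x = g * x'" "y = g * y'" "v_coprime x' y'"
    by (rule strong_gcdE)
  have "c \<preceq> g" if c: "c \<preceq> x" "c \<preceq> y" for c
  proof -
    have c0: "c \<noteq> 0" using c(1) xy dvd_D_nonzero by blast
    have "(g / c) * x' \<in> D" "(g / c) * y' \<in> D"
      using c c0 g by (simp_all add: dvd_D_iff mult.commute)
    then show ?thesis using v_coprimeD[OF g(6)] c0 by (simp add: dvd_D_iff)
  qed
  moreover have "g \<preceq> x" "g \<preceq> y" using g by auto
  ultimately show "\<exists>g\<in>D. g \<preceq> x \<and> g \<preceq> y \<and> (\<forall>c\<in>D. c \<preceq> x \<and> c \<preceq> y \<longrightarrow> c \<preceq> g)"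
    using g(1) by blast
qed

lemma t_finite_conductor_if_val_chains:
  assumes T: val_chains shows "t_finite_conductor_domain D"
  unfolding t_finite_conductor_domain_def
proof (intro ballI impI)
  fix x y assume xy: "x \<in> D" "y \<in> D" "x \<noteq> 0 \<and> y \<noteq> 0"
  then obtain g where "strong_gcd g x y" using val_chains_strong_gcd[OF T] by blast
  then obtain x' y' where g: "g \<in> D" "x' \<in> D" "y' \<in> D" "x = g * x'" "y = g * y'" "v_coprime x' y'"
    by (rule strong_gcdE)
  define l where "l = g * x' * y'"
  have l: "l \<noteq> 0" "l \<in> D" using g xy by (auto simp: l_def)
  have "principal D x \<inter> principal D y = principal D l"
  proof (intro equalityI subsetI)
    fix m assume "m \<in> principal D x \<inter> principal D y"
    then have "m / x \<in> D" "m / y \<in> D" using xy by (auto simp: mem_principal_iff dvd_D_iff)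
    moreover have "m / x = (m / l) * y'" "m / y = (m / l) * x'"
      using l g by (auto simp: l_def field_simps)
    ultimately have "m / l \<in> D" using v_coprimeD[OF g(6), of "m / l"] by simp
    then show "m \<in> principal D l" using l by (simp add: mem_principal_iff dvd_D_iff)
  next
    fix m assume "m \<in> principal D l"
    then have "l \<preceq> m" by (simp add: mem_principal_iff)
    moreover have "x \<preceq> l" "y \<preceq> l"
      using g by (auto simp: l_def intro: dvd_D_I[of y'] dvd_D_I[of x'])
    ultimately have "x \<preceq> m" "y \<preceq> m" using dvd_D_trans[of x l m] dvd_D_trans[of y l m] by simp_all
    then show "m \<in> principal D x \<inter> principal D y" by (simp add: mem_principal_iff)
  qed
  also have "\<dots> = v_closure D {l}" using l by (simp add: v_closure_singleton)
  finally show "t_finite_t_ideal D (principal D x \<inter> principal D y)"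
    using v_closure_t_finite[of "{l}"] l by simp
qed

lemma PvMD_if_val_chains:
  assumes T: val_chains shows "PvMD D"
  unfolding PvMD_def
proof (intro allI impI)
  fix I assume I: "nonzero_fg_fractional_ideal D I \<and> I \<subseteq> D"
  then obtain S where S: "finite S" "I = gen S" and frac: "nonzero_fractional_ideal D I"
    by (auto simp: nonzero_fg_fractional_ideal_def)
  have SI: "S \<subseteq> I" unfolding S by (rule hull_subset)
  have S0: "\<not> S \<subseteq> {0}" using frac S gen_zero_iff by (auto simp: nonzero_fractional_ideal_def)
  obtain g where g: "g \<in> D" "g \<noteq> 0" "ideal_inverse D S = ideal_inverse D {g}"
    "\<And>s. s \<in> S \<Longrightarrow> g \<preceq> s"
    using val_chains_inverse_principal[OF T S(1) _ S0] SI I by blast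
  have "I \<subseteq> principal D g" unfolding S(2)
    using g(4) by (intro gen_minimal submodule_principal) (auto simp: mem_principal_iff)
  then show "t_invertible D I" using t_invertibleI[OF frac S(1) SI S0 g(2,3)] by blast
qed

text \<open>The given \<open>t\<close>-ideal \<open>I\<close> is now principal, so \<open>J = I\<close> will do.\<close>

lemma minimal_primes_if_val_chains:
  assumes T: val_chains and I: "I \<subseteq> D" "t_finite_t_ideal D I" "minimal_prime_over D I P"
  shows "\<exists>J. J \<subseteq> D \<and> t_ideal D J \<and> t_invertible D J \<and> minimal_prime_over D J P"
proof -
  obtain S where S: "finite S" "S \<subseteq> I" "\<not> S \<subseteq> {0}" "I = v_closure D S"
    using I(2) by (rule t_finite_t_idealE)
  have frac: "nonzero_fractional_ideal D I" and tI: "t_ideal D I"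
    using I(2) by (auto simp: t_finite_t_ideal_def t_ideal_def)
  obtain g where g: "g \<in> D" "g \<noteq> 0" "ideal_inverse D S = ideal_inverse D {g}"
    "\<And>s. s \<in> S \<Longrightarrow> g \<preceq> s"
    using val_chains_inverse_principal[OF T S(1) _ S(3)] S(2) I(1) by blast
  have "I \<subseteq> principal D g" unfolding S(4) using v_closure_subset_principal g by blast
  then have "t_invertible D I" using t_invertibleI[OF frac S(1,2,3) g(2,3)] by blast
  then show ?thesis using I tI by blast
qed

text \<open>
  If neither \<open>P\<close> nor \<open>Q\<close> contains the other, there are incomparable valuation elements \<open>a \<in> P\<close> and
  \<open>b \<in> Q\<close>.  As \<open>{a, b}\<close> has \<open>v\<close>-closure \<open>D\<close>, no proper \<open>t\<close>-ideal contains both.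
\<close>

lemma t_treed_if_val_chains:
  assumes T: val_chains shows "t_treed D"
  unfolding t_treed_def
proof (intro allI impI, rule ccontr)
  fix P Q M
  assume *: "prime_t_ideal D P \<and> prime_t_ideal D Q \<and> prime_t_ideal D M \<and> P \<subseteq> M \<and> Q \<subseteq> M"
    and "\<not> (P \<subseteq> Q \<or> Q \<subseteq> P)"
  then obtain x y where xy: "x \<in> P" "x \<notin> Q" "y \<in> Q" "y \<notin> P" by blast
  have P: "prime_ideal D P" and Q: "prime_ideal D Q" and M: "prime_ideal D M" "t_ideal D M"
    and sub: "P \<subseteq> M" "Q \<subseteq> M"
    using * by (auto simp: prime_t_ideal_def)
  have "0 \<in> P" "0 \<in> Q" using P Q by (auto simp: prime_ideal_def submodule_def)
  then have "x \<noteq> 0" "y \<noteq> 0" using xy by auto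
  then obtain a b where a: "val a" "a \<in> P" "a \<preceq> x" and b: "val b" "b \<in> Q" "b \<preceq> y"
    using prime_ideal_val_divisor[OF P xy(1)] prime_ideal_val_divisor[OF Q xy(3)] by metis
  have "a \<notin> Q" "b \<notin> P"
    using prime_ideal_dvd[OF Q _ a(3)] prime_ideal_dvd[OF P _ b(3)] xy by blast+
  then have "\<not> a \<preceq> b" "\<not> b \<preceq> a"
    using prime_ideal_dvd[OF P a(2)] prime_ideal_dvd[OF Q b(2)] by blast+
  then have cop: "v_coprime a b" using val_chains_v_coprime[OF T a(1) b(1)] by blast
  have "1 \<in> v_closure D {a, b}"
    unfolding mem_v_closure_iff using v_coprimeD[OF cop] by simp
  moreover have "v_closure D {a, b} \<subseteq> M" using a b sub by (intro t_idealD[OF M(2)]) auto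
  ultimately show False using prime_ideal_not_unit[OF M(1), of 1] by auto
qed

end

section \<open>Maximal \<open>t\<close>-ideals\<close>

context vfd
begin

text \<open>The union of the ideals \<open>dD\<close> for the nonunit divisors \<open>d\<close> of \<open>c\<close>.\<close>

definition sharing :: "'a \<Rightarrow> 'a set" where
  "sharing c = {x \<in> D. \<exists>d\<in>D. \<not> d \<preceq> 1 \<and> d \<preceq> c \<and> d \<preceq> x}"

lemma sharing_common_divisor:
  assumes c: "val c"
  shows "finite S \<Longrightarrow> S \<subseteq> sharing c \<Longrightarrow> \<exists>d\<in>D. \<not> d \<preceq> 1 \<and> d \<preceq> c \<and> (\<forall>s\<in>S. d \<preceq> s)"
proof (induction S rule: finite_induct)
  case empty then show ?case using valD[OF c] by (intro bexI[of _ c]) auto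
next
  case (insert x S)
  then obtain d where d: "d \<in> D" "\<not> d \<preceq> 1" "d \<preceq> c" "\<forall>s\<in>S. d \<preceq> s" by auto
  obtain e where e: "e \<in> D" "\<not> e \<preceq> 1" "e \<preceq> c" "e \<preceq> x" using insert.prems by (auto simp: sharing_def)
  have "d \<preceq> e \<or> e \<preceq> d"
    using valuational_divisors_chain[OF valD(4)[OF c] d(3,1) e(3,1)] .
  then show ?case
  proof
    assume "d \<preceq> e"
    then have "d \<preceq> x" using e(4) by (rule dvd_D_trans)
    then show ?thesis using d by blast
  next
    assume "e \<preceq> d"
    then have "\<forall>s\<in>S. e \<preceq> s" using d(4) dvd_D_trans[OF \<open>e \<preceq> d\<close>] by blast
    then show ?thesis using e by blast
  qed
qed

text \<open>If \<open>c\<close> is a valuation element, this is the union of a chain of proper principal ideals.\<close>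

lemma sharing_t_ideal:
  assumes c: "val c"
  shows "t_ideal D (sharing c)" "sharing c \<subset> D"
proof -
  have sub: "sharing c \<subseteq> D" by (auto simp: sharing_def)
  have cS: "c \<in> sharing c" using valD[OF c] by (auto simp: sharing_def)
  have cl: "v_closure D S \<subseteq> sharing c" if S: "finite S" "S \<subseteq> sharing c" for S
  proof
    fix y assume y: "y \<in> v_closure D S"
    obtain d where d: "d \<in> D" "\<not> d \<preceq> 1" "d \<preceq> c" "\<forall>s\<in>S. d \<preceq> s"
      using sharing_common_divisor[OF c S] by blast
    have "d \<noteq> 0" using d(3) valD[OF c] dvd_D_nonzero by blast
    then have "y \<in> principal D d" using v_closure_subset_principal[of d S] d(4) y by blast
    then have "d \<preceq> y" by (simp add: mem_principal_iff)
    then show "y \<in> sharing c" using d dvd_D_closed[of d y] by (auto simp: sharing_def)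
  qed
  have "submodule D (sharing c)" unfolding submodule_def
  proof (intro conjI ballI)
    show "0 \<in> sharing c" using valD[OF c] by (auto simp: sharing_def intro!: bexI[of _ c])
    show "x + y \<in> sharing c" if "x \<in> sharing c" "y \<in> sharing c" for x y
    proof -
      have "submodule D (v_closure D {x, y})" "x \<in> v_closure D {x, y}" "y \<in> v_closure D {x, y}"
        using submodule_v_closure subset_v_closure[of "{x, y}"] by auto
      then have "x + y \<in> v_closure D {x, y}" by (simp add: submodule_def)
      then show ?thesis using cl[of "{x, y}"] that by auto
    qed
    show "d * x \<in> sharing c" if "d \<in> D" "x \<in> sharing c" for d x
      using that dvd_D_multI2[of _ x d] by (auto simp: sharing_def)
  qed
  moreover have "sharing c \<noteq> {0}" using cS valD[OF c] by auto
  ultimately have "nonzero_fractional_ideal D (sharing c)" using sub by (intro fractional_integral)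
  then show "t_ideal D (sharing c)" using cl by (intro t_idealI) auto
  have "1 \<notin> sharing c" by (auto simp: sharing_def)
  then show "sharing c \<subset> D" using sub by auto
qed

lemma not_sharing_v_coprime:
  assumes c: "val c" and m: "m \<in> D" "m \<notin> sharing c"
  shows "v_coprime c m"
  using coprime_inverse[of c m] valD[OF c] m unfolding v_coprime_def sharing_def by blast

lemma maximal_t_ideal_eq_sharing:
  assumes "maximal_t_ideal D M" "val c" "M \<subseteq> sharing c"
  shows "M = sharing c"
  using assms sharing_t_ideal[OF assms(2)] unfolding maximal_t_ideal_def by blast

lemma one_not_in_maximal_t_ideal:
  assumes "maximal_t_ideal D M" shows "1 \<notin> M"
  using assms submodule_one[of M] t_ideal_submodule[of M] by (auto simp: maximal_t_ideal_def)

text \<open>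
  \<open>F\<close> consists of the valuation elements in a factorization of \<open>x\<close>.  If \<open>M\<close> has for each factor \<open>c\<close>
  an element without common nonunit divisor with \<open>c\<close>, then these elements together with \<open>x\<close> have
  \<open>v\<close>-closure \<open>D\<close>.
\<close>

lemma factors_and_sharing:
  assumes x: "x \<in> D" "x \<noteq> 0"
  shows "\<exists>F. finite F \<and> (\<forall>c\<in>F. val c) \<and>
    (\<forall>M. M \<subseteq> D \<and> (\<forall>c\<in>F. \<not> M \<subseteq> sharing c) \<longrightarrow>
      (\<exists>S. finite S \<and> S \<subseteq> M \<and> (\<forall>u. u * x \<in> D \<longrightarrow> (\<forall>s\<in>S. u * s \<in> D) \<longrightarrow> u \<in> D)))"
  using x
proof (induction x rule: vfd_induct)
  case (unit u)
  have "w \<in> D" if "w * u \<in> D" for w using v_coprimeD[OF v_coprime_unit[OF unit(2), of u]] that by blast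
  then show ?case by (intro exI[of _ "{}"]) auto
next
  case (val_mult a x)
  from val_mult.IH obtain F where F: "finite F" "\<forall>c\<in>F. val c"
    "\<forall>M. M \<subseteq> D \<and> (\<forall>c\<in>F. \<not> M \<subseteq> sharing c) \<longrightarrow>
      (\<exists>S. finite S \<and> S \<subseteq> M \<and> (\<forall>u. u * x \<in> D \<longrightarrow> (\<forall>s\<in>S. u * s \<in> D) \<longrightarrow> u \<in> D))"
    by (elim exE conjE)
  have "\<exists>S. finite S \<and> S \<subseteq> M \<and> (\<forall>u. u * (a * x) \<in> D \<longrightarrow> (\<forall>s\<in>S. u * s \<in> D) \<longrightarrow> u \<in> D)"
    if M: "M \<subseteq> D" "\<forall>c\<in>insert a F. \<not> M \<subseteq> sharing c" for M
  proof -
    have "M \<subseteq> D \<and> (\<forall>c\<in>F. \<not> M \<subseteq> sharing c)" using M by simp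
    from F(3)[rule_format, OF this] obtain S where S: "finite S" "S \<subseteq> M"
      "\<forall>u. u * x \<in> D \<longrightarrow> (\<forall>s\<in>S. u * s \<in> D) \<longrightarrow> u \<in> D"
      by (elim exE conjE)
    obtain m where m: "m \<in> M" "m \<notin> sharing a" using M by blast
    have cop: "v_coprime a m" using not_sharing_v_coprime[OF val_mult(1)] m M by blast
    have "u \<in> D" if u: "u * (a * x) \<in> D" "\<forall>s\<in>insert m S. u * s \<in> D" for u
    proof -
      have "(u * m) * x \<in> D" using u(2) val_mult(2) by blast
      then have "u * x * a \<in> D" "u * x * m \<in> D" using u(1) by (simp_all add: mult_ac)
      then have "u * x \<in> D" by (rule v_coprimeD[OF cop])
      then show ?thesis using S(3) u(2) by simp
    qed
    then show ?thesis using S m by (intro exI[of _ "insert m S"]) blast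
  qed
  then have "\<forall>M. M \<subseteq> D \<and> (\<forall>c\<in>insert a F. \<not> M \<subseteq> sharing c) \<longrightarrow>
      (\<exists>S. finite S \<and> S \<subseteq> M \<and> (\<forall>u. u * (a * x) \<in> D \<longrightarrow> (\<forall>s\<in>S. u * s \<in> D) \<longrightarrow> u \<in> D))"
    by simp
  moreover have "finite (insert a F)" "\<forall>c\<in>insert a F. val c" using F(1,2) val_mult(1) by simp_all
  ultimately show ?case by (intro exI[of _ "insert a F"] conjI)
qed

text \<open>
  A maximal \<open>t\<close>-ideal that contains \<open>x\<close> is therefore \<open>sharing c\<close> for one of the factors \<open>c\<close> of \<open>x\<close>,
  and one that contains a valuation element \<open>a\<close> is \<open>sharing a\<close>.
\<close>

lemma weakly_Matlis: "weakly_Matlis D"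
  unfolding weakly_Matlis_def
proof (intro conjI allI impI)
  fix x assume "nonzero_nonunit D x"
  then have x: "x \<in> D" "x \<noteq> 0" by (auto simp: nonzero_nonunit_iff)
  from factors_and_sharing[OF x] obtain F where F: "finite F" "\<forall>c\<in>F. val c"
    "\<forall>M. M \<subseteq> D \<and> (\<forall>c\<in>F. \<not> M \<subseteq> sharing c) \<longrightarrow>
      (\<exists>S. finite S \<and> S \<subseteq> M \<and> (\<forall>u. u * x \<in> D \<longrightarrow> (\<forall>s\<in>S. u * s \<in> D) \<longrightarrow> u \<in> D))"
    by (elim exE conjE)
  have "M \<in> sharing ` F" if M: "maximal_t_ideal D M" "x \<in> M" for M
  proof (rule ccontr)
    assume "M \<notin> sharing ` F"
    then have "\<forall>c\<in>F. \<not> M \<subseteq> sharing c" using maximal_t_ideal_eq_sharing[OF M(1)] F(2) by blast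
    moreover have tM: "t_ideal D M" "M \<subseteq> D" using M(1) by (auto simp: maximal_t_ideal_def)
    ultimately have "M \<subseteq> D \<and> (\<forall>c\<in>F. \<not> M \<subseteq> sharing c)" by blast
    from F(3)[rule_format, OF this] obtain S where S: "finite S" "S \<subseteq> M"
      "\<forall>u. u * x \<in> D \<longrightarrow> (\<forall>s\<in>S. u * s \<in> D) \<longrightarrow> u \<in> D"
      by (elim exE conjE)
    have "1 \<in> v_closure D (insert x S)" unfolding mem_v_closure_iff using S(3) by simp
    moreover have "v_closure D (insert x S) \<subseteq> M" using S M(2) by (intro t_idealD[OF tM(1)]) auto
    ultimately show False using one_not_in_maximal_t_ideal[OF M(1)] by blast
  qed
  then have "{M. maximal_t_ideal D M \<and> x \<in> M} \<subseteq> sharing ` F" by blast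
  then show "finite {M. maximal_t_ideal D M \<and> x \<in> M}" using F(1) finite_subset by blast
next
  fix M N assume MN: "maximal_t_ideal D M \<and> maximal_t_ideal D N \<and> M \<noteq> N"
  show "\<not> (\<exists>P. prime_ideal D P \<and> P \<noteq> {0} \<and> P \<subseteq> M \<and> P \<subseteq> N)"
  proof
    assume "\<exists>P. prime_ideal D P \<and> P \<noteq> {0} \<and> P \<subseteq> M \<and> P \<subseteq> N"
    then obtain P where P: "prime_ideal D P" "P \<noteq> {0}" "P \<subseteq> M" "P \<subseteq> N" by blast
    then obtain x where "x \<in> P" "x \<noteq> 0" by (auto simp: prime_ideal_def submodule_def)
    then obtain a where a: "val a" "a \<in> P" using prime_ideal_val_divisor[OF P(1)] by metis
    have "M = sharing a" if M: "maximal_t_ideal D M" "a \<in> M" for M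
    proof (rule maximal_t_ideal_eq_sharing[OF M(1) a(1)], rule subsetI, rule ccontr)
      fix m assume m: "m \<in> M" "m \<notin> sharing a"
      have tM: "t_ideal D M" "M \<subseteq> D" using M(1) by (auto simp: maximal_t_ideal_def)
      have "v_coprime a m" using not_sharing_v_coprime[OF a(1)] m tM(2) by blast
      then have "1 \<in> v_closure D {a, m}" unfolding mem_v_closure_iff v_coprime_def by simp
      moreover have "v_closure D {a, m} \<subseteq> M" using M(2) m by (intro t_idealD[OF tM(1)]) auto
      ultimately show False using one_not_in_maximal_t_ideal[OF M(1)] by blast
    qed
    then show False using MN P(3,4) a(2) by blast
  qed
qed


section \<open>Unique factorization\<close>

text \<open>
  A factorization with the least number of factors is incomparable: the product of two comparable
  valuation elements is a valuation element again.
\<close>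

lemma incomparable_factorization:
  assumes x: "nonzero_nonunit D x"
  shows "\<exists>n a. n \<ge> 1 \<and> incomparable_val_seq D n a \<and> x = (\<Prod>i=1..n. a i)"
proof -
  define fac where "fac X \<longleftrightarrow> (\<forall>z. z \<in># X \<longrightarrow> val z) \<and> prod_mset X = x" for X
  have x': "x \<in> D" "x \<noteq> 0" "\<not> x \<preceq> 1" using x by (auto simp: nonzero_nonunit_iff)
  obtain n0 :: nat and a where a: "\<forall>i\<in>{1..n0}. val (a i)" "x = (\<Prod>i=1..n0. a i)"
    using VFD x unfolding VFD_def by blast
  have "fac (image_mset a (mset_set {1..n0}))"
    using a by (auto simp: fac_def prod_unfold_prod_mset)
  then obtain X where X: "fac X" "\<And>Y. fac Y \<Longrightarrow> size X \<le> size Y"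
    using ex_has_least_nat[of fac _ size] by blast
  obtain xs where xs: "mset xs = X" using ex_mset by blast
  have vx: "val z" if "z \<in> set xs" for z using X(1) that xs by (auto simp: fac_def)
  have prodx: "prod_list xs = x" using X(1) xs by (auto simp: fac_def prod_mset_prod_list)
  have inc: "incomparable D (xs ! i) (xs ! j)" if ij: "i < j" "j < length xs" for i j
  proof (rule ccontr)
    assume "\<not> ?thesis"
    then have comp: "xs ! i \<preceq> xs ! j \<or> xs ! j \<preceq> xs ! i" by (simp add: incomparable_iff)
    have v: "val (xs ! i)" "val (xs ! j)" using vx ij by auto
    define ys where "ys = take i xs @ drop (Suc i) xs"
    have xs_eq: "mset xs = add_mset (xs ! i) (mset ys)"
      using ij id_take_nth_drop[of i xs] unfolding ys_def
      by (metis less_trans mset.simps(2) mset_append union_mset_add_mset_right)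
    have "xs ! j = drop (Suc i) xs ! (j - Suc i)" using ij by simp
    moreover have "j - Suc i < length (drop (Suc i) xs)" using ij by simp
    ultimately have "xs ! j \<in> set ys" unfolding ys_def by (metis Un_iff nth_mem set_append)
    then obtain Y where Y: "mset ys = add_mset (xs ! j) Y"
      by (metis in_multiset_in_set multi_member_split)
    have Xeq: "X = add_mset (xs ! i) (add_mset (xs ! j) Y)" using xs xs_eq Y by simp
    have "valuational D (xs ! i * xs ! j)"
      using comp valuational_mult_dvd[of "xs ! i" "xs ! j"] valuational_mult_dvd[of "xs ! j" "xs ! i"]
        valD[OF v(1)] valD[OF v(2)] by (auto simp: mult.commute)
    moreover have "\<not> xs ! i * xs ! j \<preceq> 1"
    proof
      assume "xs ! i * xs ! j \<preceq> 1"
      moreover have "xs ! i \<preceq> xs ! i * xs ! j" using valD[OF v(2)] by auto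
      ultimately have "xs ! i \<preceq> 1" using dvd_D_trans[of "xs ! i" "xs ! i * xs ! j" 1] by simp
      then show False using valD[OF v(1)] by simp
    qed
    ultimately have "val (xs ! i * xs ! j)" by (simp add: val_iff)
    then have "fac (add_mset (xs ! i * xs ! j) Y)"
      using X(1) unfolding Xeq fac_def by (auto simp: mult_ac)
    then show False using X(2) Xeq by fastforce
  qed
  define b where "b i = xs ! (i - 1)" for i
  have "incomparable_val_seq D (length xs) b"
    unfolding incomparable_val_seq_def
  proof (intro conjI ballI impI)
    show "val (b i)" if "i \<in> {1..length xs}" for i using that vx by (auto simp: b_def)
    fix i j assume ij: "i \<in> {1..length xs}" "j \<in> {1..length xs}" "i \<noteq> j"
    then consider "i - 1 < j - 1" "j - 1 < length xs" | "j - 1 < i - 1" "i - 1 < length xs"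
      by fastforce
    then show "incomparable D (b i) (b j)"
      using inc[of "i - 1" "j - 1"] inc[of "j - 1" "i - 1"]
      by cases (auto simp: b_def incomparable_iff)
  qed
  moreover have "length xs \<ge> 1" using prodx x'(3) by (cases xs) auto
  moreover have "(\<Prod>i=1..length xs. b i) = (\<Prod>k<length xs. b (Suc k))"
    using prod.atLeast1_atMost_eq[of b "length xs"] by simp
  then have "x = (\<Prod>i=1..length xs. b i)"
    using prodx prod.list_conv_set_nth[of xs] by (simp add: lessThan_atLeast0 b_def)
  ultimately show ?thesis by blast
qed

text \<open>
  Some factor \<open>b j\<close> lies in \<open>rad a\<close>, hence is comparable with \<open>a\<close>.  If \<open>a = b j a'\<close> with a nonunit
  \<open>a'\<close>, then \<open>a'\<close> is comparable with another factor \<open>b k\<close>, which would thereby become comparable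
  with \<open>b j\<close>.
\<close>

lemma val_chains_dvd_prod:
  assumes T: val_chains and a: "val a" and I: "finite I" and b: "\<And>i. i \<in> I \<Longrightarrow> val (b i)"
    and inc: "\<And>i j. i \<in> I \<Longrightarrow> j \<in> I \<Longrightarrow> i \<noteq> j \<Longrightarrow> \<not> b i \<preceq> b j"
    and dvd: "a \<preceq> prod b I"
  shows "\<exists>j\<in>I. a \<preceq> b j"
proof -
  have bD: "b i \<in> D" if "i \<in> I" for i using valD[OF b[OF that]] by simp
  have aD: "a \<in> D" using valD[OF a] by simp
  have factor: "\<exists>j\<in>J. b j \<in> rad c" if J: "J \<subseteq> I" and c: "val c" "c \<preceq> prod b J" for J c
  proof -
    have "prod b J \<in> D" using J bD by (intro prod_closed) auto
    then have "prod b J \<in> rad c" using c(2) radI[of _ c 1] by simp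
    then show ?thesis
      using prime_ideal_prod[OF rad_prime[OF c(1)] finite_subset[OF J I], of b] J bD by blast
  qed
  obtain j where j: "j \<in> I" "b j \<in> rad a" using factor[of I a] a dvd by blast
  have vj: "val (b j)" using b[OF j(1)] .
  have "a \<preceq> b j \<or> b j \<preceq> a" using rad_comparable[of "b j" a] j(2) valD[OF a] valD[OF vj] by blast
  moreover have "a \<preceq> b j" if bja: "b j \<preceq> a"
  proof -
    obtain a' where a': "a' \<in> D" "a = b j * a'" using bja by (rule dvd_D_E)
    have "prod b I = b j * prod b (I - {j})" using I j(1) by (rule prod.remove)
    then have "b j * a' \<preceq> b j * prod b (I - {j})" using dvd a'(2) by simp
    then have dvd': "a' \<preceq> prod b (I - {j})" using dvd_D_cancel valD(2)[OF vj] by blast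
    have a'a: "a' \<preceq> a" using a' bD[OF j(1)] by auto
    have "a' \<preceq> 1"
    proof (rule ccontr)
      assume nu: "\<not> a' \<preceq> 1"
      then have va': "val a'" using val_dvd[OF a a'a a'(1)] by blast
      obtain k where k: "k \<in> I" "k \<noteq> j" "b k \<in> rad a'" using factor[of "I - {j}" a'] va' dvd' by blast
      have vk: "val (b k)" using b[OF k(1)] .
      have "a' \<preceq> b k \<or> b k \<preceq> a'"
        using rad_comparable[of "b k" a'] k(3) valD[OF va'] valD[OF vk] by blast
      then have "b j \<preceq> b k \<or> b k \<preceq> b j"
      proof
        assume "b k \<preceq> a'"
        then have "b k \<preceq> a" using a'a by (rule dvd_D_trans)
        then show ?thesis
          using valuational_divisors_chain[OF valD(4)[OF a] bja bD[OF j(1)]] bD[OF k(1)] by blast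
      next
        assume a'k: "a' \<preceq> b k"
        have "b j \<preceq> a' \<or> a' \<preceq> b j"
          using valuational_divisors_chain[OF valD(4)[OF a] bja bD[OF j(1)] a'a a'(1)] .
        then show ?thesis
        proof
          assume "b j \<preceq> a'" then show ?thesis using dvd_D_trans[OF _ a'k] by blast
        next
          assume "a' \<preceq> b j" then show ?thesis using T va' vj vk a'k unfolding val_chains_def by blast
        qed
      qed
      then show False using inc[OF j(1) k(1)] inc[OF k(1) j(1)] k(2) by blast
    qed
    then have "b j * a' \<preceq> b j * 1" by (intro dvd_D_mult_mono dvd_D_refl)
    then show ?thesis using a'(2) by simp
  qed
  ultimately show ?thesis using j(1) by blast
qed

text \<open>
  Each \<open>a i\<close> divides some \<open>b j\<close> and conversely.  By incomparability these assignments are mutually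
  inverse.
\<close>

lemma UVFD_if_val_chains:
  assumes T: val_chains shows "UVFD D"
  unfolding UVFD_def
proof (intro conjI allI impI)
  show "\<exists>n a. n \<ge> 1 \<and> incomparable_val_seq D n a \<and> x = (\<Prod>i=1..n. a i)"
    if "nonzero_nonunit D x" for x using incomparable_factorization[OF that] .
next
  fix n m a b
  assume *: "n \<ge> 1 \<and> m \<ge> 1 \<and> incomparable_val_seq D n a \<and> incomparable_val_seq D m b \<and>
    (\<Prod>i=1..n. a i) = (\<Prod>j=1..m. b j)"
  have match: "\<exists>j\<in>{1..m}. a i \<preceq> b j"
    if ab: "incomparable_val_seq D n a" "incomparable_val_seq D m b"
      "(\<Prod>i=1..n. a i) = (\<Prod>j=1..m. b j)" and i: "i \<in> {1..n}" for n m a b i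
  proof (rule val_chains_dvd_prod[OF T])
    show "val (a i)" using ab i by (simp add: incomparable_val_seq_def)
    show "val (b j)" if "j \<in> {1..m}" for j using ab that by (simp add: incomparable_val_seq_def)
    show "\<not> b j \<preceq> b k" if "j \<in> {1..m}" "k \<in> {1..m}" "j \<noteq> k" for j k
      using ab(2) that by (simp add: incomparable_val_seq_def incomparable_iff)
    have "prod a ({1..n} - {i}) \<in> D"
      using ab(1) by (intro prod_closed) (auto simp: incomparable_val_seq_def dest: valD)
    then have "a i \<preceq> a i * prod a ({1..n} - {i})" by (rule dvd_D_triv)
    then show "a i \<preceq> prod b {1..m}" using ab(3) prod.remove[of "{1..n}" i a] i by simp
  qed simp
  obtain \<sigma> where \<sigma>: "\<And>i. i \<in> {1..n} \<Longrightarrow> \<sigma> i \<in> {1..m} \<and> a i \<preceq> b (\<sigma> i)"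
    using match[of n a m b] * by metis
  obtain \<tau> where \<tau>: "\<And>j. j \<in> {1..m} \<Longrightarrow> \<tau> j \<in> {1..n} \<and> b j \<preceq> a (\<tau> j)"
    using match[of m b n a] * by metis
  have inca: "i = j" if "i \<in> {1..n}" "j \<in> {1..n}" "a i \<preceq> a j" for i j
    using * that unfolding incomparable_val_seq_def incomparable_iff by metis
  have incb: "i = j" if "i \<in> {1..m}" "j \<in> {1..m}" "b i \<preceq> b j" for i j
    using * that unfolding incomparable_val_seq_def incomparable_iff by metis
  have \<tau>\<sigma>: "\<tau> (\<sigma> i) = i" if i: "i \<in> {1..n}" for i
    using inca[of i "\<tau> (\<sigma> i)"] i \<sigma>[OF i] \<tau>[of "\<sigma> i"] dvd_D_trans[of "a i" "b (\<sigma> i)" "a (\<tau> (\<sigma> i))"]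
    by simp
  have \<sigma>\<tau>: "\<sigma> (\<tau> j) = j" if j: "j \<in> {1..m}" for j
    using incb[of j "\<sigma> (\<tau> j)"] j \<tau>[OF j] \<sigma>[of "\<tau> j"] dvd_D_trans[of "b j" "a (\<tau> j)" "b (\<sigma> (\<tau> j))"]
    by simp
  have bij: "bij_betw \<sigma> {1..n} {1..m}"
    using \<tau>\<sigma> \<sigma>\<tau> \<sigma> \<tau> by (intro bij_betw_byWitness[where f' = \<tau>]) auto
  then show nm: "n = m" using bij_betw_same_card by fastforce
  define \<pi> where "\<pi> i = (if i \<in> {1..n} then \<sigma> i else i)" for i
  have "bij_betw \<pi> {1..n} {1..n}"
    using bij nm bij_betw_cong[of "{1..n}" \<pi> \<sigma>] by (simp add: \<pi>_def)
  then have "\<pi> permutes {1..n}" by (rule bij_imp_permutes) (simp only: \<pi>_def if_False)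
  moreover have "principal D (a i) = principal D (b (\<pi> i))" if i: "i \<in> {1..n}" for i
    using \<sigma>[OF i] \<tau>[of "\<sigma> i"] \<tau>\<sigma>[OF i] i by (simp only: principal_eq_iff \<pi>_def if_True)
  ultimately show "\<exists>\<sigma>. \<sigma> permutes {1..n} \<and> (\<forall>i\<in>{1..n}. principal D (a i) = principal D (b (\<sigma> i)))"
    by blast
qed

end

section \<open>Content of polynomials\<close>

context subdomain
begin

lemma valuation_content:
  assumes V: "valuation_domain D" and f: "f \<noteq> (0 :: 'k poly)"
  obtains i where "coeff f i \<noteq> 0" "\<And>k. divides_in D (coeff f i) (coeff f k)"
    "\<And>k. k < i \<Longrightarrow> \<not> divides_in D (coeff f k) (coeff f i)"
proof -
  define good where "good i \<longleftrightarrow> (\<forall>k. coeff f i \<preceq> coeff f k)" for i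
  have "finite (range (coeff f))" by (simp add: range_coeff)
  then obtain s where s: "s \<in> range (coeff f)" "\<forall>t\<in>range (coeff f). s \<preceq> t"
    using valuation_min[OF V, of "range (coeff f)"] by auto
  then obtain i0 where "good i0" by (auto simp: good_def)
  define i where "i = (LEAST i. good i)"
  have i: "good i" unfolding i_def using \<open>good i0\<close> by (rule LeastI)
  show ?thesis
  proof
    have "coeff f i \<preceq> lead_coeff f" using i by (simp add: good_def)
    then show "coeff f i \<noteq> 0" using dvd_D_nonzero f by simp
    show "coeff f i \<preceq> coeff f k" for k using i by (simp add: good_def)
    fix k assume "k < i"
    then have "\<not> good k" unfolding i_def by (rule not_less_Least)
    then obtain l where l: "\<not> coeff f k \<preceq> coeff f l" by (auto simp: good_def)
    show "\<not> coeff f k \<preceq> coeff f i"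
    proof
      assume "coeff f k \<preceq> coeff f i"
      then have "coeff f k \<preceq> coeff f l" using i dvd_D_trans unfolding good_def by blast
      then show False using l by blast
    qed
  qed
qed

text \<open>
  Let \<open>i\<close> and \<open>j\<close> be the first indices at which the coefficients of \<open>f\<close> and \<open>g\<close> take their least
  value.  In the sum for the coefficient of \<open>fg\<close> at \<open>i + j\<close>, all other terms have larger value than
  \<open>f\<^sub>i g\<^sub>j\<close>, so this coefficient and \<open>f\<^sub>i g\<^sub>j\<close> agree up to a unit.
\<close>

lemma valuation_gauss:
  assumes V: "valuation_domain D" and fg: "f \<noteq> 0" "g \<noteq> (0 :: 'k poly)"
  obtains i j l where
    "\<And>k. divides_in D (coeff f i) (coeff f k)" "\<And>k. divides_in D (coeff g j) (coeff g k)"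
    "divides_in D (coeff (f * g) l) (coeff f i * coeff g j)"
proof -
  obtain i where i: "coeff f i \<noteq> 0" "\<And>k. coeff f i \<preceq> coeff f k"
    "\<And>k. k < i \<Longrightarrow> \<not> coeff f k \<preceq> coeff f i" using valuation_content[OF V fg(1)] by blast
  obtain j where j: "coeff g j \<noteq> 0" "\<And>k. coeff g j \<preceq> coeff g k"
    "\<And>k. k < j \<Longrightarrow> \<not> coeff g k \<preceq> coeff g j" using valuation_content[OF V fg(2)] by blast
  define c where "c = coeff f i * coeff g j"
  \<comment> \<open>the elements of larger value than \<open>c\<close>\<close>
  define M where "M = {x. \<exists>m\<in>D. \<not> m \<preceq> 1 \<and> x = c * m}"
  have c0: "c \<noteq> 0" using i j by (simp add: c_def)
  have M0: "0 \<in> M" by (auto simp: M_def divides_in_def intro!: bexI[of _ 0])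
  have Madd: "x + y \<in> M" if xy: "x \<in> M" "y \<in> M" for x y
  proof -
    obtain m n where mn: "m \<in> D" "\<not> m \<preceq> 1" "x = c * m" "n \<in> D" "\<not> n \<preceq> 1" "y = c * n"
      using xy unfolding M_def by blast
    have "\<not> m + n \<preceq> 1"
    proof
      assume 1: "m + n \<preceq> 1"
      have "m \<preceq> n \<or> n \<preceq> m" by (rule valuation_dvd_linear[OF V])
      then have "m \<preceq> m + n \<or> n \<preceq> m + n"
        using dvd_D_add[of m m n] dvd_D_add[of n m n] by auto
      then show False using dvd_D_trans[OF _ 1] mn by blast
    qed
    then show ?thesis using mn by (auto simp: M_def distrib_left intro!: bexI[of _ "m + n"])
  qed
  have Mlarger: "x * y \<in> M"
    if xy: "coeff f i \<preceq> x" "coeff g j \<preceq> y" "\<not> x \<preceq> coeff f i \<or> \<not> y \<preceq> coeff g j" for x y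
  proof -
    obtain m n where mn: "m \<in> D" "n \<in> D" "x = coeff f i * m" "y = coeff g j * n"
      using xy(1,2) by (auto elim!: dvd_D_E)
    have "\<not> m * n \<preceq> 1"
    proof
      assume mn1: "m * n \<preceq> 1"
      have "m \<preceq> m * n" "n \<preceq> m * n" using mn by auto
      then have "m \<preceq> 1" "n \<preceq> 1" using dvd_D_trans[OF _ mn1] by blast+
      then have "x \<preceq> coeff f i" "y \<preceq> coeff g j"
        using dvd_D_mult_mono[of "coeff f i" "coeff f i" m 1]
          dvd_D_mult_mono[of "coeff g j" "coeff g j" n 1] mn by simp_all
      then show False using xy(3) by blast
    qed
    then show ?thesis unfolding M_def using mn by (auto simp: c_def intro!: bexI[of _ "m * n"])
  qed
  let ?l = "i + j"
  have "coeff (f * g) ?l = (\<Sum>k\<le>?l. coeff f k * coeff g (?l - k))" by (rule coeff_mult)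
  also have "\<dots> = c + (\<Sum>k\<in>{..?l} - {i}. coeff f k * coeff g (?l - k))"
    by (subst sum.remove[of _ i]) (auto simp: c_def)
  finally have eq: "coeff (f * g) ?l = c + (\<Sum>k\<in>{..?l} - {i}. coeff f k * coeff g (?l - k))" .
  have sumM: "sum t I \<in> M" if "\<And>k. k \<in> I \<Longrightarrow> t k \<in> M" for t and I :: "nat set"
    using that by (induction I rule: infinite_finite_induct) (auto intro: M0 Madd)
  have "(\<Sum>k\<in>{..?l} - {i}. coeff f k * coeff g (?l - k)) \<in> M"
  proof (rule sumM)
    fix k assume k: "k \<in> {..?l} - {i}"
    then have "k < i \<or> ?l - k < j" by auto
    then have "\<not> coeff f k \<preceq> coeff f i \<or> \<not> coeff g (?l - k) \<preceq> coeff g j" using i(3) j(3) by blast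
    then show "coeff f k * coeff g (?l - k) \<in> M" by (intro Mlarger i(2) j(2))
  qed
  then obtain m where m: "m \<in> D" "\<not> m \<preceq> 1" "coeff (f * g) ?l = c * (1 + m)"
    using eq by (auto simp: M_def distrib_left)
  have "1 + m \<preceq> 1"
  proof -
    have "1 + m \<preceq> m \<or> m \<preceq> 1 + m" by (rule valuation_dvd_linear[OF V])
    moreover have "\<not> m \<preceq> 1 + m"
    proof
      assume mm: "m \<preceq> 1 + m"
      have "- 1 \<in> D" by (intro minus_closed one_closed)
      then have "m \<preceq> (1 + m) + m * (- 1)" using dvd_D_add[OF mm dvd_D_triv] by blast
      then show False using m(2) by simp
    qed
    ultimately have "1 + m \<preceq> m" by blast
    then have "1 + m \<preceq> (1 + m) * 1 + m * (- 1)"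
      by (intro dvd_D_add dvd_D_triv dvd_D_multI) (simp_all add: minus_closed)
    then show ?thesis by simp
  qed
  then have "coeff (f * g) ?l \<preceq> c"
    using dvd_D_mult_mono[of c c "1 + m" 1] m(3) by simp
  then show ?thesis using that[of i j ?l] i(2) j(2) by (simp add: c_def)
qed

text \<open>As \<open>1\<close> divides exactly the elements of \<open>D\<close>, \<open>content_dvd 1 f\<close> means that \<open>f\<close> lies in \<open>D[X]\<close>.\<close>

definition content_dvd :: "'k \<Rightarrow> 'k poly \<Rightarrow> bool" where
  "content_dvd d f \<longleftrightarrow> (\<forall>i. d \<preceq> coeff f i)"

lemma content_dvd_one_iff: "content_dvd 1 p \<longleftrightarrow> (\<forall>i. coeff p i \<in> D)"
  by (simp add: content_dvd_def)

lemma content_dvd_one: "d \<in> D \<Longrightarrow> content_dvd d f \<Longrightarrow> content_dvd 1 f"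
  unfolding content_dvd_def using dvd_D_closed by auto

lemma content_dvd_smult: "c \<noteq> 0 \<Longrightarrow> content_dvd (c * d) (smult c f) \<longleftrightarrow> content_dvd d f"
  by (simp add: content_dvd_def dvd_D_cancel)

lemma content_dvd_smultI: "content_dvd d f \<Longrightarrow> content_dvd (c * d) (smult c f)"
  by (simp add: content_dvd_def dvd_D_mult_mono)

lemma content_dvdE:
  assumes "content_dvd d f" "d \<noteq> 0" obtains f' where "f = smult d f'" "content_dvd 1 f'"
proof
  show f: "f = smult d (smult (inverse d) f)" using assms(2) by simp
  have "content_dvd (d * 1) (smult d (smult (inverse d) f))" using assms by simp
  then show "content_dvd 1 (smult (inverse d) f)" using content_dvd_smult[OF assms(2)] by blast
qed

lemma content_dvd_mult:
  "content_dvd d f \<Longrightarrow> content_dvd e g \<Longrightarrow> content_dvd (d * e) (f * g)"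
  unfolding content_dvd_def coeff_mult by (intro allI dvd_D_sum dvd_D_mult_mono) blast+

lemma content_dvd_trans: "c \<preceq> d \<Longrightarrow> content_dvd d f \<Longrightarrow> content_dvd c f"
  unfolding content_dvd_def using dvd_D_trans[of c d] by blast

lemma content_dvd_add: "content_dvd d f \<Longrightarrow> content_dvd d g \<Longrightarrow> content_dvd d (f + g)"
  by (simp add: content_dvd_def dvd_D_add)

lemma content_dvd_diff: "content_dvd 1 f \<Longrightarrow> content_dvd 1 g \<Longrightarrow> content_dvd 1 (f - g)"
  by (simp add: content_dvd_def diff_closed)

lemma content_dvd_0 [simp]: "content_dvd d 0"
  by (simp add: content_dvd_def)

lemma content_dvd_const: "content_dvd d [:c:] \<longleftrightarrow> d \<preceq> c"
  by (auto simp: content_dvd_def coeff_pCons split: nat.split)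

lemma poly_ring_eq: "poly_ring D = to_fract ` {p. content_dvd 1 p}"
  by (auto simp: poly_ring_def content_dvd_one_iff)

lemma to_fract_mem_poly_ring: "to_fract p \<in> poly_ring D \<longleftrightarrow> content_dvd 1 p"
  by (auto simp: poly_ring_eq)

lemma poly_ringE:
  assumes "x \<in> poly_ring D" obtains p where "content_dvd 1 p" "x = to_fract p"
  using assms by (auto simp: poly_ring_eq)

lemma poly_ring_subdomain: "subdomain (poly_ring D)"
proof
  have "x - y \<in> poly_ring D \<and> x * y \<in> poly_ring D"
    if xy: "x \<in> poly_ring D" "y \<in> poly_ring D" for x y
  proof -
    obtain p q where p: "content_dvd 1 p" "x = to_fract p" and q: "content_dvd 1 q" "y = to_fract q"
      using xy by (auto elim!: poly_ringE)
    have "content_dvd 1 (p * q)" using content_dvd_mult[OF p(1) q(1)] by simp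
    then show ?thesis using p q content_dvd_diff[OF p(1) q(1)]
      by (metis to_fract_diff to_fract_mem_poly_ring to_fract_mult)
  qed
  moreover have "to_fract 1 \<in> poly_ring D"
    using to_fract_mem_poly_ring[of "[:1:]"] by (simp add: content_dvd_const one_pCons)
  ultimately show "is_subring (poly_ring D)" by (simp add: is_subring_def)
qed

end

context vfd
begin

text \<open>
  Constants are primal in \<open>D[X]\<close>.  If \<open>d\<close> is valuational, it divides the product of the coefficients
  \<open>f\<^sub>i\<close> and \<open>g\<^sub>j\<close> of least value, so \<open>d = ek\<close> with \<open>e | f\<^sub>i\<close> and \<open>k | g\<^sub>j\<close>.  In \<open>V\<close>, hence also in
  \<open>D\<close>, \<open>e\<close> then divides all coefficients of \<open>f\<close>, and \<open>k\<close> those of \<open>g\<close>.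
\<close>

lemma gauss_valuational:
  assumes d: "valuational D d" and fg: "content_dvd 1 f" "content_dvd 1 g" "content_dvd d (f * g)"
  shows "\<exists>e\<in>D. \<exists>k\<in>D. d = e * k \<and> content_dvd e f \<and> content_dvd k g"
proof -
  have dD: "d \<in> D" using d by (rule valuationalD)
  consider "f = 0" | "g = 0" | "f \<noteq> 0" "g \<noteq> 0" by blast
  then show ?thesis
  proof cases
    case 1
    then show ?thesis using fg(2) dD by (intro bexI[of _ d] bexI[of _ 1]) auto
  next
    case 2
    then show ?thesis using fg(1) dD by (intro bexI[of _ 1] bexI[of _ d]) auto
  next
    case 3
    obtain V where V: "val_witness D V d" using d by (auto simp: valuational_def)
    interpret V: subdomain V using V by (rule witness_subdomain)
    have VV: "valuation_domain V" "D \<subseteq> V" using V by (auto simp: val_witness_def)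
    obtain i j l where ij: "\<And>k. divides_in V (coeff f i) (coeff f k)"
      "\<And>k. divides_in V (coeff g j) (coeff g k)"
      "divides_in V (coeff (f * g) l) (coeff f i * coeff g j)"
      using V.valuation_gauss[OF VV(1) 3] by blast
    have fD: "coeff f k \<in> D" and gD: "coeff g k \<in> D" for k using fg by (simp_all add: content_dvd_one_iff)
    have "d \<preceq> coeff (f * g) l" using fg(3) by (simp add: content_dvd_def)
    then have "divides_in V d (coeff f i * coeff g j)"
      using V.dvd_D_trans[OF dvd_D_overring[OF VV(2)] ij(3)] by blast
    moreover have "coeff f i * coeff g j \<in> D" using fD gD by blast
    ultimately have "d \<preceq> coeff f i * coeff g j" using V by (simp add: val_witness_def)
    then obtain e k where ek: "e \<in> D" "k \<in> D" "d = e * k" "e \<preceq> coeff f i" "k \<preceq> coeff g j"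
      using primalE[OF valuational_primal[OF d] fD gD] by blast
    have "e \<preceq> d" "k \<preceq> d" using ek by auto
    then have we: "val_witness D V e" "val_witness D V k" using witness_dvd[OF V] ek by blast+
    have "e \<preceq> coeff f s" for s
      using V.dvd_D_trans[OF dvd_D_overring[OF VV(2) ek(4)] ij(1)] we(1) fD
      by (simp add: val_witness_def)
    moreover have "k \<preceq> coeff g s" for s
      using V.dvd_D_trans[OF dvd_D_overring[OF VV(2) ek(5)] ij(2)] we(2) gD
      by (simp add: val_witness_def)
    ultimately show ?thesis using ek unfolding content_dvd_def by blast
  qed
qed

lemma gauss:
  assumes d: "d \<in> D" "d \<noteq> 0" and fg: "content_dvd 1 f" "content_dvd 1 g" "content_dvd d (f * g)"
  obtains e k where "e \<in> D" "k \<in> D" "d = e * k" "content_dvd e f" "content_dvd k g"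
proof -
  have "\<forall>f g. content_dvd 1 f \<longrightarrow> content_dvd 1 g \<longrightarrow> content_dvd d (f * g) \<longrightarrow>
    (\<exists>e\<in>D. \<exists>k\<in>D. d = e * k \<and> content_dvd e f \<and> content_dvd k g)"
    using d
  proof (induction d rule: vfd_induct)
    case (unit u)
    show ?case
    proof (intro allI impI)
      fix f g assume "content_dvd 1 f" "content_dvd 1 g"
      then have "content_dvd u f" using content_dvd_trans[OF unit(2)] by blast
      then show "\<exists>e\<in>D. \<exists>k\<in>D. u = e * k \<and> content_dvd e f \<and> content_dvd k g"
        using unit(1) \<open>content_dvd 1 g\<close> by (intro bexI[of _ u] bexI[of _ 1]) auto
    qed
  next
    case (val_mult a x)
    have a: "a \<in> D" "a \<noteq> 0" using valD[OF val_mult(1)] by simp_all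
    show ?case
    proof (intro allI impI)
      fix f g assume fg: "content_dvd 1 f" "content_dvd 1 g" "content_dvd (a * x) (f * g)"
      have "a \<preceq> a * x" using val_mult(2) by blast
      then have "content_dvd a (f * g)" using fg(3) by (rule content_dvd_trans)
      then obtain e k where ek: "e \<in> D" "k \<in> D" "a = e * k" "content_dvd e f" "content_dvd k g"
        using gauss_valuational[OF valD(4)[OF val_mult(1)] fg(1,2)] by blast
      have nz: "e \<noteq> 0" "k \<noteq> 0" using ek a by auto
      obtain f' where f': "f = smult e f'" "content_dvd 1 f'" using content_dvdE[OF ek(4) nz(1)] .
      obtain g' where g': "g = smult k g'" "content_dvd 1 g'" using content_dvdE[OF ek(5) nz(2)] .
      have "f * g = smult a (f' * g')" using f' g' ek(3) by (simp add: mult.commute)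
      then have "content_dvd x (f' * g')" using fg(3) content_dvd_smult[OF a(2)] by simp
      then obtain e' k' where ek': "e' \<in> D" "k' \<in> D" "x = e' * k'" "content_dvd e' f'" "content_dvd k' g'"
        using val_mult.IH f'(2) g'(2) by blast
      have "content_dvd (e * e') f" "content_dvd (k * k') g"
        unfolding f'(1) g'(1) using ek' by (auto intro: content_dvd_smultI)
      moreover have "a * x = (e * e') * (k * k')" using ek(3) ek'(3) by (simp add: mult_ac)
      ultimately show "\<exists>e\<in>D. \<exists>k\<in>D. a * x = e * k \<and> content_dvd e f \<and> content_dvd k g"
        using mult_closed[OF ek(1) ek'(1)] mult_closed[OF ek(2) ek'(2)] by blast
    qed
  qed
  then show ?thesis using that fg by blast
qed

lemma common_denominator: "\<exists>\<delta>\<in>D. \<delta> \<noteq> 0 \<and> content_dvd 1 (smult \<delta> p)"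
proof (induction p)
  case 0 then show ?case by (intro bexI[of _ 1]) auto
next
  case (pCons a p)
  then obtain \<delta> where \<delta>: "\<delta> \<in> D" "\<delta> \<noteq> 0" "content_dvd 1 (smult \<delta> p)" by blast
  obtain x y where xy: "x \<in> D" "y \<in> D" "y \<noteq> 0" "a = x / y" using fractions by blast
  have "content_dvd 1 (smult (y * \<delta>) (pCons a p))"
    unfolding content_dvd_one_iff
  proof
    fix i
    have "y * \<delta> * a = \<delta> * x" using xy by simp
    then have "y * \<delta> * a \<in> D" using mult_closed[OF \<delta>(1) xy(1)] by metis
    moreover have "y * \<delta> * coeff p n \<in> D" for n
      using mult_closed[OF xy(2), of "\<delta> * coeff p n"] \<delta>(3) by (simp add: content_dvd_one_iff mult.assoc)
    ultimately show "coeff (smult (y * \<delta>) (pCons a p)) i \<in> D" by (cases i) simp_all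
  qed
  moreover have "y * \<delta> \<in> D" "y * \<delta> \<noteq> 0" using mult_closed[OF xy(2) \<delta>(1)] xy \<delta> by simp_all
  ultimately show ?case by blast
qed


section \<open>Uppers to zero\<close>

text \<open>
  Suppose that a nonunit \<open>c\<close> divides the incomparable \<open>a\<close> and \<open>b\<close>.  The polynomials over \<open>D\<close> that vanish
  at \<open>-b/a\<close> form an upper to zero \<open>Q\<close>.  By Gauss's lemma each of them has the form \<open>(f/e) h\<close> with
  \<open>f = aX + b\<close>, a common divisor \<open>e\<close> of \<open>a\<close> and \<open>b\<close>, and \<open>h \<in> D[X]\<close>.  As \<open>ec\<close> divides \<open>a\<close> and \<open>b\<close>
  as well, \<open>Q\<close> is strictly contained in the \<open>t\<close>-ideal \<open>c D[X]\<close>.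
\<close>

lemma val_chains_if_UMT_domain:
  assumes UMT: "UMT_domain D" shows "val_chains"
  unfolding val_chains_def
proof (intro allI impI, rule ccontr)
  fix a b c assume *: "val a \<and> val b \<and> val c \<and> c \<preceq> a \<and> c \<preceq> b" and "\<not> (a \<preceq> b \<or> b \<preceq> a)"
  then have v: "val a" "val b" "val c" "c \<preceq> a" "c \<preceq> b" and inc: "\<not> a \<preceq> b" "\<not> b \<preceq> a" by blast+
  have a: "a \<in> D" "a \<noteq> 0" and b: "b \<in> D" and c: "c \<in> D" "c \<noteq> 0" "\<not> c \<preceq> 1"
    using valD v by blast+
  interpret R: subdomain "poly_ring D" by (rule poly_ring_subdomain)
  define f where "f = [:b, a:]"
  have fdvd: "content_dvd d f \<longleftrightarrow> d \<preceq> a \<and> d \<preceq> b" for d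
    by (auto simp: content_dvd_def f_def coeff_pCons split: nat.split)
  have f: "content_dvd 1 f" using a b by (simp add: fdvd)
  define Q where "Q = {to_fract p | p. content_dvd 1 p \<and> poly p (- b / a) = 0}"
  have memQ: "to_fract p \<in> Q \<longleftrightarrow> content_dvd 1 p \<and> poly p (- b / a) = 0" for p
    by (auto simp: Q_def)
  have QE: "\<exists>p. x = to_fract p \<and> content_dvd 1 p \<and> poly p (- b / a) = 0" if "x \<in> Q" for x
    using that by (auto simp: Q_def)
  have prime: "prime_ideal (poly_ring D) Q"
    unfolding prime_ideal_def submodule_def
  proof (intro conjI ballI impI psubsetI)
    show "0 \<in> Q" using memQ[of 0] by simp
    show "x + y \<in> Q" if xy: "x \<in> Q" "y \<in> Q" for x y
    proof -
      obtain p q where "x = to_fract p" "content_dvd 1 p" "poly p (- b / a) = 0"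
        "y = to_fract q" "content_dvd 1 q" "poly q (- b / a) = 0" using QE[OF xy(1)] QE[OF xy(2)] by blast
      then show ?thesis using memQ[of "p + q"] content_dvd_add[of 1 p q] by simp
    qed
    show "x * y \<in> Q" if xy: "x \<in> poly_ring D" "y \<in> Q" for x y
    proof -
      obtain p q where "x = to_fract p" "content_dvd 1 p"
        "y = to_fract q" "content_dvd 1 q" "poly q (- b / a) = 0"
        using QE[OF xy(2)] poly_ringE[OF xy(1)] by metis
      then show ?thesis using memQ[of "p * q"] content_dvd_mult[of 1 p 1 q] by simp
    qed
    show "Q \<subseteq> poly_ring D" using QE to_fract_mem_poly_ring by blast
    show "Q \<noteq> poly_ring D" using memQ[of 1] R.one_closed by auto
    show "x \<in> Q \<or> y \<in> Q" if xy: "x \<in> poly_ring D" "y \<in> poly_ring D" "x * y \<in> Q" for x y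
    proof -
      obtain p where p: "content_dvd 1 p" "x = to_fract p" using poly_ringE[OF xy(1)] .
      obtain q where q: "content_dvd 1 q" "y = to_fract q" using poly_ringE[OF xy(2)] .
      have "to_fract (p * q) \<in> Q" using xy(3) p q by simp
      then have "poly p (- b / a) * poly q (- b / a) = 0" unfolding memQ by simp
      then show ?thesis using p q memQ by auto
    qed
  qed
  moreover have "to_fract f \<in> Q" using f a by (simp add: memQ f_def)
  then have "Q \<noteq> {0}" using a by (auto simp: f_def)
  moreover have const: "Q \<inter> {to_fract [:d:] | d. d \<in> D} = {0}"
  proof
    show "Q \<inter> {to_fract [:d:] | d. d \<in> D} \<subseteq> {0}" using memQ by auto
    have "0 = to_fract [:0:]" by simp
    then show "{0} \<subseteq> Q \<inter> {to_fract [:d:] | d. d \<in> D}" using memQ[of 0] by auto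
  qed
  ultimately have "upper_to_zero D Q" by (simp add: upper_to_zero_def)
  then have max: "maximal_t_ideal (poly_ring D) Q" using UMT by (simp add: UMT_domain_def)
  define N where "N = principal (poly_ring D) (to_fract [:c:])"
  have cR: "to_fract [:c:] \<in> poly_ring D" using c by (simp add: to_fract_mem_poly_ring content_dvd_const)
  then have tN: "t_ideal (poly_ring D) N"
    unfolding N_def using c by (intro R.t_ideal_principal) auto
  have NI: "to_fract p \<in> N" if p: "content_dvd c p" for p
  proof -
    obtain p' where "p = smult c p'" "content_dvd 1 p'" using content_dvdE[OF p c(2)] .
    then have "to_fract p = to_fract [:c:] * to_fract p'" "to_fract p' \<in> poly_ring D"
      by (simp_all add: to_fract_mem_poly_ring flip: to_fract_mult)
    then show ?thesis unfolding N_def R.mem_principal_iff by (metis R.dvd_D_triv)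
  qed
  have "1 \<notin> N"
  proof
    assume "1 \<in> N"
    then obtain p where "p \<in> poly_ring D" "1 = to_fract [:c:] * p"
      unfolding N_def by (auto simp: principal_def)
    then obtain q where q: "content_dvd 1 q" "1 = to_fract [:c:] * to_fract q"
      by (metis poly_ringE)
    then have "to_fract 1 = to_fract ([:c:] * q)" by (simp only: to_fract_1 to_fract_mult)
    then have "1 = [:c:] * q" by (simp only: to_fract_eq_iff)
    then have "coeff 1 0 = coeff ([:c:] * q) 0" by (rule arg_cong)
    then have "1 = c * coeff q 0" by simp
    then have "c \<preceq> 1" using q(1) by (intro dvd_D_I[of "coeff q 0"]) (simp_all add: content_dvd_one_iff)
    then show False using c by blast
  qed
  then have "N \<noteq> poly_ring D" using R.one_closed by blast
  moreover have "N \<subseteq> poly_ring D" using R.dvd_D_closed[OF cR] by (auto simp: N_def R.mem_principal_iff)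
  moreover have "Q \<subseteq> N"
  proof
    fix x assume "x \<in> Q"
    then obtain p where p: "x = to_fract p" "content_dvd 1 p" "poly p (- b / a) = 0" using QE by blast
    have "[:- (- b / a), 1:] dvd p" using p(3) poly_eq_0_iff_dvd by blast
    then obtain h0 where h0: "p = [:- (- b / a), 1:] * h0" by (rule dvdE)
    define h where "h = smult (inverse a) h0"
    have "[:- (- b / a), 1:] = smult (inverse a) f" using a by (simp add: f_def field_simps)
    then have ph: "p = f * h" using h0 by (simp add: h_def)
    obtain \<delta> where \<delta>: "\<delta> \<in> D" "\<delta> \<noteq> 0" "content_dvd 1 (smult \<delta> h)" using common_denominator by blast
    have eq: "smult \<delta> p = f * smult \<delta> h" using ph by simp
    have "content_dvd (\<delta> * 1) (smult \<delta> p)" using p(2) by (rule content_dvd_smultI)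
    then have "content_dvd \<delta> (f * smult \<delta> h)" using eq by simp
    then obtain e k where ek: "e \<in> D" "k \<in> D" "\<delta> = e * k" "content_dvd e f" "content_dvd k (smult \<delta> h)"
      using gauss[OF \<delta>(1,2) f \<delta>(3)] by blast
    have e: "e \<preceq> a" "e \<preceq> b" using ek(4) fdvd by blast+
    have "content_dvd (e * c) f"
      unfolding fdvd using common_divisor_mult[OF v(1,2) inc ek(1) e c(1) v(4,5)]
        common_divisor_mult[OF v(2,1) inc(2,1) ek(1) e(2,1) c(1) v(5,4)] by blast
    then have "content_dvd ((e * c) * k) (smult \<delta> p)" unfolding eq using ek(5) by (rule content_dvd_mult)
    then have "content_dvd (\<delta> * c) (smult \<delta> p)" using ek(3) by (simp add: mult_ac)
    then have "content_dvd c p" using content_dvd_smult[OF \<delta>(2)] by blast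
    then show "x \<in> N" using NI p(1) by blast
  qed
  ultimately have "N = Q" using max tN unfolding maximal_t_ideal_def by blast
  moreover have "to_fract [:c:] \<in> N" using NI[of "[:c:]"] by (simp add: content_dvd_const)
  ultimately have "to_fract [:c:] \<in> Q \<inter> {to_fract [:d:] | d. d \<in> D}" using c by blast
  then show False using const c by auto
qed

text \<open>
  An element \<open>f\<close> of \<open>Q\<close> of least degree whose coefficients have no common nonunit divisor generates
  \<open>Q\<close>.  A larger \<open>t\<close>-ideal contains a nonzero constant \<open>d\<close>, because \<open>f\<close> is irreducible over the quotient
  field, and \<open>{f, d}\<close> has \<open>v\<close>-closure \<open>D[X]\<close> by Gauss's lemma.
\<close>

lemma UMT_domain_if_val_chains:
  assumes T: val_chains shows "UMT_domain D"
  unfolding UMT_domain_def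
proof (intro allI impI)
  fix Q assume "upper_to_zero D Q"
  then have prime: "prime_ideal (poly_ring D) Q" and Q0: "Q \<noteq> {0}"
    and const: "Q \<inter> {to_fract [:d:] | d. d \<in> D} = {0}" by (auto simp: upper_to_zero_def)
  interpret R: subdomain "poly_ring D" by (rule poly_ring_subdomain)
  have subQ: "submodule (poly_ring D) Q" "Q \<subseteq> poly_ring D" using prime by (auto simp: prime_ideal_def)
  have constQ: "to_fract [:d:] \<notin> Q" if "d \<in> D" "d \<noteq> 0" for d
  proof
    assume "to_fract [:d:] \<in> Q"
    then have "to_fract [:d:] \<in> Q \<inter> {to_fract [:d:] | d. d \<in> D}" using that by blast
    then show False using const that by auto
  qed
  have constR: "to_fract [:d:] \<in> poly_ring D \<longleftrightarrow> d \<in> D" for d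
    by (simp add: to_fract_mem_poly_ring content_dvd_const)
  have smultQ: "to_fract p \<in> Q" if "to_fract (smult d p) \<in> Q" "d \<in> D" "d \<noteq> 0" "content_dvd 1 p" for d p
  proof -
    have "to_fract [:d:] * to_fract p \<in> Q" using that(1) by (simp flip: to_fract_mult)
    then show ?thesis
      using R.prime_ideal_mult[OF prime, of "to_fract [:d:]" "to_fract p"] constQ that constR
      by (simp add: to_fract_mem_poly_ring)
  qed
  have multQ: "to_fract (p * q) \<in> Q" if "to_fract p \<in> Q" "content_dvd 1 q" for p q
  proof -
    have "to_fract q * to_fract p \<in> Q" using that subQ(1) to_fract_mem_poly_ring
      unfolding submodule_def by blast
    then show ?thesis by (simp add: mult.commute)
  qed
  define inQ where "inQ p \<longleftrightarrow> content_dvd 1 p \<and> p \<noteq> 0 \<and> to_fract p \<in> Q" for p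
  obtain x where "x \<in> Q" "x \<noteq> 0" using Q0 subQ(1) by (auto simp: submodule_def)
  then obtain p0 where "inQ p0" using subQ(2) by (auto simp: inQ_def elim!: poly_ringE)
  then obtain f0 where f0: "inQ f0" "\<And>p. inQ p \<Longrightarrow> degree f0 \<le> degree p"
    using ex_has_least_nat[of inQ p0 degree] by blast
  have "finite (range (coeff f0))" by (simp add: range_coeff)
  moreover have "range (coeff f0) \<subseteq> D" using f0 by (auto simp: inQ_def content_dvd_one_iff)
  moreover have "\<not> range (coeff f0) \<subseteq> {0}"
    using f0 by (auto simp: inQ_def poly_eq_iff)
  ultimately obtain g where g: "g \<in> D" "g \<noteq> 0"
    "ideal_inverse D (range (coeff f0)) = ideal_inverse D {g}"
    "\<And>s. s \<in> range (coeff f0) \<Longrightarrow> g \<preceq> s"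
    using val_chains_inverse_principal[OF T] by blast
  have "content_dvd g f0" using g(4) by (simp add: content_dvd_def)
  then obtain f where f: "f0 = smult g f" "content_dvd 1 f" using content_dvdE g(2) by blast
  have f_ne: "f \<noteq> 0" using f0 f by (auto simp: inQ_def)
  have fQ: "to_fract f \<in> Q" using smultQ[of g f] f0 f g by (simp add: inQ_def)
  have fmin: "degree f \<le> degree p" if "content_dvd 1 p" "p \<noteq> 0" "to_fract p \<in> Q" for p
    using f0(2)[of p] f(1) g(2) that by (simp add: inQ_def)
  have primitive: "e \<preceq> 1" if e: "e \<in> D" "content_dvd e f" for e
  proof -
    have e0: "e \<noteq> 0"
    proof
      assume "e = 0"
      then have "coeff f i = 0" for i using e(2) by (auto simp: content_dvd_def divides_in_def)
      then show False using f_ne by (simp add: poly_eq_iff)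
    qed
    have "content_dvd (g * e) f0" unfolding f(1) using e(2) by (rule content_dvd_smultI)
    then have "inverse (g * e) \<in> ideal_inverse D (range (coeff f0))"
      using g(2) e0 by (auto simp: mem_inverse_iff content_dvd_def dvd_D_iff field_simps)
    then have "inverse (g * e) * g \<in> D" unfolding g(3) by (simp add: mem_inverse_iff)
    then show ?thesis using g(2) e0 by (simp add: dvd_D_iff field_simps)
  qed
  have gauss_f: "content_dvd d q" if d: "d \<in> D" "d \<noteq> 0" "content_dvd 1 q" "content_dvd d (f * q)" for d q
  proof -
    obtain e k where ek: "e \<in> D" "k \<in> D" "d = e * k" "content_dvd e f" "content_dvd k q"
      using gauss[OF d(1,2) f(2) d(3,4)] by blast
    have "e * k \<preceq> 1 * k" using primitive[OF ek(1,4)] by (intro dvd_D_mult_mono) auto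
    then show ?thesis using content_dvd_trans ek(3,5) by simp
  qed
  have gen: "\<exists>q. content_dvd 1 q \<and> h = f * q" if h: "content_dvd 1 h" "to_fract h \<in> Q" for h
  proof -
    obtain \<delta>1 where \<delta>1: "\<delta>1 \<in> D" "\<delta>1 \<noteq> 0" "content_dvd 1 (smult \<delta>1 (h div f))"
      using common_denominator by blast
    define q where "q = smult \<delta>1 (h div f)"
    have eq: "smult \<delta>1 (h mod f) = smult \<delta>1 h - f * q"
    proof -
      have "h = f * (h div f) + h mod f" by simp
      then have "smult \<delta>1 h = f * q + smult \<delta>1 (h mod f)"
        unfolding q_def by (metis mult_smult_right smult_add_right)
      then show ?thesis by simp
    qed
    have q: "content_dvd 1 q" using \<delta>1(3) by (simp add: q_def)
    have \<delta>h: "content_dvd 1 (smult \<delta>1 h)"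
      using content_dvd_smultI[OF h(1), of \<delta>1] content_dvd_one[OF \<delta>1(1)] by simp
    have r: "content_dvd 1 (smult \<delta>1 (h mod f))"
      unfolding eq using content_dvd_diff[OF \<delta>h] content_dvd_mult[OF f(2) q] by simp
    have "to_fract (smult \<delta>1 (h mod f)) \<in> Q"
    proof -
      have 1: "to_fract (h * [:\<delta>1:]) \<in> Q" using h(2) \<delta>1 by (intro multQ) (auto simp: content_dvd_const)
      have "to_fract (f * (- q)) \<in> Q"
        using fQ content_dvd_diff[of 0 q] q by (intro multQ) auto
      then have "to_fract (h * [:\<delta>1:]) + to_fract (f * (- q)) \<in> Q"
        using 1 subQ(1) unfolding submodule_def by blast
      moreover have "smult \<delta>1 (h mod f) = h * [:\<delta>1:] + f * (- q)" unfolding eq by simp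
      ultimately show ?thesis by (simp only: to_fract_add)
    qed
    then have "degree f \<le> degree (h mod f)" if "h mod f \<noteq> 0"
      using fmin[OF r] that \<delta>1(2) by simp
    moreover have "degree (h mod f) < degree f" if "h mod f \<noteq> 0"
      using degree_mod_less'[OF f_ne that] .
    ultimately have "h mod f = 0" by fastforce
    then have eq2: "smult \<delta>1 h = f * q" using eq by simp
    have "content_dvd \<delta>1 (f * q)" using content_dvd_smultI[OF h(1), of \<delta>1] eq2 by simp
    then have "content_dvd \<delta>1 q" using gauss_f \<delta>1 q by blast
    then obtain q' where q': "q = smult \<delta>1 q'" "content_dvd 1 q'" using content_dvdE \<delta>1(2) by blast
    have "smult (inverse \<delta>1) (smult \<delta>1 h) = smult (inverse \<delta>1) (smult \<delta>1 (f * q'))"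
      using eq2 q'(1) by simp
    then have "h = f * q'" using \<delta>1(2) by simp
    then show ?thesis using q'(2) by blast
  qed
  have "Q = principal (poly_ring D) (to_fract f)"
  proof (intro equalityI subsetI)
    fix x assume x: "x \<in> Q"
    then obtain h where h: "content_dvd 1 h" "x = to_fract h" using subQ(2) by (auto elim!: poly_ringE)
    then obtain q where q: "content_dvd 1 q" "h = f * q" using gen x by blast
    then have "x = to_fract f * to_fract q" "to_fract q \<in> poly_ring D"
      using h by (simp_all add: to_fract_mem_poly_ring)
    then show "x \<in> principal (poly_ring D) (to_fract f)"
      unfolding R.mem_principal_iff by (metis R.dvd_D_triv)
  next
    fix x assume "x \<in> principal (poly_ring D) (to_fract f)"
    then show "x \<in> Q" using R.prime_ideal_dvd[OF prime fQ] by (simp add: R.mem_principal_iff)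
  qed
  then have "t_ideal (poly_ring D) Q"
    using R.t_ideal_principal[of "to_fract f"] f_ne f(2) by (simp add: to_fract_mem_poly_ring)
  moreover have "N = Q" if N: "t_ideal (poly_ring D) N" "N \<subset> poly_ring D" "Q \<subseteq> N" for N
  proof (rule ccontr)
    assume "N \<noteq> Q"
    then obtain x where "x \<in> N" "x \<notin> Q" using N(3) by blast
    then obtain h where h: "content_dvd 1 h" "to_fract h \<in> N" "to_fract h \<notin> Q"
      using N(2) by (auto elim!: poly_ringE)
    have subN: "submodule (poly_ring D) N" using N(1) by (rule R.t_ideal_submodule)
    have fN: "to_fract f \<in> N" using fQ N(3) by blast
    have multN: "to_fract (p * q) \<in> N" if "to_fract q \<in> N" "content_dvd 1 p" for p q
      using subN that to_fract_mem_poly_ring unfolding submodule_def by simp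
    have addN: "to_fract (p + q) \<in> N" if "to_fract p \<in> N" "to_fract q \<in> N" for p q
      using subN that unfolding submodule_def by simp
    have not_dvd: "\<not> f dvd h"
    proof
      assume "f dvd h"
      then obtain m where m: "h = f * m" by (rule dvdE)
      obtain \<delta> where \<delta>: "\<delta> \<in> D" "\<delta> \<noteq> 0" "content_dvd 1 (smult \<delta> m)" using common_denominator by blast
      have "to_fract (f * smult \<delta> m) \<in> Q" using fQ \<delta>(3) by (rule multQ)
      then have "to_fract (smult \<delta> h) \<in> Q" using m by simp
      then show False using smultQ[of \<delta> h] \<delta> h by blast
    qed
    define comb where "comb p \<longleftrightarrow> p \<noteq> 0 \<and> (\<exists>\<alpha> \<beta>. p = \<alpha> * f + \<beta> * h)" for p
    have "comb f" unfolding comb_def using f_ne by (intro conjI exI[of _ 1] exI[of _ 0]) auto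
    then obtain w where w: "comb w" "\<And>p. comb p \<Longrightarrow> degree w \<le> degree p"
      using ex_has_least_nat[of comb f degree] by blast
    have w0: "w \<noteq> 0" using w by (simp add: comb_def)
    obtain \<alpha> \<beta> where \<alpha>\<beta>: "w = \<alpha> * f + \<beta> * h" using w by (auto simp: comb_def)
    have w_dvd: "w dvd \<alpha>' * f + \<beta>' * h" for \<alpha>' \<beta>'
    proof (rule ccontr)
      define p where "p = \<alpha>' * f + \<beta>' * h"
      assume "\<not> w dvd \<alpha>' * f + \<beta>' * h"
      then have nz: "p mod w \<noteq> 0" by (simp add: p_def mod_eq_0_iff_dvd)
      have "p mod w = p - (p div w) * w" by (simp add: minus_div_mult_eq_mod)
      also have "\<dots> = (\<alpha>' - (p div w) * \<alpha>) * f + (\<beta>' - (p div w) * \<beta>) * h"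
        unfolding p_def[symmetric] by (subst (2) \<alpha>\<beta>, subst (1) p_def) (simp add: algebra_simps)
      finally have "comb (p mod w)" using nz unfolding comb_def by blast
      then have "degree w \<le> degree (p mod w)" by (rule w(2))
      then show False using degree_mod_less'[OF w0 nz] by simp
    qed
    have wf: "w dvd f" and wh: "w dvd h" using w_dvd[of 1 0] w_dvd[of 0 1] by simp_all
    obtain k where k: "f = w * k" using wf by (rule dvdE)
    obtain \<delta>1 where \<delta>1: "\<delta>1 \<in> D" "\<delta>1 \<noteq> 0" "content_dvd 1 (smult \<delta>1 w)" using common_denominator by blast
    obtain \<delta>2 where \<delta>2: "\<delta>2 \<in> D" "\<delta>2 \<noteq> 0" "content_dvd 1 (smult \<delta>2 k)" using common_denominator by blast
    have "to_fract (f * [:\<delta>1 * \<delta>2:]) \<in> Q"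
      using fQ \<delta>1 \<delta>2 by (intro multQ) (auto simp: content_dvd_const)
    moreover have "f * [:\<delta>1 * \<delta>2:] = smult \<delta>1 w * smult \<delta>2 k" using k by (simp add: mult_ac)
    ultimately have "to_fract (smult \<delta>1 w) * to_fract (smult \<delta>2 k) \<in> Q" by (simp only: to_fract_mult)
    then have "to_fract (smult \<delta>1 w) \<in> Q \<or> to_fract (smult \<delta>2 k) \<in> Q"
      using \<delta>1 \<delta>2 by (intro R.prime_ideal_mult[OF prime]) (simp_all add: to_fract_mem_poly_ring)
    moreover have "to_fract (smult \<delta>1 w) \<notin> Q"
    proof
      assume "to_fract (smult \<delta>1 w) \<in> Q"
      then have "f dvd smult \<delta>1 w" using gen[OF \<delta>1(3)] by auto
      then have "f dvd w" using \<delta>1(2) by (simp add: dvd_smult_iff)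
      then show False using wh not_dvd dvd_trans by blast
    qed
    ultimately have "to_fract (smult \<delta>2 k) \<in> Q" by blast
    moreover have k0: "k \<noteq> 0" using k f_ne by auto
    ultimately have "degree f \<le> degree k" using fmin[OF \<delta>2(3)] \<delta>2(2) by simp
    then have "degree w = 0" using k degree_mult_eq[OF w0 k0] by simp
    then obtain w' where w': "w = [:w':]" by (rule degree_eq_zeroE)
    obtain \<delta>3 where \<delta>3: "\<delta>3 \<in> D" "\<delta>3 \<noteq> 0" "content_dvd 1 (smult \<delta>3 \<alpha>)" using common_denominator by blast
    obtain \<delta>4 where \<delta>4: "\<delta>4 \<in> D" "\<delta>4 \<noteq> 0" "content_dvd 1 (smult \<delta>4 \<beta>)" using common_denominator by blast
    define d where "d = \<delta>3 * \<delta>4 * w'"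
    have "content_dvd 1 (smult \<delta>4 (smult \<delta>3 \<alpha>))"
      using content_dvd_smultI[OF \<delta>3(3), of \<delta>4] content_dvd_one[OF \<delta>4(1)] by simp
    moreover have "content_dvd 1 (smult \<delta>3 (smult \<delta>4 \<beta>))"
      using content_dvd_smultI[OF \<delta>4(3), of \<delta>3] content_dvd_one[OF \<delta>3(1)] by simp
    ultimately have "to_fract (smult \<delta>4 (smult \<delta>3 \<alpha>) * f + smult \<delta>3 (smult \<delta>4 \<beta>) * h) \<in> N"
      by (intro addN multN fN h(2))
    moreover have "smult \<delta>4 (smult \<delta>3 \<alpha>) * f + smult \<delta>3 (smult \<delta>4 \<beta>) * h = smult (\<delta>3 * \<delta>4) w"
      unfolding \<alpha>\<beta> by (simp add: smult_add_right mult.commute)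
    ultimately have "to_fract (smult (\<delta>3 * \<delta>4) w) \<in> N" by (simp only:)
    then have dN: "to_fract [:d:] \<in> N" using w' by (simp add: d_def)
    then have dD: "d \<in> D" using N(2) constR by blast
    have d0: "d \<noteq> 0" using \<delta>3(2) \<delta>4(2) w0 w' by (simp add: d_def)
    have "1 \<in> v_closure (poly_ring D) {to_fract f, to_fract [:d:]}"
      unfolding R.mem_v_closure_iff
    proof (intro allI impI)
      fix u assume "\<forall>s\<in>{to_fract f, to_fract [:d:]}. u * s \<in> poly_ring D"
      then have u: "u * to_fract f \<in> poly_ring D" "u * to_fract [:d:] \<in> poly_ring D" by auto
      obtain r where r: "content_dvd 1 r" "u * to_fract f = to_fract r" using u(1) by (rule poly_ringE)
      obtain s where s: "content_dvd 1 s" "u * to_fract [:d:] = to_fract s" using u(2) by (rule poly_ringE)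
      have "to_fract (f * s) = u * to_fract f * to_fract [:d:]" using s(2) by (simp add: mult_ac)
      also have "\<dots> = to_fract ([:d:] * r)" using r(2) by (simp only: to_fract_mult mult.commute)
      finally have "f * s = smult d r" by (simp only: to_fract_eq_iff) simp
      then have "content_dvd d (f * s)" using content_dvd_smultI[OF r(1), of d] by simp
      then have "content_dvd d s" using gauss_f dD d0 s(1) by blast
      then obtain s' where s': "s = smult d s'" "content_dvd 1 s'" using content_dvdE d0 by blast
      have "s = [:d:] * s'" using s'(1) by simp
      then have "u * to_fract [:d:] = to_fract s' * to_fract [:d:]" using s(2) by (simp only: to_fract_mult mult.commute)
      then have "u = to_fract s'" using d0 by simp
      then show "u * 1 \<in> poly_ring D" using s'(2) by (simp add: to_fract_mem_poly_ring)
    qed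
    moreover have "v_closure (poly_ring D) {to_fract f, to_fract [:d:]} \<subseteq> N"
      using fN dN by (intro R.t_idealD[OF N(1)]) auto
    ultimately have "poly_ring D \<subseteq> N" using R.submodule_one[OF subN] by blast
    then show False using N(2) by blast
  qed
  ultimately show "maximal_t_ideal (poly_ring D) Q"
    using prime unfolding maximal_t_ideal_def prime_ideal_def by blast
qed

end

section \<open>The equivalence\<close>

theorem theorem4p11:
  fixes D :: "'k::field set"
  assumes "domain_with_qf_UNIV D"
    and "VFD D"
  shows "((weakly_Matlis D \<and> GCD_domain D) \<longleftrightarrow> UVFD D)
    \<and> (UVFD D \<longleftrightarrow> PvMD D)
    \<and> (PvMD D \<longleftrightarrow> t_treed D)
    \<and> (t_treed D \<longleftrightarrow>
         (\<forall>I P. I \<subseteq> D \<and> t_finite_t_ideal D I \<and> minimal_prime_over D I P \<longrightarrow>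
            (\<exists>J. J \<subseteq> D \<and> t_ideal D J \<and> t_invertible D J \<and> minimal_prime_over D J P)))
    \<and> ((\<forall>I P. I \<subseteq> D \<and> t_finite_t_ideal D I \<and> minimal_prime_over D I P \<longrightarrow>
            (\<exists>J. J \<subseteq> D \<and> t_ideal D J \<and> t_invertible D J \<and> minimal_prime_over D J P))
         \<longleftrightarrow> t_finite_conductor_domain D)
    \<and> (t_finite_conductor_domain D \<longleftrightarrow> UMT_domain D)"
proof -
  interpret vfd D
    using assms by unfold_locales (auto simp: domain_with_qf_UNIV_def)
  have 1: "(weakly_Matlis D \<and> GCD_domain D) \<longleftrightarrow> val_chains"
    using weakly_Matlis val_chains_if_GCD GCD_if_val_chains by blast
  have 2: "UVFD D \<longleftrightarrow> val_chains"
    using val_chains_if_UVFD UVFD_if_val_chains by blast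
  have 3: "PvMD D \<longleftrightarrow> val_chains"
    using val_chains_if_PvMD PvMD_if_val_chains by blast
  have 4: "t_treed D \<longleftrightarrow> val_chains"
    using val_chains_if_t_treed t_treed_if_val_chains by blast
  have 5: "(\<forall>I P. I \<subseteq> D \<and> t_finite_t_ideal D I \<and> minimal_prime_over D I P \<longrightarrow>
      (\<exists>J. J \<subseteq> D \<and> t_ideal D J \<and> t_invertible D J \<and> minimal_prime_over D J P)) \<longleftrightarrow> val_chains"
    (is "?minimal \<longleftrightarrow> _")
  proof
    assume ?minimal then show val_chains by (intro val_chains_if_minimal_primes) simp
  next
    assume T: val_chains
    show ?minimal by (intro allI impI, elim conjE) (rule minimal_primes_if_val_chains[OF T])
  qed
  have 6: "t_finite_conductor_domain D \<longleftrightarrow> val_chains"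
    using val_chains_if_t_finite_conductor t_finite_conductor_if_val_chains by blast
  have 7: "UMT_domain D \<longleftrightarrow> val_chains"
    using val_chains_if_UMT_domain UMT_domain_if_val_chains by blast
  show ?thesis unfolding 1 2 3 4 5 6 7 by blast
qed

end
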